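(* Let $n\in\mathbb{N}$, $n\ge3$, $\varepsilon\in(0,\frac{4}{n-2})$, and let $w_\varepsilon\in C^2([0,\infty))$ be (the profile of) the radial solution of $$-\Delta w_\varepsilon=|w_\varepsilon|^{\frac{4}{n-2}-\varepsilon}w_\varepsilon\ \text{ in }\mathbb{R}^n,\qquad w_\varepsilon(0)=1.$$ Let $(r_{i,\varepsilon})_{i=1}^\infty$ and $(s_{i,\varepsilon})_{i=1}^\infty$ be respectively the (divergent) increasing sequences of all zeros and all critical points of $w_\varepsilon$, such that $$0=s_{1,\varepsilon}<r_{1,\varepsilon}<s_{2,\varepsilon}<r_{2,\varepsilon}<\ldots<s_{i,\varepsilon}<r_{i,\varepsilon}<\ldots$$ Then \begin{align*} \lim_{\varepsilon\to0}r_{m,\varepsilon}(\kappa_n\varepsilon)^{\frac{2m-1}{n-2}}&=(n(n-2))^{\frac12}\,m^{\frac{1}{2-n}}\,\Gamma(m)^{-\frac{2}{n-2}} &&\text{for }m\ge1,\\ \lim_{\varepsilon\to0}|w_\varepsilon'(r_{m,\varepsilon})|(\kappa_n\varepsilon)^{\frac{1-mn}{n-2}}&=\left(\frac{n-2}{n}\right)^{\frac12}m^{\frac{n-1}{n-2}}\,\Gamma(m)^{\frac{n}{n-2}} &&\text{for }m\ge1,\\ \lim_{\varepsilon\to0}s_{m,\varepsilon}(\kappa_n\varepsilon)^{\frac{2mn-3n+2}{n(n-2)}}&=(n(n-2))^{\frac12}(m-1)^{\frac1n}\,\Gamma(m)^{-\frac{2}{n-2}} &&\text{for }m\ge2,\\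 \lim_{\varepsilon\to0}|w_\varepsilon(s_{m,\varepsilon})|(\kappa_n\varepsilon)^{1-m}&=\Gamma(m) &&\text{for }m\ge2. \end{align*}
   Context: A radial function $w$ on $\mathbb{R}^n$ is identified with its profile $r\mapsto w(r)$, $r=|x|\in[0,\infty)$; zeros, critical points and $'$ refer to the profile. It is known that $w_\varepsilon$ has infinitely many oscillations, with exactly one critical point (a local maximum or minimum) between two consecutive zeros. $\Gamma$ is the Gamma function and $\kappa_n:=\frac{n-2}{4}\frac{\Gamma(n/2)^2}{\Gamma(n)}$. *)

theory Defs
  imports "HOL-Analysis.Analysis"
begin

definition C2_on :: "'a::real_normed_vector set \<Rightarrow> ('a \<Rightarrow> 'b::real_normed_vector) \<Rightarrow> bool" where
  "C2_on S u \<longleftrightarrow> (\<exists>D D2.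
     (\<forall>x\<in>S. (u has_derivative blinfun_apply (D x)) (at x within S)) \<and>
     (\<forall>x\<in>S. (D has_derivative blinfun_apply (D2 x)) (at x within S)) \<and>
     continuous_on S D2)"

definition partial_deriv :: "'n \<Rightarrow> (real^'n \<Rightarrow> real) \<Rightarrow> real^'n \<Rightarrow> real" where
  "partial_deriv i u x = deriv (\<lambda>t. u (x + t *\<^sub>R axis i 1)) 0"

text \<open>\<open>deriv\<close> is unspecified where a derivative does not exist, so the Laplacian is meaningful
  only together with a regularity condition such as \<open>C2_on\<close>.\<close>

definition laplacian :: "(real^'n \<Rightarrow> real) \<Rightarrow> real^'n \<Rightarrow> real" where
  "laplacian u x = (\<Sum>i\<in>UNIV. partial_deriv i (partial_deriv i u) x)"

definition classical_solution :: "real \<Rightarrow> (real^'n \<Rightarrow> real) \<Rightarrow> bool" where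
  "classical_solution q u \<longleftrightarrow>
     C2_on UNIV u \<and> (\<forall>x. - laplacian u x = \<bar>u x\<bar> powr q * u x)"

text \<open>Zeros and critical points of a radial function are those of its profile on \<open>[0,\<infinity>)\<close>; the
  derivative at \<open>0\<close> is one-sided, and values of the profile at negative reals are irrelevant.\<close>

definition zeros :: "(real \<Rightarrow> real) \<Rightarrow> real set" where
  "zeros w = {\<rho>. 0 \<le> \<rho> \<and> w \<rho> = 0}"

definition critical_points :: "(real \<Rightarrow> real) \<Rightarrow> real set" where
  "critical_points w = {\<rho>. 0 \<le> \<rho> \<and> (w has_real_derivative 0) (at \<rho> within {0..})}"

definition kappa :: "nat \<Rightarrow> real" where
  "kappa n = (real n - 2) / 4 * ((Gamma (real n / 2))\<^sup>2 / Gamma (real n))"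

end

theory Submission
  imports Defs
begin

text \<open>Write \<open>\<alpha> = (n - 2) / 2\<close>, \<open>q = 4 / (n - 2) - \<epsilon>\<close>, and let \<open>P\<close> be the Pohozaev functional of the
  radial equation, so that \<open>P' = \<delta> r\<^bsup>n - 1\<^esup> |w|\<^bsup>q + 2\<^esup>\<close> with \<open>\<delta>\<close> of order \<open>\<epsilon>\<close>.
  Between a critical point of height \<open>M\<close> and the next zero, \<open>w\<close> is, after rescaling, close to the
  critical bubble \<open>U\<close>. Hence at the \<open>m\<close>-th zero the flux \<open>r\<^bsup>n - 1\<^esup> |w'|\<close> is asymptotically \<open>A / M\<close>, and
  as every nodal region adds the same energy \<open>S\<close>, \<open>P = r\<^bsup>n\<^esup> |w'|\<^sup>2 / 2\<close> is asymptotically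
  \<open>m \<delta> S\<close>; these two relations determine \<open>r\<close> and \<open>|w'|\<close>. Beyond the zero \<open>w\<close> is nearly
  harmonic and rises to the plateau \<open>r |w'| / (n - 2)\<close>, which is the next height; the next
  critical point is located by balancing the flux. The recursion for the heights, with ratio
  \<open>m \<kappa>\<^sub>n \<epsilon>\<close>, produces the Gamma function.\<close>

section \<open>Radial solutions and their integral identities\<close>

text \<open>Origin of the ratio \<open>m * kappa n * \<epsilon>\<close>: at a zero put
  \<open>B = r ^ (n - 1) * |w'|\<close>. There \<open>P = B^2 / (2 * r ^ (n - 2))\<close>, so the
  plateau \<open>B / (2 * \<alpha> * r ^ (n - 2))\<close> equals \<open>P / (\<alpha> * B)\<close>.
  The constant \<open>kappa n\<close> is normalised so that one region contributes
  \<open>\<alpha> * A * kappa n * \<epsilon>\<close> to \<open>P\<close>; with \<open>B\<close>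
  close to \<open>A / M\<close> the plateau is close to \<open>m * kappa n * \<epsilon> * M\<close>.
  Main obstacle: the rescaled regions grow to the whole half-line, so local convergence to
  \<open>U\<close> does not give convergence of the flux and energy integrals. Subcriticality
  supplies uniform decay: \<open>P\<close> is nonnegative on a falling piece, which makes
  \<open>W powr (- q / 2)\<close> convex in the variable \<open>r powr (q * \<alpha>)\<close> and
  keeps \<open>W\<close> below a bubble-like profile. The matching lower bound comes from a Green
  representation instead of continuous dependence for the singular equation. Rescaling is exact only
  up to factors \<open>M powr (q * \<alpha> - 2)\<close>, whose exponent has order \<epsilon>. They
  tend to 1 because \<open>M\<close> is comparable to a power of \<epsilon>; hence the induction
  carries the exact order of \<open>M\<close>.\<close>

declare One_nat_def [simp del]

locale dimension =
  fixes n :: nat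
  assumes n3: "n \<ge> 3"
begin

text \<open>The critical exponent 4 / (n - 2) is \<open>2 / \<alpha>\<close>, so
  \<open>q * \<alpha> < 2\<close> is subcriticality.\<close>

definition \<alpha> :: real where "\<alpha> = (real n - 2) / 2"

lemma alpha_pos: "\<alpha> > 0" and alpha_ge: "\<alpha> \<ge> 1/2" and n_alpha: "real n = 2 * \<alpha> + 2"
  using n3 by (auto simp: \<alpha>_def field_simps)

lemma power_n: "x ^ n = x * x ^ (n - 1)" "x ^ (n - 1) = x * x ^ (n - 2)" for x :: real
proof -
  have "n = Suc (n - 1)" "n - 1 = Suc (n - 2)" using n3 by auto
  then show "x ^ n = x * x ^ (n - 1)" "x ^ (n - 1) = x * x ^ (n - 2)"
    using power_Suc by metis+
qed

lemma power_integral: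
  assumes "0 \<le> s" "s \<le> t"
  shows "((\<lambda>s. s ^ (n - 1)) has_integral t ^ n / n - s ^ n / n) {s..t}"
  using assms n3
  by (intro fundamental_theorem_of_calculus)
     (auto simp: has_real_derivative_iff_has_vector_derivative[symmetric] intro!: derivative_eq_intros
       simp: One_nat_def[symmetric])

text \<open>This is s^(n-1) (s^(2-n) - b^(2-n)) / (n-2): the radial Green function of the ball of
  radius b with pole at the origin, times the weight s^(n-1).\<close>

definition green :: "real \<Rightarrow> real \<Rightarrow> real" where
  "green b s = (s - s ^ (n - 1) / b ^ (n - 2)) / (2 * \<alpha>)"

lemma green_bounds:
  assumes "0 \<le> s" "s \<le> b" "0 < b"
  shows "0 \<le> green b s" "green b s \<le> s"
proof -
  have "s ^ (n - 2) \<le> b ^ (n - 2)" using assms by (intro power_mono) auto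
  then have 1: "s ^ (n - 1) / b ^ (n - 2) \<le> s"
    using assms unfolding power_n(2) by (auto simp: field_simps intro: mult_left_mono)
  have "0 \<le> s ^ (n - 1) / b ^ (n - 2)" using assms by simp
  moreover have "s * 1 \<le> s * (2 * \<alpha>)" using assms alpha_ge by (intro mult_left_mono) auto
  ultimately show "0 \<le> green b s" "green b s \<le> s" using assms 1 alpha_pos
      \<open>0 \<le> s ^ (n - 1) / b ^ (n - 2)\<close>
    unfolding green_def by (auto simp: pos_divide_le_eq simp del: zero_le_divide_iff)
qed

lemma green_mono:
  assumes "0 \<le> s" "0 < b" "b \<le> b'"
  shows "green b s \<le> green b' s"
proof -
  have "b ^ (n - 2) \<le> b' ^ (n - 2)" using assms by (intro power_mono) auto
  then have "s ^ (n - 1) / b' ^ (n - 2) \<le> s ^ (n - 1) / b ^ (n - 2)"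
    using assms by (intro divide_left_mono) auto
  then show ?thesis using alpha_pos by (auto simp: green_def intro!: divide_right_mono)
qed

lemma green_self: "b > 0 \<Longrightarrow> green b b = 0"
  unfolding green_def power_n(2) by simp

lemma continuous_green [continuous_intros]: "b > 0 \<Longrightarrow> continuous_on S (green b)"
  using alpha_pos unfolding green_def[abs_def] by (intro continuous_intros) auto

end

text \<open>The equation is imposed for r > 0 only, away from the singular coefficient (n - 1) / r;
  continuity at 0 lets the integral identities start there. The bound \<open>q_le\<close> is not
  strict, so that the critical bubble is an instance.\<close>

locale radial_solution = dimension +
  fixes q :: real and W W' :: "real \<Rightarrow> real"
  assumes q_pos: "0 < q" and q_le: "q * \<alpha> \<le> 2"
    and W_deriv: "\<And>r. 0 < r \<Longrightarrow> (W has_real_derivative W' r) (at r)"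
    and W'_deriv: "\<And>r. 0 < r \<Longrightarrow>
      (W' has_real_derivative - (real n - 1) / r * W' r - \<bar>W r\<bar> powr q * W r) (at r)"
    and W_cont: "continuous_on {0..} W" and W'_cont: "continuous_on {0..} W'"
begin

lemma W_cont' [continuous_intros]: "0 \<le> a \<Longrightarrow> continuous_on {a..b} W"
  by (rule continuous_on_subset[OF W_cont]) auto

lemma W'_cont' [continuous_intros]: "0 \<le> a \<Longrightarrow> continuous_on {a..b} W'"
  by (rule continuous_on_subset[OF W'_cont]) auto

definition flux :: "real \<Rightarrow> real" where "flux r = - (r ^ (n - 1) * W' r)"

definition pohozaev :: "real \<Rightarrow> real" where
  "pohozaev r = r ^ n * ((W' r)\<^sup>2 / 2 + \<bar>W r\<bar> powr (q + 2) / (q + 2)) + \<alpha> * r ^ (n - 1) * W r * W' r"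

text \<open>Vanishes exactly at the critical exponent \<open>q = 2 / \<alpha>\<close>, where
  \<open>pohozaev\<close> is conserved.\<close>

definition \<delta> :: real where "\<delta> = real n / (q + 2) - \<alpha>"

lemma delta_pos: "q * \<alpha> < 2 \<Longrightarrow> \<delta> > 0"
  using q_pos by (simp add: \<delta>_def n_alpha less_divide_eq field_simps)

lemma flux_deriv:
  assumes "0 < r" "0 \<le> W r"
  shows "(flux has_real_derivative r ^ (n - 1) * W r powr (q + 1)) (at r)"
proof -
  have *: "\<bar>W r\<bar> powr q * W r = W r powr (q + 1)"
    using assms by (auto simp: powr_add)
  have "real (n - 1) = real n - 1" using n3 by auto
  moreover have "n - 1 - 1 = n - 2" by auto
  ultimately show ?thesis unfolding flux_def[abs_def]
    using W'_deriv[OF \<open>0 < r\<close>] assms(1) power_n[of r]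
    unfolding *
    by (auto intro!: derivative_eq_intros simp: field_simps)
qed

lemma flux_integral:
  assumes "0 \<le> a" "a \<le> b" "\<And>s. a < s \<Longrightarrow> s < b \<Longrightarrow> 0 \<le> W s"
  shows "((\<lambda>s. s ^ (n - 1) * W s powr (q + 1)) has_integral flux b - flux a) {a..b}"
proof (intro fundamental_theorem_of_calculus_interior)
  show "continuous_on {a..b} flux"
    unfolding flux_def[abs_def] using assms by (intro continuous_intros) auto
qed (use assms in \<open>auto simp: has_real_derivative_iff_has_vector_derivative[symmetric]
       intro!: flux_deriv\<close>)

text \<open>The kernel g solves g' - (n-1) g / s + 1 = 0, so in the derivative of g W' + W only the
  source term survives; g vanishes at b, which removes W' b from the boundary terms.\<close>

lemma green_integral:
  assumes "0 \<le> a" "a < b" "\<And>s. a < s \<Longrightarrow> s < b \<Longrightarrow> 0 \<le> W s"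
  shows "((\<lambda>s. green b s * W s powr (q + 1)) has_integral W a + green b a * W' a - W b) {a..b}"
proof -
  define F where "F = (\<lambda>s. - (green b s * W' s + W s))"
  have "((\<lambda>s. green b s * W s powr (q + 1)) has_integral F b - F a) {a..b}"
  proof (intro fundamental_theorem_of_calculus_interior)
    show "continuous_on {a..b} F" unfolding F_def using assms by (intro continuous_intros) auto
    fix s assume s: "s \<in> {a<..<b}"
    then have s0: "0 < s" "0 \<le> W s" "0 < b" using assms by auto
    have *: "\<bar>W s\<bar> powr q * W s = W s powr (q + 1)"
      using s0 by (auto simp: powr_add)
    have k: "real (n - 1) = real n - 1" "n - 1 - 1 = n - 2" using n3 by auto
    have "(green b has_real_derivative (1 - (real n - 1) * s ^ (n - 2) / b ^ (n - 2)) / (2 * \<alpha>)) (at s)"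
      unfolding green_def[abs_def] using s0 k alpha_pos
      by (auto intro!: derivative_eq_intros simp: field_simps)
    from DERIV_minus[OF DERIV_add[OF DERIV_mult[OF this W'_deriv[OF s0(1)]] W_deriv[OF s0(1)]]]
    have "(F has_real_derivative - ((1 - (real n - 1) * s ^ (n - 2) / b ^ (n - 2)) / (2 * \<alpha>) * W' s
        + (- (real n - 1) / s * W' s - \<bar>W s\<bar> powr q * W s) * green b s + W' s)) (at s)"
      unfolding F_def .
    also have "- ((1 - (real n - 1) * s ^ (n - 2) / b ^ (n - 2)) / (2 * \<alpha>) * W' s
        + (- (real n - 1) / s * W' s - \<bar>W s\<bar> powr q * W s) * green b s + W' s)
        = green b s * W s powr (q + 1)"
    proof -
      have "(1 - (real n - 1) * s ^ (n - 2) / b ^ (n - 2)) / (2 * \<alpha>)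
         - (real n - 1) / s * green b s + 1 = 0"
        using s0 alpha_pos unfolding green_def power_n(2) n_alpha by (simp add: field_simps)
      moreover have "- (G * W' s + (- (real n - 1) / s * W' s - Y) * g + W' s)
        = g * Y - (G - (real n - 1) / s * g + 1) * W' s" for G Y g
        by (simp add: algebra_simps add_divide_distrib diff_divide_distrib)
      ultimately show ?thesis unfolding * by (simp only: mult_zero_left diff_zero)
    qed
    finally show "(F has_vector_derivative green b s * W s powr (q + 1)) (at s)"
      by (simp add: has_real_derivative_iff_has_vector_derivative)
  qed (use assms in auto)
  moreover have "F b - F a = W a + green b a * W' a - W b"
    using assms by (simp add: F_def green_self)
  ultimately show ?thesis by simp
qed

lemma pohozaev_deriv:
  assumes "0 < r" "0 < W r"
  shows "(pohozaev has_real_derivative \<delta> * (r ^ (n - 1) * W r powr (q + 2))) (at r)"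
proof -
  \<comment> \<open>\<open>P\<close> drops the absolute value of \<open>pohozaev\<close>, so that
    the power can be differentiated; both agree near r because W r > 0.\<close>
  define P where "P = (\<lambda>r. r ^ n * ((W' r)\<^sup>2 / 2 + W r powr (q + 2) / (q + 2)) + \<alpha> * r ^ (n - 1) * W r * W' r)"
  have k: "real (n - 1) = real n - 1" "n - 1 - 1 = n - 2" using n3 by auto
  define X where "X = W r powr q"
  have X: "\<bar>W r\<bar> powr q * W r = X * W r" "W r powr (q + 2) = X * (W r)\<^sup>2" "W r powr (q + 1) = X * W r"
    using assms by (auto simp: powr_add X_def)
  have q2: "q + 2 > 0" using q_pos by simp
  have d: "((\<lambda>r. W r powr (q + 2)) has_real_derivative (q + 2) * (X * W r) * W' r) (at r)"
  proof -
    have "W r powr (q + 2) * (0 * ln (W r) + W' r * (q + 2) / W r) = (q + 2) * (X * W r) * W' r"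
      unfolding X using assms by (simp add: power2_eq_square field_simps)
    with DERIV_powr[OF W_deriv[OF assms(1)] assms(2) DERIV_const[of "q + 2"]] show ?thesis by simp
  qed
  define Y where "Y = - (real n - 1) / r * W' r - \<bar>W r\<bar> powr q * W r"
  have dY: "(W' has_real_derivative Y) (at r)" unfolding Y_def by (rule W'_deriv[OF assms(1)])
  have d': "((\<lambda>r. W r powr (q + 2) / (q + 2)) has_real_derivative X * W r * W' r) (at r)"
    using DERIV_cdivide[OF d, of "q + 2"] q2 by (simp add: mult.assoc)
  have gen: "((\<lambda>r. r ^ n * ((W' r)\<^sup>2 / 2 + V r) + \<alpha> * r ^ (n - 1) * W r * W' r)
       has_real_derivative
       real n * r ^ (n - 1) * ((W' r)\<^sup>2 / 2 + V r) + r ^ n * (W' r * Y + V')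
       + \<alpha> * ((real n - 1) * r ^ (n - 2) * W r * W' r + r ^ (n - 1) * (W' r * W' r + W r * Y))) (at r)"
    if "(V has_real_derivative V') (at r)" for V V'
    using k by (auto intro!: derivative_eq_intros that dY W_deriv[OF assms(1)] simp: field_simps One_nat_def[symmetric])
  have "(P has_real_derivative \<delta> * (r ^ (n - 1) * W r powr (q + 2))) (at r)"
    unfolding P_def
  proof (rule DERIV_cong)
    show "((\<lambda>r. r ^ n * ((W' r)\<^sup>2 / 2 + W r powr (q + 2) / (q + 2)) + \<alpha> * r ^ (n - 1) * W r * W' r)
       has_real_derivative
       real n * r ^ (n - 1) * ((W' r)\<^sup>2 / 2 + W r powr (q + 2) / (q + 2))
       + r ^ n * (W' r * Y + X * W r * W' r)
       + \<alpha> * ((real n - 1) * r ^ (n - 2) * W r * W' r + r ^ (n - 1) * (W' r * W' r + W r * Y))) (at r)"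
      by (rule gen[OF d'])
    show "real n * r ^ (n - 1) * ((W' r)\<^sup>2 / 2 + W r powr (q + 2) / (q + 2))
       + r ^ n * (W' r * Y + X * W r * W' r)
       + \<alpha> * ((real n - 1) * r ^ (n - 2) * W r * W' r + r ^ (n - 1) * (W' r * W' r + W r * Y))
       = \<delta> * (r ^ (n - 1) * W r powr (q + 2))"
    proof -
      define i where "i = 1 / (q + 2)"
      have i: "n / (q + 2) = real n * i" "x / (q + 2) = x * i" for x by (auto simp: i_def)
      have Y: "r * Y = - (2 * \<alpha> + 1) * W' r - r * (X * W r)"
        unfolding Y_def X n_alpha using assms(1) by (simp add: field_simps)
      \<comment> \<open>The difference of the two sides is a multiple of the residual of the
        equation. Treating 1 / (q + 2) as the atom \<open>i\<close> makes this a polynomial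
        identity.\<close>
      have "(2 * \<alpha> + 2) * (r * k) * (v\<^sup>2 / 2 + X * u\<^sup>2 * i) + r * (r * k) * (v * Y + X * u * v)
          + \<alpha> * ((2 * \<alpha> + 2 - 1) * k * u * v + r * k * (v * v + u * Y))
          - ((2 * \<alpha> + 2) * i - \<alpha>) * (r * k * (X * u\<^sup>2))
          = (r * k * v + \<alpha> * k * u) * (r * Y - (- (2 * \<alpha> + 1) * v - r * (X * u)))" for k u v
        by (simp add: field_simps power2_eq_square)
      from this[of "r ^ (n - 2)" "W' r" "W r"] show ?thesis
        unfolding X \<delta>_def power_n(1) power_n(2)[of r] n_alpha i Y by simp
    qed
  qed
  moreover have "eventually (\<lambda>x. W x > 0) (nhds r)"
    using W_deriv[OF assms(1)] assms(2)
    by (metis DERIV_isCont isCont_def order_tendstoD(1) tendsto_at_iff_tendsto_nhds)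
  then have "eventually (\<lambda>x. P x = pohozaev x) (nhds r)"
    by eventually_elim (auto simp: P_def pohozaev_def)
  ultimately show ?thesis by (simp add: DERIV_cong_ev)
qed

lemma pohozaev_cont: "0 \<le> a \<Longrightarrow> continuous_on {a..b} pohozaev"
  unfolding pohozaev_def[abs_def] using q_pos
  by (intro continuous_intros continuous_on_powr') auto

lemma pohozaev_integral:
  assumes "q * \<alpha> < 2" "0 \<le> a" "a \<le> b" "\<And>s. a < s \<Longrightarrow> s < b \<Longrightarrow> 0 < W s"
  shows "((\<lambda>s. s ^ (n - 1) * W s powr (q + 2)) has_integral (pohozaev b - pohozaev a) / \<delta>) {a..b}"
proof -
  have "((\<lambda>s. \<delta> * (s ^ (n - 1) * W s powr (q + 2))) has_integral pohozaev b - pohozaev a) {a..b}"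
    using assms pohozaev_deriv pohozaev_cont
    by (intro fundamental_theorem_of_calculus_interior)
       (auto simp: has_real_derivative_iff_has_vector_derivative[symmetric])
  from has_integral_mult_right[OF this, of "1/\<delta>"] show ?thesis using delta_pos[OF assms(1)] by simp
qed

end

section \<open>Decay between a critical point and the next zero\<close>

text \<open>A falling piece normalised to height 1. It may start at a > 0 and so live on an annulus;
  along the sequences considered later a tends to 0.\<close>

locale bubble = radial_solution +
  fixes a R :: real
  assumes q_less: "q * \<alpha> < 2" and a_nonneg: "0 \<le> a" and a_less_R: "a < R"
    and W_a: "W a = 1" and W'_a: "W' a = 0" and W_R: "W R = 0"
    and W_pos: "\<And>s. a \<le> s \<Longrightarrow> s < R \<Longrightarrow> 0 < W s"
begin

lemma W_nonneg: "a \<le> s \<Longrightarrow> s \<le> R \<Longrightarrow> 0 \<le> W s"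
  using W_pos[of s] W_R by (cases "s = R") auto

lemma flux_a: "flux a = 0"
  by (simp add: flux_def W'_a)

lemma flux_nonneg: "a \<le> r \<Longrightarrow> r \<le> R \<Longrightarrow> 0 \<le> flux r"
  using has_integral_nonneg[OF flux_integral[of a r]] a_nonneg W_nonneg flux_a by force

lemma W'_nonpos: "a < r \<Longrightarrow> r \<le> R \<Longrightarrow> W' r \<le> 0"
  using flux_nonneg[of r] a_nonneg zero_less_power[of r "n - 1"]
  by (auto simp: flux_def mult_le_0_iff simp del: zero_less_power)

lemma W_antimono:
  assumes "a \<le> s" "s \<le> t" "t \<le> R"
  shows "W t \<le> W s"
proof (cases "s = t")
  case False
  show ?thesis
  proof (rule DERIV_nonpos_imp_decreasing_open[of s t W])
    fix x assume x: "s < x" "x < t"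
    then have "0 < x" "W' x \<le> 0" using assms a_nonneg W'_nonpos[of x] by auto
    then show "\<exists>y. (W has_real_derivative y) (at x) \<and> y \<le> 0" using W_deriv by blast
  qed (use assms False a_nonneg W_cont' in auto)
qed auto

lemma W_le_1: "a \<le> r \<Longrightarrow> r \<le> R \<Longrightarrow> W r \<le> 1"
  using W_antimono[of a r] W_a by auto

text \<open>On a falling piece the source is at most 1 and the Green kernel at most s, so the drop
  from height 1 is at most the integral of s.\<close>

lemma W_ge:
  assumes "a \<le> r" "r \<le> R"
  shows "1 - r\<^sup>2 / 2 \<le> W r"
proof (cases "a = r")
  case False
  with assms have ar: "a < r" by auto
  have "((\<lambda>s. green r s * W s powr (q + 1)) has_integral 1 - W r) {a..r}"
    using green_integral[of a r] ar a_nonneg assms W_nonneg by (simp add: W_a W'_a)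
  moreover have "((\<lambda>s. s) has_integral (r\<^sup>2 - a\<^sup>2) / 2) {a..r}"
    using ident_has_integral[of a r] ar by (simp add: diff_divide_distrib)
  moreover have "green r s * W s powr (q + 1) \<le> s" if "s \<in> {a..r}" for s
  proof -
    have "W s powr (q + 1) \<le> 1 powr (q + 1)"
      using that assms W_nonneg W_le_1 q_pos by (intro powr_mono2) auto
    then have "green r s * W s powr (q + 1) \<le> s * 1"
      using green_bounds[of s r] that ar a_nonneg by (intro mult_mono) auto
    then show ?thesis by simp
  qed
  ultimately have "1 - W r \<le> (r\<^sup>2 - a\<^sup>2) / 2" by (rule has_integral_le)
  moreover have "(r\<^sup>2 - a\<^sup>2) / 2 \<le> r\<^sup>2 / 2" by simp
  ultimately show ?thesis by linarith
qed (use W_a assms in auto)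

lemma R_gt_1: "1 < R"
proof (rule ccontr)
  assume "\<not> 1 < R"
  then have "R\<^sup>2 \<le> 1" using a_nonneg a_less_R by (simp add: power_le_one)
  then show False using W_ge[of R] W_R a_less_R by auto
qed

text \<open>Subcriticality enters here: at a the functional is nonnegative because W' vanishes, and
  as \<delta> > 0 it increases while W is positive. This sign makes \<open>h\<close>
  monotone.\<close>

lemma pohozaev_nonneg:
  assumes "a \<le> r" "r \<le> R"
  shows "0 \<le> pohozaev r"
proof -
  have "0 \<le> (pohozaev r - pohozaev a) / \<delta>"
    using has_integral_nonneg[OF pohozaev_integral[OF q_less, of a r]] a_nonneg assms W_pos by force
  moreover have "0 \<le> pohozaev a"
    using a_nonneg q_pos by (simp add: pohozaev_def W'_a)
  ultimately show ?thesis using delta_pos[OF q_less] by (simp add: zero_le_divide_iff)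
qed

text \<open>The function \<open>h\<close> is constant for the critical bubble; in general its derivative is a
  positive multiple of the Pohozaev functional.\<close>

definition h :: "real \<Rightarrow> real" where
  "h r = - W' r * W r powr (- q / 2 - 1) * r powr (1 - q * \<alpha>)"

lemma h_deriv:
  assumes "a < r" "r < R"
  shows "(h has_real_derivative
    (q + 2) * W r powr (- q / 2 - 2) * r powr (1 - q * \<alpha>) * (pohozaev r / r ^ n)) (at r)"
proof -
  have r: "0 < r" "0 < W r" using assms a_nonneg W_pos by auto
  define X w x where "X = W r powr q" and "w = W r powr (- q / 2 - 2)" and "x = r powr (1 - q * \<alpha>)"
  define Y where "Y = - (real n - 1) / r * W' r - \<bar>W r\<bar> powr q * W r"
  have dY: "(W' has_real_derivative Y) (at r)" unfolding Y_def by (rule W'_deriv[OF r(1)])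
  have w: "W r powr (- q / 2 - 1) = w * W r"
  proof -
    have "- q / 2 - 1 = (- q / 2 - 2) + 1" by simp
    then show ?thesis unfolding w_def using r powr_add[of "W r" "- q / 2 - 2" 1] by (simp only: powr_one)
  qed
  have d1: "((\<lambda>r. W r powr (- q / 2 - 1)) has_real_derivative (- q / 2 - 1) * w * W' r) (at r)"
  proof -
    have "W r powr (- q / 2 - 1) * (0 * ln (W r) + W' r * (- q / 2 - 1) / W r) = (- q / 2 - 1) * w * W' r"
      unfolding w using r by (simp add: field_simps)
    with DERIV_powr[OF W_deriv[OF r(1)] r(2) DERIV_const[of "- q / 2 - 1"]] show ?thesis by simp
  qed
  have d2: "((\<lambda>r. r powr (1 - q * \<alpha>)) has_real_derivative (1 - q * \<alpha>) * (x / r)) (at r)"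
  proof -
    have "x / r = r powr (1 - q * \<alpha> - 1)" using r powr_diff[of r "1 - q * \<alpha>" 1] by (simp add: x_def)
    then show ?thesis using has_real_derivative_powr[OF r(1), of "1 - q * \<alpha>"] by simp
  qed
  have X: "\<bar>W r\<bar> powr q * W r = X * W r" "\<bar>W r\<bar> powr (q + 2) = X * (W r)\<^sup>2"
    using r by (auto simp: powr_add X_def)
  have P: "pohozaev r / r ^ n = (W' r)\<^sup>2 / 2 + X * (W r)\<^sup>2 / (q + 2) + \<alpha> * W r * W' r / r"
    using r unfolding pohozaev_def X power_n(1) by (simp add: field_simps)
  have "(h has_real_derivative
     - Y * (w * W r) * x + - W' r * ((- q / 2 - 1) * w * W' r) * x
     + - W' r * (w * W r) * ((1 - q * \<alpha>) * (x / r))) (at r)"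
    using DERIV_mult[OF DERIV_mult[OF DERIV_minus[OF dY] d1] d2]
    unfolding h_def[abs_def] w x_def[symmetric] by (simp add: algebra_simps)
  also have "- Y * (w * W r) * x + - W' r * ((- q / 2 - 1) * w * W' r) * x
     + - W' r * (w * W r) * ((1 - q * \<alpha>) * (x / r))
     = (q + 2) * w * x * (pohozaev r / r ^ n)"
  proof -
    have q2: "q + 2 \<noteq> 0" using q_pos by simp
    define i where "i = 1 / r"
    have i: "y / r = y * i" for y by (simp add: i_def)
    have Pq: "(q + 2) * (pohozaev r / r ^ n)
      = (q + 2) * (W' r)\<^sup>2 / 2 + X * (W r)\<^sup>2 + (q + 2) * (\<alpha> * W r * W' r / r)"
      unfolding P distrib_left using q2 by simp
    have "(q + 2) * w * x * (pohozaev r / r ^ n) = w * x * ((q + 2) * (pohozaev r / r ^ n))" by simp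
    also have "\<dots> = - Y * (w * W r) * x + - W' r * ((- q / 2 - 1) * w * W' r) * x
     + - W' r * (w * W r) * ((1 - q * \<alpha>) * (x / r))"
      unfolding Pq Y_def X n_alpha i by (simp add: algebra_simps power2_eq_square)
    finally show ?thesis by simp
  qed
  finally show ?thesis unfolding w_def x_def .
qed

lemma h_mono:
  assumes "a < s" "s \<le> t" "t < R"
  shows "h s \<le> h t"
proof (rule DERIV_nonneg_imp_nondecreasing[OF assms(2)])
  fix x assume x: "s \<le> x" "x \<le> t"
  have "0 < x" using x assms a_nonneg by auto
  then have "0 \<le> (q + 2) * W x powr (- q / 2 - 2) * x powr (1 - q * \<alpha>) * (pohozaev x / x ^ n)"
    using pohozaev_nonneg[of x] x assms q_pos by (intro mult_nonneg_nonneg divide_nonneg_nonneg) auto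
  then show "\<exists>y. (h has_real_derivative y) (at x) \<and> 0 \<le> y" using h_deriv[of x] x assms by force
qed

text \<open>\<open>h / (2 * \<alpha>)\<close> is the derivative of W^(-q/2) with respect to the
  variable r^(q \<alpha>). As \<open>h\<close> increases, W^(-q/2) is convex in that variable and
  lies above its tangent at \<eta>, whose value at \<eta> is lowered to 1. For the critical bubble
  the function is affine, namely 1 + r^2 / c.\<close>

lemma W_powr_ge:
  assumes "a < \<eta>" "\<eta> \<le> r" "r < R"
  shows "1 + h \<eta> * (r powr (q * \<alpha>) - \<eta> powr (q * \<alpha>)) / (2 * \<alpha>) \<le> W r powr (- q / 2)"
proof -
  define g where "g = (\<lambda>r. W r powr (- q / 2) - h \<eta> / (2 * \<alpha>) * r powr (q * \<alpha>))"
  have "g \<eta> \<le> g r"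
  proof (rule DERIV_nonneg_imp_nondecreasing[OF assms(2)])
    fix x assume x: "\<eta> \<le> x" "x \<le> r"
    have x0: "0 < x" "0 < W x" using x assms a_nonneg W_pos[of x] by auto
    have d1: "((\<lambda>r. W r powr (- q / 2)) has_real_derivative (q / 2) * x powr (q * \<alpha> - 1) * h x) (at x)"
    proof -
      have "x powr (q * \<alpha> - 1) * x powr (1 - q * \<alpha>) = 1"
        using x0 by (simp add: powr_add[symmetric])
      moreover have "W x powr (- q / 2) = W x powr (- q / 2 - 1) * W x"
        using x0 powr_add[of "W x" "- q / 2 - 1" 1] by simp
      ultimately have eq: "W x powr (- q / 2) * (0 * ln (W x) + W' x * (- q / 2) / W x)
        = (q / 2) * x powr (q * \<alpha> - 1) * h x"
        unfolding h_def using x0 by simp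
      from DERIV_powr[OF W_deriv[OF x0(1)] x0(2) DERIV_const[of "- q / 2"]]
      show ?thesis unfolding eq .
    qed
    have "(g has_real_derivative (q / 2) * x powr (q * \<alpha> - 1) * h x
      - h \<eta> / (2 * \<alpha>) * (q * \<alpha> * x powr (q * \<alpha> - 1))) (at x)"
      unfolding g_def
      by (rule DERIV_diff[OF d1 DERIV_cmult[OF has_real_derivative_powr[OF x0(1)]]])
    moreover have "(q / 2) * x powr (q * \<alpha> - 1) * h x
      - h \<eta> / (2 * \<alpha>) * (q * \<alpha> * x powr (q * \<alpha> - 1)) = (q / 2) * x powr (q * \<alpha> - 1) * (h x - h \<eta>)"
      using alpha_pos by (simp add: field_simps)
    moreover have "0 \<le> (q / 2) * x powr (q * \<alpha> - 1) * (h x - h \<eta>)"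
      using h_mono[of \<eta> x] assms x q_pos by (intro mult_nonneg_nonneg) auto
    ultimately show "\<exists>y. (g has_real_derivative y) (at x) \<and> 0 \<le> y" by force
  qed
  moreover have "1 \<le> W \<eta> powr (- q / 2)"
    using powr_mono2'[of "- q / 2" "W \<eta>" 1] W_le_1[of \<eta>] W_pos[of \<eta>] assms q_pos by simp
  ultimately show ?thesis by (simp add: g_def algebra_simps diff_divide_distrib)
qed

text \<open>The flux gained on \<open>{a..\<eta>}\<close> is bounded below with W at least W \<eta>,
  hence at least 1 - \<eta>^2. For a to 0 and q to \<open>2 / \<alpha>\<close> the bound tends to (1
  - \<eta>^2)^(2/\<alpha>+1) / n, and this approaches 1 / n, the value of \<open>h\<close> for the
  critical bubble, as \<eta> tends to 0.\<close>

lemma h_ge: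
  assumes "a < \<eta>" "\<eta> < 1"
  shows "\<eta> powr (2 - q * \<alpha>) * (1 - \<eta>\<^sup>2) powr (q + 1) * (1 - (a / \<eta>) ^ n) / n \<le> h \<eta>"
proof -
  have \<eta>: "0 < \<eta>" "\<eta> < R" "0 < W \<eta>" "W \<eta> \<le> 1"
    using assms a_nonneg R_gt_1 W_pos[of \<eta>] W_le_1[of \<eta>] by auto
  have w: "(1 - \<eta>\<^sup>2) powr (q + 1) \<le> W \<eta> powr (q + 1)"
    using W_ge[of \<eta>] \<eta> assms q_pos
    by (intro powr_mono2) (auto simp: abs_square_le_1 abs_square_less_1 less_imp_le power_le_one)
  have "((\<lambda>s. s ^ (n - 1)) has_integral \<eta> ^ n / n - a ^ n / n) {a..\<eta>}"
    using assms a_nonneg by (intro power_integral) auto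
  then have "((\<lambda>s. W \<eta> powr (q + 1) * s ^ (n - 1)) has_integral W \<eta> powr (q + 1) * (\<eta> ^ n / n - a ^ n / n)) {a..\<eta>}"
    by (rule has_integral_mult_right)
  moreover have "((\<lambda>s. s ^ (n - 1) * W s powr (q + 1)) has_integral flux \<eta>) {a..\<eta>}"
    using flux_integral[of a \<eta>] assms a_nonneg W_nonneg \<eta> flux_a by auto
  moreover have "W \<eta> powr (q + 1) * s ^ (n - 1) \<le> s ^ (n - 1) * W s powr (q + 1)" if "s \<in> {a..\<eta>}" for s
    using W_antimono[of s \<eta>] that \<eta> q_pos a_nonneg
    by (auto simp: mult.commute intro!: mult_left_mono powr_mono2)
  ultimately have f: "W \<eta> powr (q + 1) * (\<eta> ^ n / n - a ^ n / n) \<le> flux \<eta>" by (rule has_integral_le)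
  have "\<eta> powr (2 - q * \<alpha>) = \<eta> * \<eta> powr (1 - q * \<alpha>)"
    using \<eta> powr_add[of \<eta> 1 "1 - q * \<alpha>"] by simp
  moreover have "(1 - (a / \<eta>) ^ n) * \<eta> * \<eta> ^ (n - 1) = \<eta> ^ n - a ^ n"
    using \<eta> power_n(1)[of \<eta>] by (simp add: power_divide left_diff_distrib)
  then have 3: "(1 - (a / \<eta>) ^ n) * \<eta> / n = (\<eta> ^ n / n - a ^ n / n) / \<eta> ^ (n - 1)"
  proof -
    have "x * \<eta> / n = y / n / k" if "x * \<eta> * k = y" "k \<noteq> 0" for x y k using that by auto
    from this[OF \<open>(1 - (a / \<eta>) ^ n) * \<eta> * \<eta> ^ (n - 1) = \<eta> ^ n - a ^ n\<close>]
    show ?thesis using \<eta> by (simp add: diff_divide_distrib)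
  qed
  ultimately have "\<eta> powr (2 - q * \<alpha>) * (1 - \<eta>\<^sup>2) powr (q + 1) * (1 - (a / \<eta>) ^ n) / n
    = \<eta> powr (1 - q * \<alpha>) * ((1 - \<eta>\<^sup>2) powr (q + 1) * ((\<eta> ^ n / n - a ^ n / n) / \<eta> ^ (n - 1)))"
    unfolding 3[symmetric] by simp
  also have "\<dots> \<le> \<eta> powr (1 - q * \<alpha>) * (W \<eta> powr (q + 1) * ((\<eta> ^ n / n - a ^ n / n) / \<eta> ^ (n - 1)))"
    using w \<eta> assms a_nonneg n3
    by (intro mult_left_mono mult_right_mono divide_nonneg_nonneg)
       (auto intro!: divide_right_mono power_mono)
  also have "\<dots> \<le> \<eta> powr (1 - q * \<alpha>) * (- W' \<eta>)"
    using f \<eta> by (intro mult_left_mono) (auto simp: flux_def field_simps)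
  also have "\<dots> \<le> \<eta> powr (1 - q * \<alpha>) * (- W' \<eta>) * W \<eta> powr (- q / 2 - 1)"
    using powr_mono2'[of "- q / 2 - 1" "W \<eta>" 1] \<eta> q_pos W'_nonpos[of \<eta>] assms
      mult_left_mono[of 1 "W \<eta> powr (- q / 2 - 1)" "\<eta> powr (1 - q * \<alpha>) * (- W' \<eta>)"]
    by (auto simp: mult_le_0_iff)
  finally show ?thesis by (simp add: h_def mult_ac)
qed

text \<open>The power -2/q of the tangent bound is a bubble-like profile above W. The slope
  \<open>H\<close> stays free: the sharp lower bound for h \<eta> leads to the limit profile, a
  fixed smaller constant to uniform decay.\<close>

lemma W_le_profile:
  assumes "a < \<eta>" "\<eta> < 1" "\<eta> \<le> r" "r \<le> R"
    and H: "0 \<le> H" "H \<le> \<eta> powr (2 - q * \<alpha>) * (1 - \<eta>\<^sup>2) powr (q + 1) * (1 - (a / \<eta>) ^ n) / n"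
  shows "W r \<le> (1 + H * (r powr (q * \<alpha>) - \<eta> powr (q * \<alpha>)) / (2 * \<alpha>)) powr (- 2 / q)"
proof (cases "r = R")
  case False
  have "\<eta> powr (q * \<alpha>) \<le> r powr (q * \<alpha>)"
    using assms q_pos alpha_pos a_nonneg by (intro powr_mono2) auto
  then have 0: "0 \<le> H * (r powr (q * \<alpha>) - \<eta> powr (q * \<alpha>)) / (2 * \<alpha>)"
    "H * (r powr (q * \<alpha>) - \<eta> powr (q * \<alpha>)) / (2 * \<alpha>) \<le> h \<eta> * (r powr (q * \<alpha>) - \<eta> powr (q * \<alpha>)) / (2 * \<alpha>)"
    using H h_ge[OF assms(1,2)] alpha_pos by (auto intro!: divide_right_mono mult_right_mono)
  have Wr: "W r > 0" using False assms W_pos by auto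
  have "W r = (W r powr (- q / 2)) powr (- 2 / q)"
    using Wr q_pos by (simp add: powr_powr)
  also have "\<dots> \<le> (1 + H * (r powr (q * \<alpha>) - \<eta> powr (q * \<alpha>)) / (2 * \<alpha>)) powr (- 2 / q)"
    using 0 W_powr_ge[of \<eta> r] False assms q_pos by (intro powr_mono2') auto
  finally show ?thesis .
qed (simp add: W_R)

end

section \<open>The critical bubble\<close>

context dimension
begin

text \<open>This is n (n - 2), the constant for which \<open>U\<close> solves the critical equation
  with U 0 = 1; its square root is the length in the limits of the theorem.\<close>

definition c :: real where "c = real n * (2 * \<alpha>)"

lemma c_pos: "c > 0"
  using n3 alpha_pos by (auto simp: c_def)

definition U :: "real \<Rightarrow> real" where "U r = (1 + r\<^sup>2 / c) powr (- \<alpha>)"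

definition U' :: "real \<Rightarrow> real" where "U' r = - (r / n * (1 + r\<^sup>2 / c) powr (- \<alpha> - 1))"

lemma base_pos: "0 < 1 + r\<^sup>2 / c"
  using c_pos by (intro add_pos_nonneg) auto

lemma U_pos: "0 < U r"
  using base_pos[of r] by (simp add: U_def)

lemma U_le_1: "U r \<le> 1"
  using powr_mono2'[of "-\<alpha>" 1 "1 + r\<^sup>2 / c"] alpha_pos c_pos by (simp add: U_def)

lemma U_deriv: "(U has_real_derivative U' r) (at r)"
proof -
  have "(U has_real_derivative - \<alpha> * (1 + r\<^sup>2 / c) powr (- \<alpha> - 1) * (2 * r / c)) (at r)"
    unfolding U_def[abs_def] using base_pos[of r]
    by (rule DERIV_fun_powr[THEN DERIV_cong, rotated])
       (use c_pos in \<open>auto intro!: derivative_eq_intros\<close>)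
  also have "- \<alpha> * (1 + r\<^sup>2 / c) powr (- \<alpha> - 1) * (2 * r / c) = U' r"
    using alpha_pos by (simp add: U'_def c_def)
  finally show ?thesis .
qed

lemma U'_deriv:
  assumes "r > 0"
  shows "(U' has_real_derivative - (real n - 1) / r * U' r - \<bar>U r\<bar> powr (2 / \<alpha>) * U r) (at r)"
proof -
  define B where "B = 1 + r\<^sup>2 / c"
  have B: "B > 0" unfolding B_def by (rule base_pos)
  define b where "b = B powr (- \<alpha> - 2)"
  have b1: "B powr (- \<alpha> - 1) = b * B"
  proof -
    have "- \<alpha> - 1 = (- \<alpha> - 2) + 1" by simp
    then show ?thesis using B powr_add[of B "- \<alpha> - 2" 1] by (simp only: b_def powr_one)
  qed
  have b2: "\<bar>U r\<bar> powr (2 / \<alpha>) * U r = b"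
    using B alpha_pos unfolding U_def B_def[symmetric] b_def
    by (simp add: powr_powr powr_add[symmetric] field_simps)
  have "(U' has_real_derivative - (B powr (- \<alpha> - 1) / n + r / n * ((- \<alpha> - 1) * b * (2 * r / c)))) (at r)"
  proof -
    have "((\<lambda>r. (1 + r\<^sup>2 / c) powr (- \<alpha> - 1)) has_real_derivative (- \<alpha> - 1) * b * (2 * r / c)) (at r)"
      using B DERIV_fun_powr[of "\<lambda>r. 1 + r\<^sup>2 / c" "2 * r / c" r "- \<alpha> - 1"]
      unfolding B_def b_def using c_pos by (auto intro!: derivative_eq_intros simp: algebra_simps)
    from DERIV_minus[OF DERIV_mult[OF DERIV_cdivide[OF DERIV_ident, of n] this]]
    show ?thesis unfolding U'_def[abs_def] B_def by (simp add: algebra_simps)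
  qed
  also have "- (B powr (- \<alpha> - 1) / n + r / n * ((- \<alpha> - 1) * b * (2 * r / c))) =
     - (real n - 1) / r * U' r - b"
  proof -
    have n: "real n > 0" using n3 by auto
    have cB: "c * B = c + r\<^sup>2" using c_pos by (simp add: B_def field_simps)
    have "- (b * B / n + r / n * ((- \<alpha> - 1) * b * (2 * r / c))) * (n * c) = - b * (c * B) + (real n) * b * r\<^sup>2"
    proof -
      have "(b * B / n + r / n * ((- \<alpha> - 1) * b * (2 * r / c))) * (n * c) = b * B * c + r * ((- \<alpha> - 1) * b * (2 * r))"
        using n c_pos by (simp add: field_simps)
      then show ?thesis by (simp add: n_alpha algebra_simps power2_eq_square)
    qed
    also have "\<dots> = (- (real n - 1) / r * (- (r / n * (b * B))) - b) * (n * c)"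
    proof -
      have "(- (real n - 1) / r * (- (r / n * (b * B))) - b) * (n * c) = (real n - 1) * b * (c * B) - b * n * c"
        using n assms by (simp add: field_simps)
      then show ?thesis unfolding cB by (simp add: algebra_simps)
    qed
    finally show ?thesis unfolding U'_def B_def[symmetric] b1 using n c_pos by simp
  qed
  finally show ?thesis by (simp add: b2)
qed

text \<open>\<open>U\<close> is the endpoint case \<open>q * \<alpha> = 2\<close> and inherits the
  flux and Green identities.\<close>

sublocale critical: radial_solution n "2 / \<alpha>" U U'
proof
  show "0 < 2 / \<alpha>" "2 / \<alpha> * \<alpha> \<le> 2" using alpha_pos by auto
  show "continuous_on {0..} U" by (rule DERIV_continuous_on) (rule DERIV_subset[OF U_deriv], simp)
  show "continuous_on {0..} U'" unfolding U'_def[abs_def]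
    using base_pos n3 c_pos by (intro continuous_intros) (auto simp: less_imp_neq[symmetric])
qed (use U_deriv U'_deriv in auto)

lemma U_0: "U 0 = 1" and U'_0: "U' 0 = 0"
  by (auto simp: U_def U'_def)

lemma green_U_integral:
  assumes "0 < r"
  shows "((\<lambda>s. green r s * U s powr (2 / \<alpha> + 1)) has_integral 1 - U r) {0..r}"
  using critical.green_integral[of 0 r] assms U_pos by (auto simp: U_0 U'_0 less_imp_le)

section \<open>Total flux and total energy of the critical bubble\<close>

definition A :: real where "A = 2 * \<alpha> * c powr \<alpha>"

lemma A_pos: "A > 0"
  using alpha_pos c_pos by (simp add: A_def)

lemma powr_real_nat: "x > 0 \<Longrightarrow> x ^ k = x powr real k" for x :: real
  by (simp add: powr_realpow)

lemma n_minus: "real (n - 1) = 2 * \<alpha> + 1" "real (n - 2) = 2 * \<alpha>"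
  using n3 n_alpha by auto

text \<open>At infinity U r behaves like c^\<alpha> r^(-2\<alpha>), so its flux tends to 2 \<alpha>
  c^\<alpha>.\<close>

lemma U_flux_integral: "((\<lambda>s. s ^ (n - 1) * U s powr (2 / \<alpha> + 1)) has_integral A) {0..}"
proof (rule has_integral_to_inf)
  have fl: "((\<lambda>s. s ^ (n - 1) * U s powr (2 / \<alpha> + 1)) has_integral critical.flux y) {0..y}" if "0 \<le> y" for y
    using critical.flux_integral[of 0 y] that U_pos n3
    by (auto simp: critical.flux_def U'_0 less_imp_le)
  show "(\<lambda>s. s ^ (n - 1) * U s powr (2 / \<alpha> + 1)) integrable_on {0..y}" for y
    using fl[of y] by (cases "0 \<le> y") (auto simp: integrable_on_def)
  \<comment> \<open>The flux of \<open>U\<close> with y^2 taken out of 1 + y^2 / c; the powers of y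
    cancel because n = 2\<alpha> + 2.\<close>
  have "eventually (\<lambda>y. (y powr (- 2) + 1 / c) powr (- (\<alpha> + 1)) / n
      = integral {0..y} (\<lambda>s. s ^ (n - 1) * U s powr (2 / \<alpha> + 1))) at_top"
    using eventually_gt_at_top[of 0]
  proof eventually_elim
    case (elim y)
    have "(1 + y\<^sup>2 / c) = y powr 2 * (y powr (- 2) + 1 / c)"
      using elim by (simp add: field_simps powr_minus)
    then have "(1 + y\<^sup>2 / c) powr (- \<alpha> - 1) = y powr (- 2 * \<alpha> - 2) * (y powr (- 2) + 1 / c) powr (- (\<alpha> + 1))"
    proof -
      have "(y powr 2) powr (- \<alpha> - 1) = y powr (- 2 * \<alpha> - 2)" by (simp add: powr_powr algebra_simps)
      moreover have "- (\<alpha> + 1) = - \<alpha> - 1" by simp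
      ultimately show ?thesis unfolding \<open>1 + y\<^sup>2 / c = _\<close> using elim c_pos by (simp only: powr_mult)
    qed
    moreover have "y ^ (n - 1) * y * y powr (- 2 * \<alpha> - 2) = 1"
    proof -
      have "y ^ (n - 1) * y = y powr (2 * \<alpha> + 2)"
        using elim power_n(1)[of y] n_alpha powr_real_nat[of y n] by (simp add: mult.commute)
      moreover have "y powr (2 * \<alpha> + 2) * y powr (- 2 * \<alpha> - 2) = 1"
        using elim by (simp add: powr_add[symmetric])
      ultimately show ?thesis by simp
    qed
    ultimately have "critical.flux y = (y powr (- 2) + 1 / c) powr (- (\<alpha> + 1)) / n"
      unfolding critical.flux_def U'_def by (simp add: mult_ac)
    then show ?case using integral_unique[OF fl, of y] elim by simp
  qed
  moreover have "((\<lambda>y. (y powr (- 2) + 1 / c) powr (- (\<alpha> + 1)) / n) \<longlongrightarrow> (0 + 1 / c) powr (- (\<alpha> + 1)) / n) at_top"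
    using c_pos n3 by (intro tendsto_intros tendsto_neg_powr filterlim_ident) auto
  moreover have "(0 + 1 / c) powr (- (\<alpha> + 1)) / n = A"
  proof -
    have "(1 / c) powr (- (\<alpha> + 1)) = c powr (\<alpha> + 1)"
      using c_pos by (simp add: powr_divide powr_minus_divide del: minus_add_distrib)
    also have "\<dots> / n = A"
      using c_pos n3 by (simp add: A_def powr_add) (simp add: c_def)
    finally show ?thesis by simp
  qed
  ultimately show "((\<lambda>y. integral {0..y} (\<lambda>s. s ^ (n - 1) * U s powr (2 / \<alpha> + 1))) \<longlongrightarrow> A) at_top"
    using Lim_transform_eventually by fastforce
qed (use U_pos in \<open>auto simp: less_imp_le\<close>)

definition S :: real where "S = c powr (n / 2) / 2 * Beta (n / 2) (n / 2)"

lemma U_energy_integral: "((\<lambda>s. s ^ (n - 1) * U s powr (2 / \<alpha> + 2)) has_integral S) {0..}"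
proof (rule has_integral_to_inf)
  define f where "f = (\<lambda>t::real. t powr (n / 2 - 1) * (1 - t) powr (n / 2 - 1))"
  \<comment> \<open>The substitution t = s^2 / (c + s^2), with 1 - t = c / (c + s^2), maps the
    half-line to [0,1) and turns the energy into an incomplete Beta integral.\<close>
  define g where "g = (\<lambda>s. s\<^sup>2 / (c + s\<^sup>2))"
  define g' where "g' = (\<lambda>s. 2 * s * c / (c + s\<^sup>2)\<^sup>2)"
  have cs: "c + s\<^sup>2 > 0" for s using c_pos by (intro add_pos_nonneg) auto
  have n2: "real n / 2 - 1 > 0" using n3 by auto
  have f_cont: "continuous_on {0..1} f"
    unfolding f_def using n2 by (intro continuous_intros continuous_on_powr') auto
  have g_01: "g s \<in> {0..1}" for s
    using cs[of s] c_pos by (auto simp: g_def)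
  have fl: "((\<lambda>s. s ^ (n - 1) * U s powr (2 / \<alpha> + 2)) has_integral
       c powr (n / 2) / 2 * integral {0..g y} f) {0..y}" if "0 \<le> y" for y
  proof -
    have "((\<lambda>s. g' s *\<^sub>R f (g s)) has_integral integral {g 0..g y} f) {0..y}"
    proof (rule has_integral_substitution[OF that _ _ f_cont])
      show "g 0 \<le> g y" using g_01[of y] by (simp add: g_def)
      show "g ` {0..y} \<subseteq> {0..1}" using g_01 by auto
      show "(g has_real_derivative g' x) (at x within {0..y})" for x
        unfolding g_def g'_def using cs[of x]
        by (auto intro!: derivative_eq_intros simp: field_simps power2_eq_square)
    qed
    from has_integral_mult_right[OF this, of "c powr (n / 2) / 2"]
    have "((\<lambda>s. c powr (n / 2) / 2 * (g' s * f (g s))) has_integral c powr (n / 2) / 2 * integral {0..g y} f) {0..y}"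
      by (simp add: g_def)
    moreover have "c powr (n / 2) / 2 * (g' s * f (g s)) = s ^ (n - 1) * U s powr (2 / \<alpha> + 2)"
      if "s \<in> {0..y}" for s
    proof (cases "s = 0")
      case True
      then show ?thesis using n3 by (simp add: g'_def)
    next
      case False
      then have s: "s > 0" using that by auto
      define C where "C = c + s\<^sup>2"
      have C: "C > 0" using cs by (simp add: C_def)
      have gs: "g s = s powr 2 / C" "1 - g s = c / C"
        using s C by (auto simp: g_def C_def field_simps)
      have na: "real n / 2 - 1 = \<alpha>" "real n / 2 = \<alpha> + 1" by (auto simp: n_alpha field_simps)
      have U: "U s = c powr \<alpha> * C powr (- \<alpha>)"
      proof -
        have "1 + s\<^sup>2 / c = C / c" using c_pos by (simp add: C_def field_simps)
        then show ?thesis unfolding U_def using C c_pos by (simp add: powr_divide powr_minus field_simps)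
      qed
      have e1: "U s powr (2 / \<alpha> + 2) = c powr (2 * \<alpha> + 2) * C powr (- 2 * \<alpha> - 2)"
      proof -
        have "\<alpha> * (2 / \<alpha> + 2) = 2 * \<alpha> + 2" "- \<alpha> * (2 / \<alpha> + 2) = - 2 * \<alpha> - 2"
          using alpha_pos by (auto simp: field_simps)
        then show ?thesis unfolding U using C c_pos by (simp only: powr_mult powr_powr)
      qed
      have e2: "f (g s) = s powr (2 * \<alpha>) * c powr \<alpha> * C powr (- 2 * \<alpha>)"
        unfolding f_def gs(2) na unfolding gs(1) using s C c_pos powr_add[of C \<alpha> \<alpha>] powr_powr[of s 2 \<alpha>]
        by (simp add: powr_divide powr_powr powr_minus field_simps)
      have e3: "g' s = 2 * s powr 1 * c powr 1 * C powr (- 2)"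
        using s C c_pos by (simp add: g'_def C_def[symmetric] powr_minus field_simps)
      have e4: "s ^ (n - 1) = s powr (2 * \<alpha> + 1)"
        using s by (simp add: powr_real_nat n_minus)
      have e5: "c powr (2 * \<alpha>) = c powr \<alpha> * c powr \<alpha>"
        using powr_add[of c \<alpha> \<alpha>] by simp
      show ?thesis unfolding na e1 e2 e3 e4 using s C c_pos e5
        by (simp add: powr_add powr_diff powr_minus field_simps power2_eq_square)
    qed
    ultimately show ?thesis by (rule has_integral_eq[rotated])
  qed
  show "(\<lambda>s. s ^ (n - 1) * U s powr (2 / \<alpha> + 2)) integrable_on {0..y}" for y
    using fl[of y] by (cases "0 \<le> y") (auto simp: integrable_on_def)
  have "eventually (\<lambda>y. c powr (n / 2) / 2 * integral {0..g y} f
      = integral {0..y} (\<lambda>s. s ^ (n - 1) * U s powr (2 / \<alpha> + 2))) at_top"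
    using eventually_ge_at_top[of 0] by eventually_elim (rule integral_unique[OF fl, symmetric])
  moreover have "((\<lambda>y. integral {0..g y} f) \<longlongrightarrow> integral {0..1} f) at_top"
  proof (rule continuous_on_tendsto_compose[where f = "\<lambda>x. integral {0..x} f" and s = "{0..1}"])
    show "continuous_on {0..1} (\<lambda>x. integral {0..x} f)"
      by (intro indefinite_integral_continuous_1 integrable_continuous_interval f_cont)
    have "((\<lambda>y. inverse (c * y powr (- 2) + 1)) \<longlongrightarrow> inverse (c * 0 + 1)) at_top"
      by (intro tendsto_intros tendsto_neg_powr filterlim_ident) auto
    moreover have "eventually (\<lambda>y. inverse (c * y powr (- 2) + 1) = g y) at_top"
      using eventually_gt_at_top[of 0]
    proof eventually_elim
      case (elim y)
      then show ?case using cs[of y] by (simp add: g_def powr_minus field_simps)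
    qed
    ultimately show "(g \<longlongrightarrow> 1) at_top" using Lim_transform_eventually by fastforce
  qed (use g_01 in auto)
  then have "((\<lambda>y. c powr (n / 2) / 2 * integral {0..g y} f) \<longlongrightarrow> c powr (n / 2) / 2 * integral {0..1} f) at_top"
    by (rule tendsto_mult_left)
  moreover have "integral {0..1} f = Beta (n / 2) (n / 2)"
    using has_integral_Beta_real[of "n / 2" "n / 2"] n3 by (auto simp: f_def intro!: integral_unique)
  ultimately show "((\<lambda>y. integral {0..y} (\<lambda>s. s ^ (n - 1) * U s powr (2 / \<alpha> + 2))) \<longlongrightarrow> S) at_top"
    unfolding S_def using Lim_transform_eventually by fastforce
qed (use U_pos in \<open>auto simp: less_imp_le\<close>)

text \<open>Origin of \<open>kappa n\<close>: its quotient of Gamma values is Beta(n/2, n/2), and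
  this relation makes the energy step \<delta> S asymptotic to \<alpha> A \<open>kappa n\<close>
  \<epsilon>.\<close>

lemma S_kappa: "S = real n * kappa n * A / \<alpha>"
proof -
  have "real n / 2 = \<alpha> + 1" by (simp add: n_alpha field_simps)
  then have "c powr (n / 2) = c powr \<alpha> * c" using c_pos by (simp only: powr_add) simp
  moreover have "real n - 2 = 2 * \<alpha>" using n_alpha by simp
  ultimately show ?thesis using alpha_pos
    unfolding S_def kappa_def A_def Beta_def by (simp add: power2_eq_square) (simp add: c_def)
qed

lemma kappa_pos: "kappa n > 0"
  using n3 Gamma_real_pos[of "real n / 2"] Gamma_real_pos[of "real n"]
  unfolding kappa_def by (intro mult_pos_pos divide_pos_pos zero_less_power) auto

end

section \<open>Convergence to the critical bubble\<close>

locale bubble_sequence = dimension +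
  fixes q :: "nat \<Rightarrow> real" and W W' :: "nat \<Rightarrow> real \<Rightarrow> real" and a R :: "nat \<Rightarrow> real"
  assumes bubble: "\<And>k. bubble n (q k) (W k) (W' k) (a k) (R k)"
    and q_lim: "q \<longlonglongrightarrow> 2 / \<alpha>" and a_lim: "a \<longlonglongrightarrow> 0"
begin

lemmas q_pos = radial_solution.q_pos[OF bubble.axioms(1)[OF bubble]]
lemmas q_less = bubble.q_less[OF bubble]
lemmas W_cont = radial_solution.W_cont'[OF bubble.axioms(1)[OF bubble]]
lemmas a_nonneg = bubble.a_nonneg[OF bubble]
lemmas W_nonneg = bubble.W_nonneg[OF bubble]
lemmas W_le_1 = bubble.W_le_1[OF bubble]

lemma b_lim: "(\<lambda>k. q k * \<alpha>) \<longlonglongrightarrow> 2"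
  using tendsto_mult_right[OF q_lim, of \<alpha>] alpha_pos by simp

text \<open>For fixed \<eta> the profile bound converges along the sequence to G \<eta>, and G
  \<eta> tends to U r as \<eta> tends to 0; hence \<eta> is chosen before k. The premise
  \<open>r \<le> R k\<close> stays, since divergence of \<open>R k\<close> is not yet known.\<close>

lemma eventually_W_less_U:
  assumes "0 < r" "0 < e"
  shows "\<forall>\<^sub>F k in sequentially. r \<le> R k \<longrightarrow> W k r < U r + e"
proof -
  define G where "G = (\<lambda>\<eta>. (1 + (1 - \<eta>\<^sup>2) powr (2 / \<alpha> + 1) / n * (r\<^sup>2 - \<eta>\<^sup>2) / (2 * \<alpha>)) powr (- \<alpha>))"
  have "((\<lambda>\<eta>. G \<eta>) \<longlongrightarrow> (1 + (1 - 0\<^sup>2) powr (2 / \<alpha> + 1) / n * (r\<^sup>2 - 0\<^sup>2) / (2 * \<alpha>)) powr (- \<alpha>)) (at_right 0)"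
    unfolding G_def using base_pos[of r] alpha_pos n3 c_pos
    by (intro tendsto_intros) (auto simp: c_def less_imp_neq[symmetric])
  also have "(1 + (1 - 0\<^sup>2) powr (2 / \<alpha> + 1) / n * (r\<^sup>2 - 0\<^sup>2) / (2 * \<alpha>)) powr (- \<alpha>) = U r"
    by (simp add: U_def c_def)
  finally have "eventually (\<lambda>\<eta>. G \<eta> < U r + e) (at_right 0)"
    using assms(2) by (intro order_tendstoD) auto
  moreover have "eventually (\<lambda>\<eta>. \<eta> \<in> {0<..<min 1 r}) (at_right 0)"
    using assms(1) by (intro eventually_at_rightI[of 0 "min 1 r"]) auto
  ultimately have "eventually (\<lambda>\<eta>. G \<eta> < U r + e \<and> \<eta> \<in> {0<..<min 1 r}) (at_right 0)"
    by (rule eventually_conj)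
  from eventually_happens'[OF trivial_limit_at_right_real this]
  obtain \<eta> where \<eta>: "G \<eta> < U r + e" "0 < \<eta>" "\<eta> < 1" "\<eta> < r" by auto
  define H where "H = (\<lambda>k. \<eta> powr (2 - q k * \<alpha>) * (1 - \<eta>\<^sup>2) powr (q k + 1) * (1 - (a k / \<eta>) ^ n) / n)"
  define V where "V = (\<lambda>k. (1 + H k * (r powr (q k * \<alpha>) - \<eta> powr (q k * \<alpha>)) / (2 * \<alpha>)) powr (- 2 / q k))"
  have \<eta>2: "1 - \<eta>\<^sup>2 > 0" using \<eta> by (simp add: power_less_one_iff)
  have n0: "n \<noteq> 0" using n3 by auto
  have H: "H \<longlonglongrightarrow> \<eta> powr (2 - 2) * (1 - \<eta>\<^sup>2) powr (2 / \<alpha> + 1) * (1 - (0 / \<eta>) ^ n) / n"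
    unfolding H_def using \<eta> \<eta>2 n0 by (intro tendsto_intros b_lim q_lim a_lim) auto
  have "V \<longlonglongrightarrow> (1 + (\<eta> powr (2 - 2) * (1 - \<eta>\<^sup>2) powr (2 / \<alpha> + 1) * (1 - (0 / \<eta>) ^ n) / n)
      * (r powr 2 - \<eta> powr 2) / (2 * \<alpha>)) powr (- 2 / (2 / \<alpha>))"
  proof -
    have "0 \<le> (1 - \<eta>\<^sup>2) powr (2 / \<alpha> + 1) / n * (r\<^sup>2 - \<eta>\<^sup>2) / (2 * \<alpha>)"
      using \<eta> alpha_pos assms by (intro mult_nonneg_nonneg divide_nonneg_nonneg) (auto intro: power_mono)
    then show ?thesis
      unfolding V_def using \<eta> \<eta>2 alpha_pos n0 assms
      by (intro tendsto_intros H b_lim q_lim)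
         (auto simp: power_0_left dest: add_nonneg_eq_0_iff[THEN iffD1, rotated 2])
  qed
  also have "(1 + (\<eta> powr (2 - 2) * (1 - \<eta>\<^sup>2) powr (2 / \<alpha> + 1) * (1 - (0 / \<eta>) ^ n) / n)
      * (r powr 2 - \<eta> powr 2) / (2 * \<alpha>)) powr (- 2 / (2 / \<alpha>)) = G \<eta>"
    using \<eta> assms n0 by (simp add: G_def power_0_left)
  finally have "\<forall>\<^sub>F k in sequentially. V k < U r + e"
    using \<eta>(1) by (rule order_tendstoD)
  moreover have "\<forall>\<^sub>F k in sequentially. a k < \<eta>"
    using order_tendstoD(2)[OF a_lim] \<eta> by auto
  ultimately show ?thesis
  proof eventually_elim
    case (elim k)
    interpret B: bubble n "q k" "W k" "W' k" "a k" "R k" by (rule bubble)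
    have "(a k / \<eta>) ^ n \<le> 1" using elim \<eta> B.a_nonneg by (intro power_le_one) auto
    then have "0 \<le> H k"
      unfolding H_def by (intro mult_nonneg_nonneg divide_nonneg_nonneg) auto
    then show ?case
      using B.W_le_profile[of \<eta> r "H k"] elim \<eta> unfolding V_def H_def by auto
  qed
qed

lemma p_lim: "(\<lambda>k. q k + 1) \<longlonglongrightarrow> 2 / \<alpha> + 1"
  by (intro tendsto_intros q_lim)

text \<open>The bound from above, inserted into the Green representation, yields the matching bound from
  below; truncating at \<open>R k\<close> lets the same estimate show that \<open>R k\<close> diverges.\<close>

lemma W_lower:
  assumes "0 < r"
  shows "\<exists>L. L \<longlonglongrightarrow> U r \<and> (\<forall>\<^sub>F k in sequentially. L k \<le> W k (min r (R k)))"
proof -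
  define \<rho> where "\<rho> = (\<lambda>k. min r (R k))"
  \<comment> \<open>Off \<open>{a k..\<rho> k}\<close> there is no control of W, so \<open>Y\<close>
    equals U there. The maximum makes \<open>Y\<close> at least U everywhere; its convergence to U
    then needs only the upper bound already proved.\<close>
  define Y where "Y = (\<lambda>k s. if s \<in> {a k..\<rho> k} then max (W k s) (U s) else U s)"
  define f where "f = (\<lambda>k s. green r s * Y k s powr (q k + 1))"
  have Y_nonneg: "0 \<le> Y k s" for k s using U_pos[of s] by (auto simp: Y_def)
  have Y_le: "Y k s \<le> 1" for k s
    using U_le_1[of s] W_le_1[of k s] by (auto simp: Y_def \<rho>_def)
  have f_nonneg: "0 \<le> f k s" if "s \<in> {0..r}" for k s
    using green_bounds[of s r] that assms by (auto simp: f_def)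
  have U_cont: "continuous_on T U" for T
    by (rule DERIV_continuous_on) (rule DERIV_subset[OF U_deriv], simp)
  have f_int: "f k integrable_on {0..r}" for k
  proof -
    define g where "g = (\<lambda>s. green r s * (max (W k s) (U s) powr (q k + 1) - U s powr (q k + 1)))"
    have "g integrable_on {a k..\<rho> k}"
      unfolding g_def using a_nonneg[of k] q_pos[of k] assms U_pos
      by (intro integrable_continuous_interval continuous_intros W_cont U_cont continuous_on_powr')
         (auto simp: le_max_iff_disj less_imp_le)
    moreover have "{a k..\<rho> k} \<inter> {0..r} = {a k..\<rho> k}"
      using a_nonneg[of k] by (auto simp: \<rho>_def)
    ultimately have "(\<lambda>s. if s \<in> {a k..\<rho> k} then g s else 0) integrable_on {0..r}"
      by (simp only: integrable_restrict_Int)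
    moreover have "(\<lambda>s. green r s * U s powr (q k + 1)) integrable_on {0..r}"
      using q_pos[of k] assms U_pos
      by (intro integrable_continuous_interval continuous_intros U_cont continuous_on_powr')
         (auto simp: less_imp_le)
    ultimately have "(\<lambda>s. green r s * U s powr (q k + 1) + (if s \<in> {a k..\<rho> k} then g s else 0)) integrable_on {0..r}"
      by (rule integrable_add[rotated])
    moreover have "(\<lambda>s. green r s * U s powr (q k + 1) + (if s \<in> {a k..\<rho> k} then g s else 0)) = f k"
      by (auto simp: f_def Y_def g_def algebra_simps)
    ultimately show ?thesis by simp
  qed
  have f_le: "norm (f k s) \<le> r" if "s \<in> {0..r}" for k s
  proof -
    have "Y k s powr (q k + 1) \<le> 1 powr (q k + 1)"
      using Y_le Y_nonneg q_pos[of k] by (intro powr_mono2) auto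
    then have "f k s \<le> r * 1" unfolding f_def
      using green_bounds[of s r] that assms by (intro mult_mono) auto
    then show ?thesis using f_nonneg[OF that] by simp
  qed
  have f_lim: "(\<lambda>k. f k s) \<longlonglongrightarrow> green r s * U s powr (2 / \<alpha> + 1)" if "s \<in> {0..r}" for s
  proof (cases "s = 0")
    case True
    have "green r 0 = 0" using n3 by (simp add: green_def)
    then show ?thesis using True by (simp add: f_def)
  next
    case False
    have "(\<lambda>k. Y k s) \<longlonglongrightarrow> U s"
    proof (rule order_tendstoI)
      fix x assume "x < U s"
      then show "\<forall>\<^sub>F k in sequentially. x < Y k s" by (intro always_eventually) (auto simp: Y_def)
    next
      fix x assume x: "U s < x"
      have "\<forall>\<^sub>F k in sequentially. s \<le> R k \<longrightarrow> W k s < U s + (x - U s)"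
        using False that x by (intro eventually_W_less_U) auto
      then show "\<forall>\<^sub>F k in sequentially. Y k s < x"
        by eventually_elim (use x in \<open>auto simp: Y_def \<rho>_def\<close>)
    qed
    then show ?thesis unfolding f_def using U_pos[of s] by (intro tendsto_intros p_lim) auto
  qed
  have "(\<lambda>k. integral {0..r} (f k)) \<longlonglongrightarrow> integral {0..r} (\<lambda>s. green r s * U s powr (2 / \<alpha> + 1))"
    by (rule dominated_convergence[where h = "\<lambda>_. r"]) (use f_int f_le f_lim in auto)
  then have lim: "(\<lambda>k. 1 - integral {0..r} (f k)) \<longlonglongrightarrow> U r"
    using integral_unique[OF green_U_integral[OF assms]] tendsto_diff[OF tendsto_const[of 1]] by fastforce
  have "\<forall>\<^sub>F k in sequentially. a k < r" using order_tendstoD(2)[OF a_lim assms] .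
  then have "\<forall>\<^sub>F k in sequentially. 1 - integral {0..r} (f k) \<le> W k (min r (R k))"
  proof eventually_elim
    case (elim k)
    interpret B: bubble n "q k" "W k" "W' k" "a k" "R k" by (rule bubble)
    have a\<rho>: "a k < \<rho> k" "\<rho> k \<le> r" "\<rho> k \<le> R k" using elim B.a_less_R by (auto simp: \<rho>_def)
    have sub: "{a k..\<rho> k} \<subseteq> {0..r}" using B.a_nonneg a\<rho> by auto
    have "((\<lambda>s. green (\<rho> k) s * W k s powr (q k + 1)) has_integral 1 - W k (\<rho> k)) {a k..\<rho> k}"
      using B.green_integral[of "a k" "\<rho> k"] a\<rho> B.a_nonneg B.W_nonneg by (simp add: B.W_a B.W'_a)
    moreover have "f k integrable_on {a k..\<rho> k}"
      using f_int sub by (rule integrable_on_subinterval)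
    then have "(f k has_integral integral {a k..\<rho> k} (f k)) {a k..\<rho> k}" by (rule integrable_integral)
    \<comment> \<open>Replacing the radius \<rho> by r enlarges the kernel, and \<open>Y\<close> is
      at least W here, so the limit integral over \<open>{0..r}\<close> bounds the drop of
      W.\<close>
    moreover have "green (\<rho> k) s * W k s powr (q k + 1) \<le> f k s" if "s \<in> {a k..\<rho> k}" for s
      unfolding f_def using that a\<rho> B.a_nonneg B.W_nonneg[of s] q_pos[of k] green_bounds[of s r]
      by (intro mult_mono green_mono powr_mono2) (auto simp: Y_def)
    ultimately have "1 - W k (\<rho> k) \<le> integral {a k..\<rho> k} (f k)" by (rule has_integral_le)
    also have "\<dots> \<le> integral {0..r} (f k)"
      using sub f_int f_nonneg \<open>f k integrable_on {a k..\<rho> k}\<close> by (intro integral_subset_le) auto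
    finally show ?case by (simp add: \<rho>_def)
  qed
  with lim show ?thesis by blast
qed

text \<open>Otherwise \<open>min r (R k)\<close> is \<open>R k\<close>, where W vanishes, against a
  lower bound with positive limit U r.\<close>

lemma eventually_less_R:
  assumes "0 < r"
  shows "\<forall>\<^sub>F k in sequentially. r < R k"
proof -
  obtain L where L: "L \<longlonglongrightarrow> U r" "\<forall>\<^sub>F k in sequentially. L k \<le> W k (min r (R k))"
    using W_lower[OF assms] by blast
  have "\<forall>\<^sub>F k in sequentially. 0 < L k" using order_tendstoD(1)[OF L(1)] U_pos by blast
  with L(2) show ?thesis
  proof eventually_elim
    case (elim k)
    show ?case
    proof (rule ccontr)
      assume "\<not> r < R k"
      then show False using elim bubble.W_R[OF bubble, of k] by (simp add: min_def split: if_splits)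
    qed
  qed
qed

lemma W_lim:
  assumes "0 < r"
  shows "(\<lambda>k. W k r) \<longlonglongrightarrow> U r"
proof (rule order_tendstoI)
  fix x assume x: "x < U r"
  obtain L where L: "L \<longlonglongrightarrow> U r" "\<forall>\<^sub>F k in sequentially. L k \<le> W k (min r (R k))"
    using W_lower[OF assms] by blast
  from order_tendstoD(1)[OF L(1) x] L(2) eventually_less_R[OF assms]
  show "\<forall>\<^sub>F k in sequentially. x < W k r" by eventually_elim (auto simp: min_def)
next
  fix x assume x: "U r < x"
  have "\<forall>\<^sub>F k in sequentially. r \<le> R k \<longrightarrow> W k r < U r + (x - U r)"
    using assms x by (intro eventually_W_less_U) auto
  with eventually_less_R[OF assms] show "\<forall>\<^sub>F k in sequentially. W k r < x"
    by eventually_elim auto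
qed

text \<open>Only the order of decay matters, so \<eta> = 1/2 is fixed. The profile grows like r^(q
  \<alpha>) inside the power -2/q, so the rate is r^(-2\<alpha>) for every q.\<close>

lemma decay:
  "\<exists>C\<ge>1. \<forall>\<^sub>F k in sequentially. 3 / 2 \<le> q k * \<alpha> \<and> (\<forall>r. 1 \<le> r \<longrightarrow> a k \<le> r \<longrightarrow> r \<le> R k \<longrightarrow> W k r \<le> C * r powr (- 2 * \<alpha>))"
proof -
  define H where "H = (\<lambda>k. (1/2) powr (2 - q k * \<alpha>) * (1 - (1/2)\<^sup>2) powr (q k + 1) * (1 - (a k / (1/2)) ^ n) / real n)"
  have n0: "n \<noteq> 0" using n3 by auto
  have "H \<longlonglongrightarrow> (1/2) powr (2 - 2) * (1 - (1/2)\<^sup>2) powr (2 / \<alpha> + 1) * (1 - (0 / (1/2)) ^ n) / real n"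
    unfolding H_def using n0 by (intro tendsto_intros b_lim q_lim a_lim) (auto simp: power2_eq_square)
  \<comment> \<open>Half of the limit of \<open>H\<close>, so it is eventually below
    \<open>H k\<close>.\<close>
  moreover define h0 where "h0 = (3/4) powr (2 / \<alpha> + 1) / real n / 2"
  have h0: "h0 > 0" using n0 by (simp add: h0_def)
  have "(1/2) powr (2 - 2) * (1 - (1/2)\<^sup>2) powr (2 / \<alpha> + 1) * (1 - (0 / (1/2)) ^ n) / real n = 2 * h0"
    using n0 by (simp add: h0_def power2_eq_square power_0_left)
  with h0 have "h0 < (1/2) powr (2 - 2) * (1 - (1/2)\<^sup>2) powr (2 / \<alpha> + 1) * (1 - (0 / (1/2)) ^ n) / real n"
    by simp
  ultimately have 1: "\<forall>\<^sub>F k in sequentially. h0 < H k" by (rule order_tendstoD)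
  have 2: "\<forall>\<^sub>F k in sequentially. a k < 1 / 2" by (rule order_tendstoD(2)[OF a_lim]) simp
  have 3: "\<forall>\<^sub>F k in sequentially. 3 / 2 < q k * \<alpha>" by (rule order_tendstoD(1)[OF b_lim]) simp
  \<comment> \<open>With \<open>c1 \<le> 1\<close> and \<open>q k * \<alpha> \<ge> 1\<close> the
    constant c1^(-2/q) is at most c1^(-2\<alpha>), which does not depend on k.\<close>
  define c1 where "c1 = min 1 (h0 / (4 * \<alpha>))"
  have c1: "0 < c1" "c1 \<le> 1" "c1 \<le> h0 / (4 * \<alpha>)" using h0 alpha_pos by (auto simp: c1_def)
  have "\<forall>\<^sub>F k in sequentially. 3 / 2 \<le> q k * \<alpha> \<and>
    (\<forall>r. 1 \<le> r \<longrightarrow> a k \<le> r \<longrightarrow> r \<le> R k \<longrightarrow> W k r \<le> c1 powr (- 2 * \<alpha>) * r powr (- 2 * \<alpha>))"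
    using 1 2 3
  proof eventually_elim
    case (elim k)
    interpret B: bubble n "q k" "W k" "W' k" "a k" "R k" by (rule bubble)
    have "W k r \<le> c1 powr (- 2 * \<alpha>) * r powr (- 2 * \<alpha>)" if r: "1 \<le> r" "r \<le> R k" for r
    proof -
      define b where "b = q k * \<alpha>"
      have b: "3/2 < b" using elim by (simp add: b_def)
      have q: "q k > 0" by (rule q_pos)
      have rb: "1 \<le> r powr b" using r b by (simp add: ge_one_powr_ge_zero)
      have "(1/2) powr b \<le> (1/2::real) powr 1" using b by (intro powr_mono') auto
      then have "r powr b / 2 \<le> r powr b - (1/2) powr b" using rb by simp
      then have "h0 * (r powr b / 2) / (2 * \<alpha>) \<le> h0 * (r powr b - (1/2) powr b) / (2 * \<alpha>)"
        using h0 alpha_pos by (intro divide_right_mono mult_left_mono) auto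
      moreover have "c1 * r powr b \<le> h0 / (4 * \<alpha>) * r powr b"
        using c1 by (intro mult_right_mono) auto
      ultimately have ge: "c1 * r powr b \<le> 1 + h0 * (r powr b - (1/2) powr b) / (2 * \<alpha>)" by simp
      have "W k r \<le> (1 + h0 * (r powr b - (1/2) powr b) / (2 * \<alpha>)) powr (- 2 / q k)"
        unfolding b_def using elim r h0 by (intro B.W_le_profile) (auto simp: H_def)
      also have "\<dots> \<le> (c1 * r powr b) powr (- 2 / q k)"
        using ge c1 r q by (intro powr_mono2') auto
      also have "\<dots> = c1 powr (- 2 / q k) * r powr (- 2 * \<alpha>)"
        using c1 q by (simp add: powr_mult powr_powr b_def mult.commute[of \<alpha>])
      also have "\<dots> \<le> c1 powr (- 2 * \<alpha>) * r powr (- 2 * \<alpha>)"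
        using c1 b q by (intro mult_right_mono powr_mono') (auto simp: b_def field_simps)
      finally show ?thesis .
    qed
    then show ?case using elim by auto
  qed
  moreover have "1 \<le> c1 powr (- 2 * \<alpha>)"
    using powr_mono2'[of "- 2 * \<alpha>" c1 1] c1 alpha_pos by simp
  ultimately show ?thesis by blast
qed

text \<open>Dominated convergence, with j = 0 for the flux and j = 1 for the energy. As W is at most
  1, the extra power j only decreases the integrand, and one majorant serves both.\<close>

lemma bubble_integral_lim:
  assumes j: "0 \<le> j" and g: "((\<lambda>s. s ^ (n - 1) * U s powr (2 / \<alpha> + 1 + j)) has_integral I) {0..}"
    and f: "\<And>k. ((\<lambda>s. s ^ (n - 1) * W k s powr (q k + 1 + j)) has_integral F k) {a k..R k}"
  shows "F \<longlonglongrightarrow> I"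
proof -
  obtain C where C: "C \<ge> 1" "\<forall>\<^sub>F k in sequentially. 3 / 2 \<le> q k * \<alpha> \<and>
    (\<forall>r. 1 \<le> r \<longrightarrow> a k \<le> r \<longrightarrow> r \<le> R k \<longrightarrow> W k r \<le> C * r powr (- 2 * \<alpha>))"
    using decay by blast
  from C(2) obtain N where N: "\<And>k. N \<le> k \<Longrightarrow> 3 / 2 \<le> q k * \<alpha> \<and>
    (\<forall>r. 1 \<le> r \<longrightarrow> a k \<le> r \<longrightarrow> r \<le> R k \<longrightarrow> W k r \<le> C * r powr (- 2 * \<alpha>))"
    unfolding eventually_sequentially by blast
  define Z where "Z = (\<lambda>k s. if s \<in> {a k..R k} then s ^ (n - 1) * W k s powr (q k + 1 + j) else 0)"
  define E where "E = C powr (2 / \<alpha> + 1)"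
  \<comment> \<open>Since \<open>q k * \<alpha> \<ge> 3 / 2\<close>, decay makes W^(q+1) at most a
    constant times s^(-2\<alpha>-3), and the weight s^(2\<alpha>+1) leaves s^(-2).\<close>
  define D where "D = (\<lambda>s::real. if s \<le> 1 then 1 else E * s powr (- 2))"
  have E1: "E \<ge> 1" unfolding E_def using C(1) alpha_pos by (intro ge_one_powr_ge_zero) auto
  have D_int: "D integrable_on {0..}"
  proof (rule integrable_Un')
    show "D integrable_on {0..1}"
      by (rule integrable_eq[of "\<lambda>_. 1"]) (auto simp: D_def)
    have "(\<lambda>s. E * s powr (- 2)) integrable_on {1..}"
      using has_integral_mult_right[OF has_integral_powr_to_inf[of "-2" 1], of E]
      by (auto simp: integrable_on_def)
    then show "D integrable_on {1..}"
      by (rule integrable_spike_finite[of "{1}", rotated 2]) (auto simp: D_def)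
    have "{0..1} \<inter> {1..} = {1::real}" by auto
    then show "negligible ({0..1} \<inter> {1..} :: real set)" by simp
  qed auto
  have Z_has: "(Z k has_integral F k) {0..}" for k
    unfolding Z_def using f[of k] a_nonneg[of k] by (subst has_integral_restrict) auto
  have Z_le: "norm (Z (k + N) s) \<le> D s" if "s \<in> {0..}" for k s
  proof (cases "s \<in> {a (k + N)..R (k + N)}")
    case True
    define K where "K = k + N"
    have K: "3 / 2 \<le> q K * \<alpha>" "\<And>r. 1 \<le> r \<Longrightarrow> a K \<le> r \<Longrightarrow> r \<le> R K \<Longrightarrow> W K r \<le> C * r powr (- 2 * \<alpha>)"
      using N[of K] by (auto simp: K_def)
    have W01: "0 \<le> W K s" "W K s \<le> 1" using True W_nonneg W_le_1 by (auto simp: K_def)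
    have qK: "q K > 0" by (rule q_pos)
    have "W K s powr (q K + 1 + j) \<le> W K s powr (q K + 1)"
      using W01 j qK by (cases "W K s = 0") (auto intro: powr_mono')
    then have ZK: "norm (Z K s) \<le> s ^ (n - 1) * W K s powr (q K + 1)"
      using that True by (auto simp: Z_def K_def intro: mult_left_mono)
    show ?thesis
    proof (cases "s \<le> 1")
      case True
      have "s ^ (n - 1) * W K s powr (q K + 1) \<le> 1 * 1"
        using True that W01 qK by (intro mult_mono power_le_one powr_le1) auto
      then show ?thesis using ZK True by (simp add: D_def K_def)
    next
      case False
      then have s: "s > 1" by simp
      have "W K s powr (q K + 1) \<le> (C * s powr (- 2 * \<alpha>)) powr (q K + 1)"
        using W01 qK K(2)[of s] True s by (intro powr_mono2) (auto simp: K_def)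
      also have "\<dots> = C powr (q K + 1) * s powr (- 2 * \<alpha> * (q K + 1))"
        using C(1) by (simp add: powr_mult powr_powr)
      also have "\<dots> \<le> E * s powr (- 2 * \<alpha> - 3)"
        unfolding E_def using C(1) s K(1) q_less[of K] alpha_pos
        by (intro mult_mono powr_mono) (auto simp: field_simps)
      finally have "s ^ (n - 1) * W K s powr (q K + 1) \<le> s powr (2 * \<alpha> + 1) * (E * s powr (- 2 * \<alpha> - 3))"
        using s by (simp add: powr_real_nat n_minus)
      also have "\<dots> = D s"
        using s powr_add[of s "2 * \<alpha> + 1" "- 2 * \<alpha> - 3"] by (simp add: D_def)
      finally show ?thesis using ZK by (simp add: K_def)
    qed
  next
    case False
    have "0 \<le> D s" using E1 by (auto simp: D_def)
    moreover have "Z (k + N) s = 0" using False unfolding Z_def by (rule if_not_P)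
    ultimately show ?thesis by simp
  qed
  have Z_lim: "(\<lambda>k. Z k s) \<longlonglongrightarrow> s ^ (n - 1) * U s powr (2 / \<alpha> + 1 + j)" if "s \<in> {0..}" for s
  proof (cases "s = 0")
    case True
    then have "s ^ (n - 1) = 0" using n3 by auto
    then show ?thesis by (simp only: Z_def mult_zero_left if_cancel tendsto_const)
  next
    case False
    with that have s: "s > 0" by auto
    have "(\<lambda>k. s ^ (n - 1) * W k s powr (q k + 1 + j)) \<longlonglongrightarrow> s ^ (n - 1) * U s powr (2 / \<alpha> + 1 + j)"
      using U_pos[of s] by (intro tendsto_intros W_lim[OF s] q_lim) auto
    moreover have "\<forall>\<^sub>F k in sequentially. s ^ (n - 1) * W k s powr (q k + 1 + j) = Z k s"
      using eventually_less_R[OF s] order_tendstoD(2)[OF a_lim s]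
      by eventually_elim (auto simp: Z_def)
    ultimately show ?thesis by (rule Lim_transform_eventually)
  qed
  have "(\<lambda>k. integral {0..} (Z (k + N))) \<longlonglongrightarrow> integral {0..} (\<lambda>s. s ^ (n - 1) * U s powr (2 / \<alpha> + 1 + j))"
    by (rule dominated_convergence[where h = D])
       (use Z_has Z_le D_int LIMSEQ_ignore_initial_segment[OF Z_lim] in \<open>auto simp: integrable_on_def\<close>)
  then have "(\<lambda>k. F (k + N)) \<longlonglongrightarrow> I"
    using g by (simp add: integral_unique[OF Z_has] integral_unique)
  then show ?thesis by (rule LIMSEQ_offset)
qed

theorem flux_lim: "(\<lambda>k. - (R k ^ (n - 1) * W' k (R k))) \<longlonglongrightarrow> A"
proof (rule bubble_integral_lim[of 0])
  show "((\<lambda>s. s ^ (n - 1) * W k s powr (q k + 1 + 0)) has_integral - (R k ^ (n - 1) * W' k (R k))) {a k..R k}" for k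
  proof -
    interpret B: bubble n "q k" "W k" "W' k" "a k" "R k" by (rule bubble)
    show ?thesis
      using B.flux_integral[of "a k" "R k"] B.a_nonneg B.a_less_R B.W_nonneg
      unfolding B.flux_a by (simp add: B.flux_def)
  qed
qed (use U_flux_integral in auto)

theorem pohozaev_lim:
  "(\<lambda>k. (radial_solution.pohozaev n (q k) (W k) (W' k) (R k) - radial_solution.pohozaev n (q k) (W k) (W' k) (a k))
    / radial_solution.\<delta> n (q k)) \<longlonglongrightarrow> S"
proof (rule bubble_integral_lim[of 1])
  show "((\<lambda>s. s ^ (n - 1) * W k s powr (q k + 1 + 1)) has_integral
    (radial_solution.pohozaev n (q k) (W k) (W' k) (R k) - radial_solution.pohozaev n (q k) (W k) (W' k) (a k))
    / radial_solution.\<delta> n (q k)) {a k..R k}" for k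
  proof -
    interpret B: bubble n "q k" "W k" "W' k" "a k" "R k" by (rule bubble)
    show ?thesis
      using B.pohozaev_integral[OF B.q_less, of "a k" "R k"] B.a_nonneg B.a_less_R B.W_pos
      by (simp add: add.assoc)
  qed
qed (use U_energy_integral in \<open>auto simp: add.assoc\<close>)

end

section \<open>Rescaling a nodal region\<close>

lemma continuous_same_sign:
  fixes f :: "real \<Rightarrow> real"
  assumes "continuous_on {a..b} f" "a \<le> b" "\<And>x. a \<le> x \<Longrightarrow> x \<le> b \<Longrightarrow> f x \<noteq> 0"
  shows "sgn (f a) = sgn (f b)"
proof (rule ccontr)
  assume ne: "sgn (f a) \<noteq> sgn (f b)"
  have "f a \<noteq> 0" "f b \<noteq> 0" using assms by auto
  with ne have "f a \<le> 0 \<and> 0 \<le> f b \<or> f b \<le> 0 \<and> 0 \<le> f a" by (auto simp: sgn_if split: if_splits)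
  then obtain x where "a \<le> x" "x \<le> b" "f x = 0"
    using IVT'[of f a 0 b] IVT2'[of f b 0 a] assms by blast
  with assms(3) show False by blast
qed

context radial_solution
begin

text \<open>The scaling symmetry of the equation: heights by M, radii by M^(q/2). The sign \<sigma>
  makes the piece positive; M = 1 gives a mere reflection.\<close>

definition scaled :: "real \<Rightarrow> real \<Rightarrow> real \<Rightarrow> real" where
  "scaled \<sigma> M \<rho> = \<sigma> * W (\<rho> / M powr (q / 2)) / M"

definition scaled' :: "real \<Rightarrow> real \<Rightarrow> real \<Rightarrow> real" where
  "scaled' \<sigma> M \<rho> = \<sigma> * W' (\<rho> / M powr (q / 2)) / (M powr (q / 2) * M)"

lemma scaled_radial_solution:
  assumes M: "0 < M" and \<sigma>: "\<bar>\<sigma>\<bar> = 1"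
  shows "radial_solution n q (scaled \<sigma> M) (scaled' \<sigma> M)"
proof
  define \<mu> where "\<mu> = M powr (q / 2)"
  have \<mu>: "\<mu> > 0" using M by (simp add: \<mu>_def)
  have \<mu>2: "\<mu> * \<mu> = M powr q" using M by (simp add: \<mu>_def powr_add[symmetric])
  show "0 < q" "q * \<alpha> \<le> 2" by (fact q_pos q_le)+
  have lin: "((\<lambda>\<rho>. \<rho> / \<mu>) has_real_derivative 1 / \<mu>) (at \<rho>)" for \<rho>
    by (rule DERIV_cdivide[OF DERIV_ident])
  show "(scaled \<sigma> M has_real_derivative scaled' \<sigma> M \<rho>) (at \<rho>)" if "0 < \<rho>" for \<rho>
  proof -
    have "0 < \<rho> / \<mu>" using that \<mu> by simp
    from DERIV_cdivide[OF DERIV_cmult[OF DERIV_chain2[OF W_deriv[OF this] lin], of \<sigma>], of M]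
    show ?thesis unfolding scaled_def[abs_def] scaled'_def \<mu>_def[symmetric] by (simp add: mult.commute)
  qed
  show "(scaled' \<sigma> M has_real_derivative
      - (real n - 1) / \<rho> * scaled' \<sigma> M \<rho> - \<bar>scaled \<sigma> M \<rho>\<bar> powr q * scaled \<sigma> M \<rho>) (at \<rho>)"
    if "0 < \<rho>" for \<rho>
  proof -
    define u u' where "u = W (\<rho> / \<mu>)" and "u' = W' (\<rho> / \<mu>)"
    have "0 < \<rho> / \<mu>" using that \<mu> by simp
    from DERIV_cdivide[OF DERIV_cmult[OF DERIV_chain2[OF W'_deriv[OF this] lin], of \<sigma>], of "\<mu> * M"]
    have "(scaled' \<sigma> M has_real_derivative
      \<sigma> * ((- (real n - 1) / (\<rho> / \<mu>) * u' - \<bar>u\<bar> powr q * u) * (1 / \<mu>)) / (\<mu> * M)) (at \<rho>)"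
      unfolding scaled'_def[abs_def] \<mu>_def[symmetric] u_def u'_def .
    moreover have "\<sigma> * ((- (real n - 1) / (\<rho> / \<mu>) * u' - \<bar>u\<bar> powr q * u) * (1 / \<mu>)) / (\<mu> * M)
      = - (real n - 1) / \<rho> * (\<sigma> * u' / (\<mu> * M)) - (\<bar>u\<bar> powr q / (\<mu> * \<mu>)) * (\<sigma> * u / M)"
      using \<mu> M that by (simp add: field_simps)
    moreover have "\<bar>u\<bar> powr q / (\<mu> * \<mu>) = \<bar>\<sigma> * u / M\<bar> powr q"
      unfolding \<mu>2 using M \<sigma> by (simp add: abs_mult powr_divide)
    ultimately show ?thesis unfolding scaled_def scaled'_def \<mu>_def[symmetric] u_def u'_def by simp
  qed
  have im: "(\<lambda>\<rho>. \<rho> / \<mu>) ` {0..} \<subseteq> {0..}" using \<mu> by auto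
  show "continuous_on {0..} (scaled \<sigma> M)"
    unfolding scaled_def[abs_def] \<mu>_def[symmetric] using M \<mu>
    by (intro continuous_intros continuous_on_compose2[OF W_cont _ im]) auto
  show "continuous_on {0..} (scaled' \<sigma> M)"
    unfolding scaled'_def[abs_def] \<mu>_def[symmetric] using M \<mu>
    by (intro continuous_intros continuous_on_compose2[OF W'_cont _ im]) auto
qed

lemma powr_half_power:
  assumes "0 < M"
  shows "(M powr (q / 2)) ^ (n - 2) = M powr (q * \<alpha>)"
  using assms by (simp add: powr_real_nat powr_powr n_minus)

text \<open>The factor \<open>M powr (q * \<alpha> - 2)\<close> measures the failure of scale
  invariance and is 1 at the critical exponent; \<open>pohozaev\<close> picks up the same
  factor.\<close>

lemma scaled_flux:
  assumes M: "0 < M" and \<sigma>: "\<bar>\<sigma>\<bar> = 1"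
  shows "(r * M powr (q / 2)) ^ (n - 1) * scaled' \<sigma> M (r * M powr (q / 2))
    = M powr (q * \<alpha> - 2) * (M * (\<sigma> * (r ^ (n - 1) * W' r)))"
proof -
  define \<mu> where "\<mu> = M powr (q / 2)"
  have \<mu>: "\<mu> > 0" using M by (simp add: \<mu>_def)
  have "M powr (q * \<alpha> - 2) = \<mu> ^ (n - 2) / M\<^sup>2"
    using M by (simp add: powr_half_power \<mu>_def powr_diff)
  then show ?thesis
    using M \<mu> power_n(2)[of \<mu>] unfolding scaled'_def \<mu>_def[symmetric] power_mult_distrib
    by (simp add: field_simps power2_eq_square)
qed

lemma scaled_pohozaev:
  assumes M: "0 < M" and \<sigma>: "\<bar>\<sigma>\<bar> = 1"
  shows "radial_solution.pohozaev n q (scaled \<sigma> M) (scaled' \<sigma> M) (r * M powr (q / 2))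
    = M powr (q * \<alpha> - 2) * pohozaev r"
proof -
  interpret S: radial_solution n q "scaled \<sigma> M" "scaled' \<sigma> M" by (rule scaled_radial_solution[OF M \<sigma>])
  define \<mu> where "\<mu> = M powr (q / 2)"
  have \<mu>: "\<mu> > 0" using M by (simp add: \<mu>_def)
  have \<mu>2: "\<mu> * \<mu> = M powr q" using M by (simp add: \<mu>_def powr_add[symmetric])
  have \<sigma>2: "\<sigma>\<^sup>2 = 1" "\<sigma> * \<sigma> = 1" using \<sigma> by (auto simp: abs_if power2_eq_square split: if_splits)
  define Q where "Q = \<bar>W r\<bar> powr (q + 2) / (q + 2)"
  have "\<bar>\<sigma> * W r / M\<bar> powr (q + 2) = \<bar>W r\<bar> powr (q + 2) / (\<mu> * \<mu> * M\<^sup>2)"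
    using M \<sigma> by (simp add: abs_mult powr_divide powr_add \<mu>2)
  then have Q: "\<bar>\<sigma> * W r / M\<bar> powr (q + 2) / (q + 2) = Q / (\<mu> * \<mu> * M\<^sup>2)"
    by (simp add: Q_def)
  have 1: "M powr (q * \<alpha> - 2) = \<mu> ^ (n - 2) / M\<^sup>2"
    using M by (simp add: powr_half_power \<mu>_def powr_diff)
  have W: "scaled \<sigma> M (r * \<mu>) = \<sigma> * W r / M" "scaled' \<sigma> M (r * \<mu>) = \<sigma> * W' r / (\<mu> * M)"
    using \<mu> by (auto simp: scaled_def scaled'_def \<mu>_def[symmetric])
  have "S.pohozaev (r * \<mu>) = (r * \<mu>) ^ n * ((\<sigma> * W' r / (\<mu> * M))\<^sup>2 / 2 + Q / (\<mu> * \<mu> * M\<^sup>2))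
    + \<alpha> * (r * \<mu>) ^ (n - 1) * (\<sigma> * W r / M) * (\<sigma> * W' r / (\<mu> * M))"
    unfolding S.pohozaev_def W Q ..
  also have "\<dots> = \<mu> ^ (n - 2) / M\<^sup>2 * (r ^ n * ((W' r)\<^sup>2 / 2 + Q) + \<alpha> * r ^ (n - 1) * W r * W' r * \<sigma>\<^sup>2)"
    using M \<mu> unfolding power_mult_distrib power_n(1)[of \<mu>] power_n(2)[of \<mu>] power_divide \<sigma>2(1)
    by (simp add: field_simps power2_eq_square \<sigma>2)
  finally show ?thesis unfolding pohozaev_def Q_def \<sigma>2 1 \<mu>_def by simp
qed

lemma scaled_bubble:
  assumes "q * \<alpha> < 2" "0 \<le> s" "s < r" "W' s = 0" "W r = 0" "\<And>t. s \<le> t \<Longrightarrow> t < r \<Longrightarrow> W t \<noteq> 0"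
  defines "M \<equiv> \<bar>W s\<bar>"
  shows "bubble n q (scaled (sgn (W s)) M) (scaled' (sgn (W s)) M) (s * M powr (q / 2)) (r * M powr (q / 2))"
proof -
  have Ws: "W s \<noteq> 0" using assms by auto
  then have M: "M > 0" by (simp add: M_def)
  define \<mu> where "\<mu> = M powr (q / 2)"
  have \<mu>: "\<mu> > 0" using M by (simp add: \<mu>_def)
  have \<sigma>: "\<bar>sgn (W s)\<bar> = 1" using Ws by (simp add: abs_sgn_eq)
  interpret S: radial_solution n q "scaled (sgn (W s)) M" "scaled' (sgn (W s)) M"
    by (rule scaled_radial_solution[OF M \<sigma>])
  show ?thesis unfolding \<mu>_def[symmetric]
  proof
    fix \<rho> assume \<rho>: "s * \<mu> \<le> \<rho>" "\<rho> < r * \<mu>"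
    then have t: "s \<le> \<rho> / \<mu>" "\<rho> / \<mu> < r" using \<mu> by (auto simp: field_simps)
    then have "sgn (W s) = sgn (W (\<rho> / \<mu>))"
      using assms by (intro continuous_same_sign W_cont') auto
    moreover have "W (\<rho> / \<mu>) \<noteq> 0" using assms t by auto
    ultimately have "0 < sgn (W s) * W (\<rho> / \<mu>)" by (simp add: sgn_if)
    then show "0 < scaled (sgn (W s)) M \<rho>" using M by (simp add: scaled_def \<mu>_def)
  next
    show "scaled (sgn (W s)) M (s * \<mu>) = 1"
      using \<mu> M by (simp add: scaled_def \<mu>_def[symmetric]) (simp add: M_def sgn_if)
    show "scaled' (sgn (W s)) M (s * \<mu>) = 0" "scaled (sgn (W s)) M (r * \<mu>) = 0"
      using \<mu> \<open>W' s = 0\<close> \<open>W r = 0\<close> by (auto simp: scaled_def scaled'_def \<mu>_def[symmetric])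
  qed (use assms(1-3) \<mu> in auto)
qed

end

text \<open>The bubble limits in unscaled quantities. \<open>s_lim\<close> says that the hole of the
  rescaled annulus closes, \<open>M_lim\<close> that the scaling defect disappears.\<close>

lemma (in dimension) falling_lim:
  fixes q :: "nat \<Rightarrow> real" and W W' :: "nat \<Rightarrow> real \<Rightarrow> real" and s r :: "nat \<Rightarrow> real"
  defines "M \<equiv> \<lambda>k. \<bar>W k (s k)\<bar>"
  assumes sol: "\<And>k. radial_solution n (q k) (W k) (W' k)" and q: "\<And>k. q k * \<alpha> < 2" "q \<longlonglongrightarrow> 2 / \<alpha>"
    and sr: "\<And>k. 0 \<le> s k" "\<And>k. s k < r k" "\<And>k. W' k (s k) = 0" "\<And>k. W k (r k) = 0"
      "\<And>k t. s k \<le> t \<Longrightarrow> t < r k \<Longrightarrow> W k t \<noteq> 0"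
    and s_lim: "(\<lambda>k. s k * M k powr (q k / 2)) \<longlonglongrightarrow> 0"
    and M_lim: "(\<lambda>k. M k powr (q k * \<alpha> - 2)) \<longlonglongrightarrow> 1"
  shows "(\<lambda>k. M k * (r k ^ (n - 1) * \<bar>W' k (r k)\<bar>)) \<longlonglongrightarrow> A"
    and "(\<lambda>k. (radial_solution.pohozaev n (q k) (W k) (W' k) (r k) - radial_solution.pohozaev n (q k) (W k) (W' k) (s k))
      / radial_solution.\<delta> n (q k)) \<longlonglongrightarrow> S"
proof -
  have M: "M k > 0" for k using sr(2,5)[of k] by (simp add: M_def)
  have \<sigma>: "\<bar>sgn (W k (s k))\<bar> = 1" for k using M[of k] by (simp add: M_def abs_sgn_eq)
  define V V' where "V = (\<lambda>k. radial_solution.scaled (q k) (W k) (sgn (W k (s k))) (M k))"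
    and "V' = (\<lambda>k. radial_solution.scaled' (q k) (W' k) (sgn (W k (s k))) (M k))"
  interpret B: bubble_sequence n q V V' "\<lambda>k. s k * M k powr (q k / 2)" "\<lambda>k. r k * M k powr (q k / 2)"
  proof (intro bubble_sequence.intro bubble_sequence_axioms.intro dimension_axioms q(2) s_lim)
    show "bubble n (q k) (V k) (V' k) (s k * M k powr (q k / 2)) (r k * M k powr (q k / 2))" for k
      unfolding V_def V'_def M_def by (rule radial_solution.scaled_bubble[OF sol q(1) sr])
  qed
  have fl: "- ((r k * M k powr (q k / 2)) ^ (n - 1) * V' k (r k * M k powr (q k / 2)))
    = M k powr (q k * \<alpha> - 2) * (M k * (r k ^ (n - 1) * \<bar>W' k (r k)\<bar>))" for k
  proof -
    interpret B: bubble n "q k" "V k" "V' k" "s k * M k powr (q k / 2)" "r k * M k powr (q k / 2)"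
      by (rule B.bubble)
    have eq: "(r k * M k powr (q k / 2)) ^ (n - 1) * V' k (r k * M k powr (q k / 2))
      = M k powr (q k * \<alpha> - 2) * (M k * (sgn (W k (s k)) * (r k ^ (n - 1) * W' k (r k))))"
      unfolding V'_def by (rule radial_solution.scaled_flux[OF sol M \<sigma>])
    have "0 \<le> - ((r k * M k powr (q k / 2)) ^ (n - 1) * V' k (r k * M k powr (q k / 2)))"
      using B.flux_nonneg[of "r k * M k powr (q k / 2)"] B.a_less_R by (simp add: B.flux_def)
    then have "- ((r k * M k powr (q k / 2)) ^ (n - 1) * V' k (r k * M k powr (q k / 2)))
      = \<bar>(r k * M k powr (q k / 2)) ^ (n - 1) * V' k (r k * M k powr (q k / 2))\<bar>" by linarith
    also have "\<dots> = M k powr (q k * \<alpha> - 2) * (M k * (r k ^ (n - 1) * \<bar>W' k (r k)\<bar>))"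
      unfolding eq using M[of k] sr(1,2)[of k] \<sigma>[of k] by (simp add: abs_mult)
    finally show ?thesis .
  qed
  have "(\<lambda>k. M k powr (q k * \<alpha> - 2) * (M k * (r k ^ (n - 1) * \<bar>W' k (r k)\<bar>)) / M k powr (q k * \<alpha> - 2)) \<longlonglongrightarrow> A / 1"
    using B.flux_lim unfolding fl by (rule tendsto_divide[OF _ M_lim]) simp
  then show "(\<lambda>k. M k * (r k ^ (n - 1) * \<bar>W' k (r k)\<bar>)) \<longlonglongrightarrow> A"
    using M by (simp add: less_imp_neq[symmetric])
  have ph: "radial_solution.pohozaev n (q k) (V k) (V' k) (t * M k powr (q k / 2))
    = M k powr (q k * \<alpha> - 2) * radial_solution.pohozaev n (q k) (W k) (W' k) t" for k t
    unfolding V_def V'_def by (rule radial_solution.scaled_pohozaev[OF sol M \<sigma>])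
  have "(\<lambda>k. M k powr (q k * \<alpha> - 2) * ((radial_solution.pohozaev n (q k) (W k) (W' k) (r k)
      - radial_solution.pohozaev n (q k) (W k) (W' k) (s k)) / radial_solution.\<delta> n (q k))) \<longlonglongrightarrow> S"
    using B.pohozaev_lim unfolding ph right_diff_distrib[symmetric] times_divide_eq_right[symmetric] .
  from tendsto_divide[OF this M_lim]
  show "(\<lambda>k. (radial_solution.pohozaev n (q k) (W k) (W' k) (r k) - radial_solution.pohozaev n (q k) (W k) (W' k) (s k))
      / radial_solution.\<delta> n (q k)) \<longlonglongrightarrow> S"
    using M by (simp add: less_imp_neq[symmetric])
qed

section \<open>From a zero to the next critical point\<close>

locale rise = radial_solution +
  fixes R T :: real
  assumes q_less: "q * \<alpha> < 2" and R_pos: "0 < R" and R_less_T: "R < T"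
    and W_R: "W R = 0" and W'_T: "W' T = 0"
    and W_pos: "\<And>t. R < t \<Longrightarrow> t \<le> T \<Longrightarrow> 0 < W t"
begin

definition B :: real where "B = R ^ (n - 1) * W' R"

text \<open>The plateau: the value at infinity of the harmonic function C (1 - (R/r)^(n-2)), which
  vanishes at R with slope W' R.\<close>

definition C :: real where "C = R * W' R / (2 * \<alpha>)"

lemma W_nonneg: "R \<le> t \<Longrightarrow> t \<le> T \<Longrightarrow> 0 \<le> W t"
  using W_pos[of t] W_R by (cases "t = R") auto

lemma B_C: "B = 2 * \<alpha> * C * R ^ (n - 2)"
  using alpha_pos by (simp add: B_def C_def power_n(2))

lemma B_integral: "((\<lambda>s. s ^ (n - 1) * W s powr (q + 1)) has_integral B) {R..T}"
  using flux_integral[of R T] R_pos R_less_T W_nonneg by (simp add: flux_def B_def W'_T)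

lemma W'_nonneg:
  assumes "R \<le> r" "r \<le> T"
  shows "0 \<le> W' r"
proof -
  have "0 \<le> flux T - flux r"
    using assms R_pos W_nonneg by (intro has_integral_nonneg[OF flux_integral[of r T]]) auto
  moreover have "0 < r ^ (n - 1)" using assms R_pos by simp
  ultimately show ?thesis by (simp add: flux_def W'_T zero_le_mult_iff del: zero_less_power)
qed

lemma W_mono:
  assumes "R \<le> s" "s \<le> t" "t \<le> T"
  shows "W s \<le> W t"
proof (rule DERIV_nonneg_imp_nondecreasing[OF assms(2)])
  fix x assume x: "s \<le> x" "x \<le> t"
  have "0 < x" using x assms R_pos by auto
  then show "\<exists>y. (W has_real_derivative y) (at x) \<and> 0 \<le> y"
    using W_deriv W'_nonneg[of x] x assms by force
qed

text \<open>Bounds T from above: as W increases, the flux spent on \<open>{t..T}\<close> alone is at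
  least W(t)^(q+1) (T^n - t^n) / n, and only B is available.\<close>

lemma B_ge:
  assumes "R \<le> t" "t \<le> T"
  shows "W t powr (q + 1) * (T ^ n - t ^ n) \<le> n * B"
proof -
  have i: "((\<lambda>s. s ^ (n - 1) * W s powr (q + 1)) has_integral flux T - flux t) {t..T}"
    "((\<lambda>s. s ^ (n - 1) * W s powr (q + 1)) has_integral flux t - flux R) {R..t}"
    using assms R_pos W_nonneg by (auto intro!: flux_integral)
  have "((\<lambda>s. W t powr (q + 1) * s ^ (n - 1)) has_integral W t powr (q + 1) * (T ^ n / n - t ^ n / n)) {t..T}"
    using power_integral[of t T] assms R_pos by (intro has_integral_mult_right) auto
  then have "W t powr (q + 1) * (T ^ n / n - t ^ n / n) \<le> flux T - flux t"
  proof (rule has_integral_le[OF _ i(1)])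
    show "W t powr (q + 1) * s ^ (n - 1) \<le> s ^ (n - 1) * W s powr (q + 1)" if "s \<in> {t..T}" for s
      using that W_mono[of t s] W_nonneg[of t] assms q_pos R_pos
      by (auto simp: mult.commute intro!: mult_left_mono powr_mono2)
  qed
  moreover have "0 \<le> flux t - flux R"
    using has_integral_nonneg[OF i(2)] assms R_pos by auto
  moreover have "flux T - flux R = B" by (simp add: flux_def B_def W'_T)
  ultimately have "W t powr (q + 1) * (T ^ n / n - t ^ n / n) \<le> B" by linarith
  then have "W t powr (q + 1) * (T ^ n - t ^ n) / n \<le> B"
    by (simp only: diff_divide_distrib[symmetric] times_divide_eq_right)
  then show ?thesis using n3 by (simp add: divide_le_eq mult.commute)
qed

lemma B_pos: "0 < B"
proof -
  have "((R + T) / 2) ^ n < T ^ n" using R_pos R_less_T n3 by (intro power_strict_mono) auto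
  then have "0 < W ((R + T) / 2) powr (q + 1) * (T ^ n - ((R + T) / 2) ^ n)"
    using W_pos[of "(R + T) / 2"] R_less_T by simp
  also have "\<dots> \<le> n * B" using R_less_T by (intro B_ge) auto
  finally show ?thesis using n3 by (simp add: zero_less_mult_iff)
qed

lemma C_pos: "0 < C"
  using B_pos R_pos alpha_pos unfolding B_C by (simp add: zero_less_mult_iff)

lemma green_R: "r > 0 \<Longrightarrow> green r R * W' R = C * (1 - (R / r) ^ (n - 2))"
  using alpha_pos by (simp add: green_def C_def power_n(2)[of R] field_simps power_divide)

text \<open>The source is nonnegative, so W stays below the harmonic function with the same data at
  R, hence below its limit.\<close>

lemma W_le:
  assumes "R \<le> r" "r \<le> T"
  shows "W r \<le> C"
proof (cases "r = R")
  case False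
  then have r: "R < r" using assms by auto
  have "0 \<le> W R + green r R * W' R - W r"
    using r R_pos W_nonneg assms green_bounds
    by (intro has_integral_nonneg[OF green_integral[of R r]]) auto
  moreover have "C * (1 - (R / r) ^ (n - 2)) \<le> C * 1"
    using C_pos R_pos r by (intro mult_left_mono) auto
  ultimately show ?thesis using green_R[of r] r R_pos W_R by simp
qed (use C_pos W_R in auto)

text \<open>The two errors are the distance of the harmonic function from its limit and the Green
  integral of the source, estimated with W at most C and kernel at most s.\<close>

lemma W_ge:
  assumes "R < r" "r \<le> T"
  shows "C * (1 - ((R / r) ^ (n - 2) + C powr q * r\<^sup>2 / 2)) \<le> W r"
proof -
  have "((\<lambda>s. green r s * W s powr (q + 1)) has_integral W R + green r R * W' R - W r) {R..r}"
    using assms R_pos W_nonneg by (intro green_integral) auto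
  moreover have "((\<lambda>s. C powr (q + 1) * s) has_integral C powr (q + 1) * ((r\<^sup>2 - R\<^sup>2) / 2)) {R..r}"
    using ident_has_integral[of R r] assms
    by (intro has_integral_mult_right) (auto simp: diff_divide_distrib)
  moreover have "green r s * W s powr (q + 1) \<le> C powr (q + 1) * s" if "s \<in> {R..r}" for s
    using that assms R_pos green_bounds[of s r] W_le[of s] W_nonneg[of s] q_pos
    by (subst mult.commute) (intro mult_mono powr_mono2, auto)
  ultimately have "W R + green r R * W' R - W r \<le> C powr (q + 1) * ((r\<^sup>2 - R\<^sup>2) / 2)"
    by (rule has_integral_le)
  also have "\<dots> \<le> C powr (q + 1) * (r\<^sup>2 / 2)" by (intro mult_left_mono) auto
  finally show ?thesis using green_R[of r] assms R_pos C_pos W_R by (simp add: powr_add algebra_simps)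
qed

text \<open>Bounds T from below: with W at most C the whole flux B cannot be spent too
  early.\<close>

lemma B_le: "n * B \<le> C powr (q + 1) * T ^ n"
proof -
  have "((\<lambda>s. C powr (q + 1) * s ^ (n - 1)) has_integral C powr (q + 1) * (T ^ n / n - R ^ n / n)) {R..T}"
    using power_integral[of R T] R_pos R_less_T by (intro has_integral_mult_right) auto
  with B_integral have "B \<le> C powr (q + 1) * (T ^ n / n - R ^ n / n)"
    by (rule has_integral_le) (use W_le W_nonneg q_pos R_pos in \<open>auto simp: mult.commute intro!: mult_left_mono powr_mono2\<close>)
  also have "\<dots> \<le> C powr (q + 1) * (T ^ n / n)" using R_pos by (intro mult_left_mono) auto
  finally show ?thesis using n3 by (simp add: field_simps)
qed

text \<open>The energy integrand is at most C times the flux integrand. In the recursion C B tends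
  to 0, so rising pieces add no energy in the limit.\<close>

lemma pohozaev_bounds: "0 \<le> (pohozaev T - pohozaev R) / \<delta>" "(pohozaev T - pohozaev R) / \<delta> \<le> C * B"
proof -
  have i: "((\<lambda>s. s ^ (n - 1) * W s powr (q + 2)) has_integral (pohozaev T - pohozaev R) / \<delta>) {R..T}"
    using R_pos R_less_T W_pos by (intro pohozaev_integral[OF q_less]) auto
  then show "0 \<le> (pohozaev T - pohozaev R) / \<delta>" by (rule has_integral_nonneg) (use R_pos in auto)
  show "(pohozaev T - pohozaev R) / \<delta> \<le> C * B"
  proof (rule has_integral_le[OF i has_integral_mult_right[OF B_integral]])
    fix s assume s: "s \<in> {R..T}"
    have "W s powr (q + 2) = W s * W s powr (q + 1)"
      using W_nonneg[of s] s powr_add[of "W s" 1 "q + 1"] by (cases "W s = 0") (auto simp: add_ac)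
    also have "\<dots> \<le> C * W s powr (q + 1)" using W_le[of s] s by (intro mult_right_mono) auto
    finally show "s ^ (n - 1) * W s powr (q + 2) \<le> C * (s ^ (n - 1) * W s powr (q + 1))"
      using s R_pos mult_left_mono[of "W s powr (q + 2)" "C * W s powr (q + 1)" "s ^ (n - 1)"]
      by (simp add: mult_ac)
  qed
qed

end

lemma (in radial_solution) scaled_rise:
  assumes "q * \<alpha> < 2" "0 < R" "R < T" "W R = 0" "W' T = 0" "\<And>t. R < t \<Longrightarrow> t \<le> T \<Longrightarrow> W t \<noteq> 0"
  shows "rise n q (scaled (sgn (W T)) 1) (scaled' (sgn (W T)) 1) R T"
proof -
  have WT: "W T \<noteq> 0" using assms by auto
  interpret S: radial_solution n q "scaled (sgn (W T)) 1" "scaled' (sgn (W T)) 1"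
    by (rule scaled_radial_solution) (use WT in \<open>auto simp: abs_sgn_eq\<close>)
  show ?thesis
  proof
    fix t assume t: "R < t" "t \<le> T"
    then have "sgn (W t) = sgn (W T)" using assms by (intro continuous_same_sign W_cont') auto
    moreover have "W t \<noteq> 0" using assms t by auto
    ultimately show "0 < scaled (sgn (W T)) 1 t" by (simp add: scaled_def sgn_if split: if_splits)
  qed (use assms(1-5) in \<open>auto simp: scaled_def scaled'_def\<close>)
qed

section \<open>Height and position of the next critical point\<close>

context dimension
begin

text \<open>One parameter controls everything: \<open>R^2 * C powr q\<close> and
  \<open>T0^2 * C powr q\<close> are powers of multiples of
  \<open>G = B * C powr (q * \<alpha> - 1)\<close>. Their smallness makes R / T0 small and both
  error terms of \<open>W_ge\<close> small at an intermediate radius.\<close>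

lemma rising_asymptotics:
  fixes q :: "nat \<Rightarrow> real" and W W' :: "nat \<Rightarrow> real \<Rightarrow> real" and R T :: "nat \<Rightarrow> real"
  assumes rise: "\<And>k. rise n (q k) (W k) (W' k) (R k) (T k)" and q_lim: "q \<longlonglongrightarrow> 2 / \<alpha>"
  defines "B \<equiv> \<lambda>k. R k ^ (n - 1) * W' k (R k)" and "C \<equiv> \<lambda>k. R k * W' k (R k) / (2 * \<alpha>)"
  assumes G_lim: "(\<lambda>k. B k * C k powr (q k * \<alpha> - 1)) \<longlonglongrightarrow> 0"
  shows "(\<lambda>k. W k (T k) / C k) \<longlonglongrightarrow> 1"
    and "(\<lambda>k. T k ^ n * C k powr (q k + 1) / (real n * B k)) \<longlonglongrightarrow> 1"
proof -
  define G where "G = (\<lambda>k. B k * C k powr (q k * \<alpha> - 1))"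
  have G: "G \<longlonglongrightarrow> 0" using G_lim by (simp add: G_def)
  define T0 where "T0 = (\<lambda>k. (n * B k / C k powr (q k + 1)) powr (1 / n))"
  define \<theta> where "\<theta> = (\<lambda>k. R k / T0 k)"
  \<comment> \<open>\<open>T0\<close> is the critical point predicted by \<open>W = C\<close>; the plateau is reached on the scale \<open>t\<close>, which
    lies well above \<open>R\<close> and well below \<open>T0\<close>.\<close>
  define t where "t = (\<lambda>k. sqrt (R k * T0 k))"
  \<comment> \<open>The relative deficit in \<open>W_ge\<close> at radius t.\<close>
  define \<tau> where "\<tau> = (\<lambda>k. (R k / t k) ^ (n - 2) + C k powr q k * (t k)\<^sup>2 / 2)"
  have n: "real n > 0" "n > 0" "n - 2 > 0" using n3 by auto
  have q_pos: "q k > 0" and q_less: "q k * \<alpha> < 2" and R_pos: "R k > 0" and R_less_T: "R k < T k" for k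
    using rise[of k] by (auto simp: rise_def radial_solution_def radial_solution_axioms_def rise_axioms_def)
  have B_pos: "B k > 0" and C_pos: "C k > 0" and BC: "B k = 2 * \<alpha> * C k * R k ^ (n - 2)" for k
  proof -
    interpret S: rise n "q k" "W k" "W' k" "R k" "T k" by (rule rise)
    show "B k > 0" "C k > 0" "B k = 2 * \<alpha> * C k * R k ^ (n - 2)"
      using S.B_pos S.C_pos S.B_C by (auto simp: B_def C_def S.B_def S.C_def)
  qed
  have T0_pos: "T0 k > 0" for k unfolding T0_def using B_pos[of k] C_pos[of k] n by simp
  have T0n: "T0 k ^ n = real n * B k / C k powr (q k + 1)" for k
    unfolding T0_def using B_pos[of k] C_pos[of k] n by (simp add: powr_realpow[symmetric] powr_powr)
  have G_pos: "G k > 0" for k unfolding G_def using B_pos[of k] C_pos[of k] by simp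
  have t_pos: "t k > 0" for k using R_pos[of k] T0_pos[of k] by (simp add: t_def)
  have RC: "(R k)\<^sup>2 * C k powr q k = (G k / (2 * \<alpha>)) powr (1 / \<alpha>)" for k
  proof -
    have "C k powr (q k * \<alpha>) = C k * C k powr (q k * \<alpha> - 1)"
      using C_pos[of k] by (simp add: powr_diff)
    then have "G k / (2 * \<alpha>) = R k ^ (n - 2) * C k powr (q k * \<alpha>)"
      unfolding G_def BC using alpha_pos by simp
    also have "\<dots> = ((R k)\<^sup>2 * C k powr q k) powr \<alpha>"
    proof -
      have "R k ^ (n - 2) = (R k powr 2) powr \<alpha>"
        using R_pos[of k] powr_powr[of "R k" 2 \<alpha>] by (simp only: powr_real_nat n_minus)
      then show ?thesis using C_pos[of k] R_pos[of k] by (simp add: powr_mult powr_powr)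
    qed
    finally show ?thesis using C_pos[of k] R_pos[of k] alpha_pos by (simp add: powr_powr)
  qed
  have T0C: "(T0 k)\<^sup>2 * C k powr q k = (real n * G k) powr (2 / n)" for k
  proof -
    have e: "2 / real n = 1 / (\<alpha> + 1)" using alpha_pos by (simp add: n_alpha field_simps)
    have "q k * (\<alpha> + 1) = (q k + 1) + (q k * \<alpha> - 1)" by (simp add: algebra_simps)
    then have "C k powr (q k * (\<alpha> + 1)) = C k powr (q k + 1) * C k powr (q k * \<alpha> - 1)"
      by (simp only: powr_add)
    then have "real n * G k = T0 k ^ n * C k powr (q k * (\<alpha> + 1))"
      unfolding T0n G_def using C_pos[of k] by simp
    also have "\<dots> = ((T0 k)\<^sup>2 * C k powr q k) powr (\<alpha> + 1)"
    proof -
      have "T0 k ^ n = (T0 k powr 2) powr (\<alpha> + 1)"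
        using T0_pos[of k] powr_powr[of "T0 k" 2 "\<alpha> + 1"] by (simp only: powr_real_nat n_alpha) (simp add: algebra_simps)
      then show ?thesis using C_pos[of k] T0_pos[of k] by (simp add: powr_mult powr_powr)
    qed
    finally show ?thesis using C_pos[of k] T0_pos[of k] alpha_pos unfolding e by (simp add: powr_powr)
  qed
  have RC_lim: "(\<lambda>k. (R k)\<^sup>2 * C k powr q k) \<longlonglongrightarrow> 0"
    unfolding RC using alpha_pos G_pos
    by (intro tendsto_zero_powrI[OF tendsto_divide_zero[OF G] tendsto_const]) (auto intro!: always_eventually simp: less_imp_le)
  have T0C_lim: "(\<lambda>k. (T0 k)\<^sup>2 * C k powr q k) \<longlonglongrightarrow> 0"
    unfolding T0C using G_pos n
    by (intro tendsto_zero_powrI[OF tendsto_mult_right_zero[OF G] tendsto_const]) (auto intro!: always_eventually simp: less_imp_le)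
  have \<theta>_eq: "\<theta> k = ((R k)\<^sup>2 * C k powr q k / (2 * \<alpha> * n)) powr (1 / n)" for k
  proof -
    have "\<theta> k ^ n = R k ^ n * (C k powr q k * C k) / (real n * B k)"
      using C_pos[of k] by (simp add: \<theta>_def power_divide T0n powr_add)
    also have "\<dots> = (R k)\<^sup>2 * C k powr q k / (2 * \<alpha> * n)"
      unfolding BC power_n(1)[of "R k"] power_n(2)[of "R k"] using C_pos[of k] R_pos[of k] alpha_pos n
      by (simp add: field_simps power2_eq_square)
    finally have "((R k)\<^sup>2 * C k powr q k / (2 * \<alpha> * n)) powr (1 / n) = (\<theta> k ^ n) powr (1 / n)" by simp
    also have "\<dots> = (\<theta> k powr real n) powr (1 / n)"
      using R_pos[of k] T0_pos[of k] by (simp only: powr_real_nat \<theta>_def divide_pos_pos)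
    also have "\<dots> = \<theta> k"
      using R_pos[of k] T0_pos[of k] n by (simp add: powr_powr \<theta>_def)
    finally show ?thesis ..
  qed
  have \<theta>_lim: "\<theta> \<longlonglongrightarrow> 0"
  proof -
    have "(\<lambda>k. ((R k)\<^sup>2 * C k powr q k / (2 * \<alpha> * n)) powr (1 / n)) \<longlonglongrightarrow> 0"
      using n alpha_pos
      by (intro tendsto_zero_powrI[OF tendsto_divide_zero[OF RC_lim] tendsto_const]) auto
    moreover have "\<theta> = (\<lambda>k. ((R k)\<^sup>2 * C k powr q k / (2 * \<alpha> * n)) powr (1 / n))"
      by (rule ext) (rule \<theta>_eq)
    ultimately show ?thesis by simp
  qed
  have Rt: "R k / t k = sqrt (\<theta> k)" "t k / T0 k = sqrt (\<theta> k)" "(t k)\<^sup>2 = \<theta> k * (T0 k)\<^sup>2" for k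
  proof -
    have t2: "(t k)\<^sup>2 = R k * T0 k" using R_pos[of k] T0_pos[of k] by (simp add: t_def)
    have "(R k / t k)\<^sup>2 = \<theta> k" "(t k / T0 k)\<^sup>2 = \<theta> k"
      unfolding power_divide t2 \<theta>_def using R_pos[of k] T0_pos[of k] by (auto simp: power2_eq_square)
    then show "R k / t k = sqrt (\<theta> k)" "t k / T0 k = sqrt (\<theta> k)"
      using R_pos[of k] T0_pos[of k] t_pos[of k] by (metis divide_pos_pos less_imp_le real_sqrt_unique)+
    show "(t k)\<^sup>2 = \<theta> k * (T0 k)\<^sup>2"
      unfolding t2 \<theta>_def using T0_pos[of k] by (simp add: power2_eq_square)
  qed
  have sq_lim: "(\<lambda>k. sqrt (\<theta> k)) \<longlonglongrightarrow> 0"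
    using tendsto_real_sqrt[OF \<theta>_lim] by simp
  have "\<tau> \<longlonglongrightarrow> 0 ^ (n - 2) + 0 * 0 / 2"
    unfolding \<tau>_def Rt
    using tendsto_add[OF tendsto_power[OF sq_lim, of "n - 2"]
        tendsto_divide[OF tendsto_mult[OF \<theta>_lim T0C_lim] tendsto_const[of 2]]]
    by (simp add: mult_ac)
  then have \<tau>_lim: "\<tau> \<longlonglongrightarrow> 0" using n by (simp add: power_0_left)
  have \<theta>_small: "\<forall>\<^sub>F k in sequentially. \<theta> k < 1" using order_tendstoD(2)[OF \<theta>_lim] by auto
  have \<tau>_small: "\<forall>\<^sub>F k in sequentially. \<tau> k < 1" using order_tendstoD(2)[OF \<tau>_lim] by auto
  \<comment> \<open>This is (T / T0)^n. By \<open>B_le\<close> it is at least 1; by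
    \<open>B_ge\<close> at t, where W has almost reached the plateau, it exceeds 1 by
    little.\<close>
  define \<Theta> where "\<Theta> = (\<lambda>k. T k ^ n * C k powr (q k + 1) / (real n * B k))"
  have \<Theta>: "\<Theta> k = (T k / T0 k) ^ n" for k
    by (simp add: \<Theta>_def power_divide T0n)
  have \<Theta>_ge: "1 \<le> \<Theta> k" for k
  proof -
    interpret S: rise n "q k" "W k" "W' k" "R k" "T k" by (rule rise)
    have "real n * B k \<le> T k ^ n * C k powr (q k + 1)"
      using S.B_le by (simp add: B_def C_def S.B_def S.C_def mult.commute)
    then show ?thesis using B_pos[of k] n by (simp add: \<Theta>_def)
  qed
  have T0_le: "T0 k \<le> T k" for k
  proof -
    have "T0 k ^ n \<le> T k ^ n" using \<Theta>_ge[of k] T0_pos[of k] by (simp add: \<Theta> power_divide)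
    then show ?thesis using R_pos[of k] R_less_T[of k] n
      by (meson less_imp_le less_trans power_mono_iff T0_pos)
  qed
  have main: "\<forall>\<^sub>F k in sequentially. R k < t k \<and> t k \<le> T k \<and> C k * (1 - \<tau> k) \<le> W k (t k)
      \<and> W k (t k) \<le> W k (T k) \<and> W k (T k) \<le> C k \<and> W k (t k) powr (q k + 1) * (T k ^ n - t k ^ n) \<le> real n * B k"
    using \<theta>_small
  proof eventually_elim
    case (elim k)
    interpret S: rise n "q k" "W k" "W' k" "R k" "T k" by (rule rise)
    have "sqrt (\<theta> k) < 1" using elim by simp
    then have "R k / t k < 1" "t k / T0 k < 1" by (simp_all only: Rt)
    then have 1: "R k < t k" "t k < T0 k"
      using t_pos[of k] T0_pos[of k] by (auto simp: divide_less_eq_1)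
    then have 2: "t k \<le> T k" using T0_le[of k] by simp
    have CB: "S.C = C k" "S.B = B k" by (auto simp: B_def C_def S.B_def S.C_def)
    show ?case
      using 1 2 S.W_ge[of "t k"] S.W_mono[of "t k" "T k"] S.W_le[of "T k"] S.B_ge[of "t k"] R_less_T[of k]
      unfolding CB \<tau>_def by auto
  qed
  show "(\<lambda>k. W k (T k) / C k) \<longlonglongrightarrow> 1"
  proof (rule tendsto_sandwich[of "\<lambda>k. 1 - \<tau> k" _ _ "\<lambda>_. 1"])
    show "\<forall>\<^sub>F k in sequentially. 1 - \<tau> k \<le> W k (T k) / C k"
      using main by eventually_elim (use C_pos in \<open>auto simp: le_divide_eq mult.commute\<close>)
    show "\<forall>\<^sub>F k in sequentially. W k (T k) / C k \<le> 1"
      using main by eventually_elim (use C_pos in \<open>auto simp: divide_le_eq\<close>)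
    show "(\<lambda>k. 1 - \<tau> k) \<longlonglongrightarrow> 1" using tendsto_diff[OF tendsto_const[of 1] \<tau>_lim] by simp
  qed simp
  have "\<Theta> \<longlonglongrightarrow> 1"
  proof (rule tendsto_sandwich[of "\<lambda>_. 1" _ _ "\<lambda>k. (1 - \<tau> k) powr (- (q k + 1)) + sqrt (\<theta> k) ^ n"])
    have "(\<lambda>k. (1 - \<tau> k) powr (- (q k + 1)) + sqrt (\<theta> k) ^ n) \<longlonglongrightarrow> (1 - 0) powr (- (2 / \<alpha> + 1)) + 0 ^ n"
      by (intro tendsto_intros \<tau>_lim q_lim sq_lim) auto
    then show "(\<lambda>k. (1 - \<tau> k) powr (- (q k + 1)) + sqrt (\<theta> k) ^ n) \<longlonglongrightarrow> 1"
      using n by (simp add: power_0_left)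
    show "\<forall>\<^sub>F k in sequentially. \<Theta> k \<le> (1 - \<tau> k) powr (- (q k + 1)) + sqrt (\<theta> k) ^ n"
      using main \<tau>_small
    proof eventually_elim
      case (elim k)
      have "(C k * (1 - \<tau> k)) powr (q k + 1) * (T k ^ n - t k ^ n) \<le> W k (t k) powr (q k + 1) * (T k ^ n - t k ^ n)"
        using elim C_pos[of k] q_pos[of k] t_pos[of k]
        by (intro mult_right_mono powr_mono2) (auto intro: power_mono)
      also have "\<dots> \<le> real n * B k" using elim by auto
      also have "\<dots> = C k powr (q k + 1) * T0 k ^ n" using C_pos[of k] by (simp add: T0n)
      finally have "C k powr (q k + 1) * ((1 - \<tau> k) powr (q k + 1) * (T k ^ n - t k ^ n)) \<le> C k powr (q k + 1) * T0 k ^ n"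
        using C_pos[of k] elim by (simp add: powr_mult mult_ac)
      then have "(1 - \<tau> k) powr (q k + 1) * (T k ^ n - t k ^ n) \<le> T0 k ^ n"
        using C_pos[of k] by simp
      moreover have "0 < (1 - \<tau> k) powr (q k + 1)" "0 < T0 k ^ n" using T0_pos[of k] elim(2) by auto
      ultimately have "(T k ^ n - t k ^ n) / T0 k ^ n \<le> 1 / (1 - \<tau> k) powr (q k + 1)"
        by (simp only: pos_divide_le_eq pos_le_divide_eq mult.commute times_divide_eq_right mult_1_right)
      then have "(T k ^ n - t k ^ n) / T0 k ^ n \<le> (1 - \<tau> k) powr (- (q k + 1))"
        by (simp only: powr_minus_divide)
      moreover have "t k ^ n / T0 k ^ n = sqrt (\<theta> k) ^ n" using Rt(2)[of k] by (metis power_divide)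
      ultimately show ?case by (simp add: \<Theta> power_divide diff_divide_distrib)
    qed
  qed (use \<Theta>_ge in auto)
  then show "(\<lambda>k. T k ^ n * C k powr (q k + 1) / (real n * B k)) \<longlonglongrightarrow> 1" by (simp add: \<Theta>_def)
qed

text \<open>Transfers the asymptotics to pieces of either sign: reflection by the sign at T, that is
  scaling with M = 1, preserves \<open>pohozaev\<close> and the absolute values.\<close>

lemma rising_lim:
  fixes q :: "nat \<Rightarrow> real" and W W' :: "nat \<Rightarrow> real \<Rightarrow> real" and R T :: "nat \<Rightarrow> real"
  defines "B \<equiv> \<lambda>k. R k ^ (n - 1) * \<bar>W' k (R k)\<bar>" and "C \<equiv> \<lambda>k. R k * \<bar>W' k (R k)\<bar> / (2 * \<alpha>)"
  assumes sol: "\<And>k. radial_solution n (q k) (W k) (W' k)" and q: "\<And>k. q k * \<alpha> < 2" "q \<longlonglongrightarrow> 2 / \<alpha>"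
    and RT: "\<And>k. 0 < R k" "\<And>k. R k < T k" "\<And>k. W k (R k) = 0" "\<And>k. W' k (T k) = 0"
      "\<And>k t. R k < t \<Longrightarrow> t \<le> T k \<Longrightarrow> W k t \<noteq> 0"
    and G_lim: "(\<lambda>k. B k * C k powr (q k * \<alpha> - 1)) \<longlonglongrightarrow> 0"
  shows "(\<lambda>k. \<bar>W k (T k)\<bar> / C k) \<longlonglongrightarrow> 1"
    and "(\<lambda>k. T k ^ n * C k powr (q k + 1) / (real n * B k)) \<longlonglongrightarrow> 1"
    and "\<And>k. 0 < B k" "\<And>k. 0 < C k"
    and "\<And>k. 0 \<le> (radial_solution.pohozaev n (q k) (W k) (W' k) (T k) - radial_solution.pohozaev n (q k) (W k) (W' k) (R k))
      / radial_solution.\<delta> n (q k)"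
    and "\<And>k. (radial_solution.pohozaev n (q k) (W k) (W' k) (T k) - radial_solution.pohozaev n (q k) (W k) (W' k) (R k))
      / radial_solution.\<delta> n (q k) \<le> C k * B k"
proof -
  have WT: "W k (T k) \<noteq> 0" for k using RT(2,5)[of k] by auto
  then have \<sigma>: "\<bar>sgn (W k (T k))\<bar> = 1" for k by (simp add: abs_sgn_eq)
  define V V' where "V = (\<lambda>k. radial_solution.scaled (q k) (W k) (sgn (W k (T k))) 1)"
    and "V' = (\<lambda>k. radial_solution.scaled' (q k) (W' k) (sgn (W k (T k))) 1)"
  have V: "rise n (q k) (V k) (V' k) (R k) (T k)" for k
    unfolding V_def V'_def by (rule radial_solution.scaled_rise[OF sol q(1) RT])
  have V'R: "V' k (R k) = \<bar>W' k (R k)\<bar>" for k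
  proof -
    interpret S: rise n "q k" "V k" "V' k" "R k" "T k" by (rule V)
    have "V' k (R k) = \<bar>V' k (R k)\<bar>" using S.W'_nonneg[of "R k"] S.R_less_T by simp
    also have "\<dots> = \<bar>W' k (R k)\<bar>"
      using \<sigma>[of k] by (simp add: V'_def radial_solution.scaled'_def[OF sol] abs_mult)
    finally show ?thesis .
  qed
  have VT: "V k (T k) = \<bar>W k (T k)\<bar>" for k
    by (simp add: V_def radial_solution.scaled_def[OF sol] abs_sgn mult.commute)
  have P: "radial_solution.pohozaev n (q k) (V k) (V' k) t = radial_solution.pohozaev n (q k) (W k) (W' k) t" for k t
    using radial_solution.scaled_pohozaev[OF sol zero_less_one \<sigma>[of k], of k t] by (simp add: V_def V'_def)
  have G: "(\<lambda>k. R k ^ (n - 1) * V' k (R k) * (R k * V' k (R k) / (2 * \<alpha>)) powr (q k * \<alpha> - 1)) \<longlonglongrightarrow> 0"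
    using G_lim by (simp add: V'R B_def C_def)
  show "(\<lambda>k. \<bar>W k (T k)\<bar> / C k) \<longlonglongrightarrow> 1"
    using rising_asymptotics(1)[OF V q(2) G] by (simp add: V'R VT C_def)
  show "(\<lambda>k. T k ^ n * C k powr (q k + 1) / (real n * B k)) \<longlonglongrightarrow> 1"
    using rising_asymptotics(2)[OF V q(2) G] by (simp add: V'R B_def C_def)
  fix k
  interpret S: rise n "q k" "V k" "V' k" "R k" "T k" by (rule V)
  have CB: "S.C = C k" "S.B = B k" by (auto simp: B_def C_def S.B_def S.C_def V'R)
  show "0 < B k" "0 < C k" using S.B_pos S.C_pos by (auto simp: CB)
  show "0 \<le> (radial_solution.pohozaev n (q k) (W k) (W' k) (T k) - radial_solution.pohozaev n (q k) (W k) (W' k) (R k))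
      / radial_solution.\<delta> n (q k)"
    and "(radial_solution.pohozaev n (q k) (W k) (W' k) (T k) - radial_solution.pohozaev n (q k) (W k) (W' k) (R k))
      / radial_solution.\<delta> n (q k) \<le> C k * B k"
    using S.pohozaev_bounds unfolding CB P by auto
qed

end

section \<open>Recursion over the nodal regions\<close>

text \<open>Taking logarithms turns identities between products of real powers into linear
  arithmetic of exponents.\<close>

lemma ln_eqI: "0 < a \<Longrightarrow> 0 < b \<Longrightarrow> ln a = ln b \<Longrightarrow> a = b" for a b :: real
  by simp

lemma root_power_mult_powr:
  fixes a y :: real
  assumes "0 < a" "0 < y" "0 < N"
  shows "(a ^ N * y powr j) powr (1 / real N) = a * y powr (j / real N)"
proof -
  have "(a ^ N * y powr j) powr (1 / real N) = (a powr real N) powr (1 / real N) * (y powr j) powr (1 / real N)"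
    using assms by (simp only: powr_mult powr_realpow)
  also have "\<dots> = a * y powr (j / real N)"
    using assms unfolding powr_powr by simp
  finally show ?thesis .
qed

text \<open>A quantity of exact order e^j has logarithm of order ln e, and e ln e tends to 0. This
  disposes of every factor caused by q differing from its limit.\<close>

lemma powr_vanishing_exponent:
  fixes e g :: "nat \<Rightarrow> real"
  assumes e: "e \<longlonglongrightarrow> 0" "\<And>k. 0 < e k" and \<kappa>: "0 < \<kappa>"
    and g: "\<And>k. 0 < g k" "(\<lambda>k. g k * (\<kappa> * e k) powr (- j)) \<longlonglongrightarrow> L" "0 < L"
  shows "(\<lambda>k. g k powr (b * e k)) \<longlonglongrightarrow> 1"
proof -
  define x where "x = (\<lambda>k. \<kappa> * e k)"
  have x: "0 < x k" for k using e(2)[of k] \<kappa> by (simp add: x_def)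
  have x_lim: "x \<longlonglongrightarrow> 0" unfolding x_def by (rule tendsto_mult_right_zero[OF e(1)])
  have sq: "(\<lambda>k. 2 * sqrt (x k)) \<longlonglongrightarrow> 0"
    using tendsto_mult_right_zero[OF tendsto_real_sqrt[OF x_lim, simplified]] .
  \<comment> \<open>With y = sqrt x, the inequality - ln y \<le> 1 / y gives |x ln x| \<le> 2 sqrt
    x.\<close>
  have "(\<lambda>k. x k * ln (x k)) \<longlonglongrightarrow> 0"
  proof (rule Lim_null_comparison[OF _ sq])
    have "\<forall>\<^sub>F k in sequentially. x k < 1" using order_tendstoD(2)[OF x_lim] by auto
    then show "\<forall>\<^sub>F k in sequentially. norm (x k * ln (x k)) \<le> 2 * sqrt (x k)"
    proof eventually_elim
      case (elim k)
      define y where "y = sqrt (x k)"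
      have y: "y > 0" "x k = y * y" using x[of k] by (auto simp: y_def)
      have "ln (1 / y) \<le> 1 / y - 1" using y by (intro ln_le_minus_one) auto
      then have "- ln y \<le> 1 / y" using y by (simp add: ln_div)
      then have "y * y * (- ln y) \<le> y" using y mult_left_mono[of "- ln y" "1 / y" "y * y"] by simp
      then have "- (x k * (2 * ln y)) \<le> 2 * y" unfolding y(2) by simp
      moreover have "ln (x k) = 2 * ln y" using y by (simp add: ln_mult)
      moreover have "x k * ln (x k) \<le> 0"
        using elim x[of k] by (intro mult_nonneg_nonpos) auto
      ultimately have "\<bar>x k * ln (x k)\<bar> \<le> 2 * y" by (simp only: abs_of_nonpos)
      then show ?case by (simp only: y_def real_norm_def)
    qed
  qed
  then have "(\<lambda>k. x k * ln (x k) / \<kappa>) \<longlonglongrightarrow> 0" by (rule tendsto_divide_zero)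
  then have xl: "(\<lambda>k. e k * ln (x k)) \<longlonglongrightarrow> 0" using \<kappa> by (simp add: x_def)
  have "(\<lambda>k. ln (g k * x k powr (- j))) \<longlonglongrightarrow> ln L"
    unfolding x_def using g by (intro tendsto_ln) auto
  from tendsto_mult[OF e(1) this] have "(\<lambda>k. e k * ln (g k * x k powr (- j))) \<longlonglongrightarrow> 0" by simp
  from tendsto_add[OF this tendsto_mult_right_zero[OF xl, of j]]
  have "(\<lambda>k. e k * ln (g k * x k powr (- j)) + j * (e k * ln (x k))) \<longlonglongrightarrow> 0" by simp
  also have "(\<lambda>k. e k * ln (g k * x k powr (- j)) + j * (e k * ln (x k))) = (\<lambda>k. e k * ln (g k))"
  proof
    fix k
    have eq: "ln (g k * x k powr (- j)) = ln (g k) - j * ln (x k)"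
      using g(1)[of k] x[of k] by (simp add: ln_mult ln_powr)
    show "e k * ln (g k * x k powr (- j)) + j * (e k * ln (x k)) = e k * ln (g k)"
      unfolding eq by (simp add: algebra_simps)
  qed
  finally have "(\<lambda>k. exp (b * (e k * ln (g k)))) \<longlonglongrightarrow> exp (b * 0)" by (intro tendsto_intros)
  moreover have "exp (b * (e k * ln (g k))) = g k powr (b * e k)" for k
    using g(1)[of k] by (simp add: powr_def mult_ac)
  ultimately show ?thesis by simp
qed

text \<open>The solutions along one sequence of parameters tending to 0, with indices starting at 1.
  Completeness of the list of zeros appears as nonvanishing between neighbouring zeros.\<close>

locale nodal_sequence = dimension +
  fixes e :: "nat \<Rightarrow> real" and W W' :: "nat \<Rightarrow> real \<Rightarrow> real" and r s :: "nat \<Rightarrow> nat \<Rightarrow> real"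
  assumes e_pos: "\<And>k. 0 < e k" and e_lim: "e \<longlonglongrightarrow> 0"
    and sol: "\<And>k. radial_solution n (2 / \<alpha> - e k) (W k) (W' k)"
    and W_0: "\<And>k. W k 0 = 1" and s_1: "\<And>k. s k 1 = 0"
    and W_r: "\<And>k m. 1 \<le> m \<Longrightarrow> W k (r k m) = 0" and W'_s: "\<And>k m. 1 \<le> m \<Longrightarrow> W' k (s k m) = 0"
    and s_less_r: "\<And>k m. 1 \<le> m \<Longrightarrow> s k m < r k m"
    and r_less_s: "\<And>k m. 1 \<le> m \<Longrightarrow> r k m < s k (m + 1)"
    and W_nz_first: "\<And>k t. 0 \<le> t \<Longrightarrow> t < r k 1 \<Longrightarrow> W k t \<noteq> 0"
    and W_nz: "\<And>k m t. 1 \<le> m \<Longrightarrow> r k m < t \<Longrightarrow> t < r k (m + 1) \<Longrightarrow> W k t \<noteq> 0"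
begin

definition q :: "nat \<Rightarrow> real" where "q k = 2 / \<alpha> - e k"

definition x :: "nat \<Rightarrow> real" where "x k = kappa n * e k"

definition M :: "nat \<Rightarrow> nat \<Rightarrow> real" where "M m k = \<bar>W k (s k m)\<bar>"

definition B :: "nat \<Rightarrow> nat \<Rightarrow> real" where "B m k = r k m ^ (n - 1) * \<bar>W' k (r k m)\<bar>"

definition C :: "nat \<Rightarrow> nat \<Rightarrow> real" where "C m k = r k m * \<bar>W' k (r k m)\<bar> / (2 * \<alpha>)"

definition P :: "nat \<Rightarrow> real \<Rightarrow> real" where "P k = radial_solution.pohozaev n (q k) (W k) (W' k)"

definition \<delta> :: "nat \<Rightarrow> real" where "\<delta> k = radial_solution.\<delta> n (q k)"

lemma sol_q: "radial_solution n (q k) (W k) (W' k)"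
  unfolding q_def by (rule sol)

lemma q_less: "q k * \<alpha> < 2"
  using e_pos[of k] alpha_pos by (simp add: q_def left_diff_distrib)

lemma q_pos: "q k > 0"
  by (rule radial_solution.q_pos[OF sol_q])

lemma q_lim: "q \<longlonglongrightarrow> 2 / \<alpha>"
  unfolding q_def using tendsto_diff[OF tendsto_const e_lim, of "2 / \<alpha>"] by simp

lemma x_pos: "x k > 0"
  using e_pos kappa_pos by (simp add: x_def)

lemma x_lim: "x \<longlonglongrightarrow> 0"
  unfolding x_def by (rule tendsto_mult_right_zero[OF e_lim])

lemma s_nonneg_r_pos: "1 \<le> m \<Longrightarrow> 0 \<le> s k m \<and> 0 < r k m"
proof (induction m rule: nat_induct_at_least)
  case base
  then show ?case using s_1[of k] s_less_r[of 1 k] by simp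
next
  case (Suc m)
  then show ?case using r_less_s[of m k] s_less_r[of "m + 1" k] unfolding Suc_eq_plus1 by simp
qed

lemma W_nz_falling: "1 \<le> m \<Longrightarrow> s k m \<le> t \<Longrightarrow> t < r k m \<Longrightarrow> W k t \<noteq> 0"
proof (cases "m = 1")
  case False
  assume m: "1 \<le> m" "s k m \<le> t" "t < r k m"
  then obtain j where j: "m = j + 1" "1 \<le> j" using False by (intro that[of "m - 1"]) auto
  then show ?thesis using W_nz[of j k t] r_less_s[of j k] m by simp
qed (use W_nz_first s_1 in simp)

lemma M_pos: "1 \<le> m \<Longrightarrow> M m k > 0"
  using W_nz_falling[of m k "s k m"] s_less_r[of m k] by (simp add: M_def)

lemma powr_e_lim:
  assumes "\<And>k. 0 < g k" "(\<lambda>k. g k * x k powr (- j)) \<longlonglongrightarrow> L" "0 < L"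
  shows "(\<lambda>k. g k powr (b * e k)) \<longlonglongrightarrow> 1"
  using powr_vanishing_exponent[OF e_lim e_pos kappa_pos assms(1), where j = j and L = L and b = b] assms(2,3)
  by (simp add: x_def)

text \<open>Exactly \<delta> = \<alpha> e / (q + 2), and q + 2 tends to n / \<alpha>.\<close>

lemma \<delta>_lim: "(\<lambda>k. \<delta> k / x k) \<longlonglongrightarrow> \<alpha>\<^sup>2 / (kappa n * n)"
proof -
  have "\<delta> k / x k = \<alpha> / (kappa n * (q k + 2))" for k
  proof -
    have "\<delta> k = \<alpha> * e k / (q k + 2)"
      unfolding \<delta>_def radial_solution.\<delta>_def[OF sol_q] using q_pos[of k] alpha_pos
      by (simp add: n_alpha q_def field_simps)
    then show ?thesis using e_pos[of k] by (simp add: x_def)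
  qed
  moreover have "(\<lambda>k. \<alpha> / (kappa n * (q k + 2))) \<longlonglongrightarrow> \<alpha> / (kappa n * (2 / \<alpha> + 2))"
    using kappa_pos alpha_pos by (intro tendsto_intros q_lim) (auto simp: add_pos_pos less_imp_neq[symmetric])
  moreover have "\<alpha> / (kappa n * (2 / \<alpha> + 2)) = \<alpha>\<^sup>2 / (kappa n * n)"
  proof -
    have "2 / \<alpha> + 2 = n / \<alpha>" using alpha_pos by (simp add: n_alpha field_simps)
    then show ?thesis by (simp add: power2_eq_square)
  qed
  ultimately show ?thesis by simp
qed

lemma S_delta: "S * (\<alpha>\<^sup>2 / (kappa n * n)) = \<alpha> * A"
  using kappa_pos alpha_pos n3 by (simp add: S_kappa power2_eq_square)

text \<open>The order of the height makes the scaling defect disappear, and the second limit closes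
  the hole; together they give the hypotheses of \<open>falling_lim\<close>. The third limit counts
  the m - 1 earlier regions, each worth \<open>\<alpha> * A * x\<close>.\<close>

definition invariant :: "nat \<Rightarrow> bool" where
  "invariant m \<longleftrightarrow> (\<lambda>k. M m k * x k powr (1 - real m)) \<longlonglongrightarrow> Gamma (real m)
     \<and> (\<lambda>k. s k m * M m k powr (q k / 2)) \<longlonglongrightarrow> 0
     \<and> (\<lambda>k. P k (s k m) / x k) \<longlonglongrightarrow> (real m - 1) * (\<alpha> * A)"

lemma invariant_1: "invariant 1"
proof -
  have "P k 0 = 0" for k
    unfolding P_def radial_solution.pohozaev_def[OF sol_q] power_n by simp
  moreover have "M 1 k = 1" for k by (simp add: M_def s_1 W_0)
  ultimately show ?thesis using x_pos by (simp add: invariant_def s_1 less_imp_neq[symmetric])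
qed

section \<open>One step of the recursion\<close>

context
  fixes m :: nat
  assumes m: "1 \<le> m" and inv: "invariant m"
begin

lemma M_lim: "(\<lambda>k. M m k * x k powr (1 - real m)) \<longlonglongrightarrow> Gamma (real m)"
  using inv by (simp add: invariant_def)

lemma Gamma_m_pos: "Gamma (real m) > 0"
  using m by (intro Gamma_real_pos) auto

lemma Gamma_m_nz: "Gamma (real m) \<noteq> 0"
  using Gamma_m_pos by linarith

lemma r_pos: "0 < r k m"
  using s_nonneg_r_pos m by blast

lemma M_powr_lim: "(\<lambda>k. M m k powr (q k * \<alpha> - 2)) \<longlonglongrightarrow> 1"
proof -
  have "q k * \<alpha> - 2 = - \<alpha> * e k" for k
    using alpha_pos by (simp add: q_def algebra_simps)
  then show ?thesis
    using powr_e_lim[OF M_pos[OF m], where j = "real m - 1" and L = "Gamma (real m)" and b = "- \<alpha>"] M_lim Gamma_m_pos by simp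
qed

lemma falling_step: "(\<lambda>k. B m k * M m k) \<longlonglongrightarrow> A" "(\<lambda>k. P k (r k m) / x k) \<longlonglongrightarrow> m * (\<alpha> * A)"
proof -
  have s_lim: "(\<lambda>k. s k m * \<bar>W k (s k m)\<bar> powr (q k / 2)) \<longlonglongrightarrow> 0"
    and P_lim: "(\<lambda>k. P k (s k m) / x k) \<longlonglongrightarrow> (real m - 1) * (\<alpha> * A)"
    using inv by (auto simp: invariant_def M_def)
  have s0: "0 \<le> s k m" for k using s_nonneg_r_pos m by blast
  note lims = falling_lim[of q W W' "\<lambda>k. s k m" "\<lambda>k. r k m", OF sol_q q_less q_lim s0 s_less_r[OF m]
      W'_s[OF m] W_r[OF m] W_nz_falling[OF m] s_lim M_powr_lim[unfolded M_def]]
  show "(\<lambda>k. B m k * M m k) \<longlonglongrightarrow> A"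
    using lims(1) by (simp add: B_def M_def mult_ac)
  have "\<delta> k \<noteq> 0" for k
    using radial_solution.delta_pos[OF sol_q q_less, of k] by (simp add: \<delta>_def)
  then have "(P k (r k m) - P k (s k m)) / \<delta> k * (\<delta> k / x k) + P k (s k m) / x k = P k (r k m) / x k" for k
    using x_pos[of k] by (simp add: field_simps)
  moreover have "(\<lambda>k. (P k (r k m) - P k (s k m)) / \<delta> k * (\<delta> k / x k) + P k (s k m) / x k)
    \<longlonglongrightarrow> S * (\<alpha>\<^sup>2 / (kappa n * n)) + (real m - 1) * (\<alpha> * A)"
    using lims(2) unfolding P_def \<delta>_def[symmetric] by (intro tendsto_intros \<delta>_lim P_lim[unfolded P_def])
  moreover have "S * (\<alpha>\<^sup>2 / (kappa n * n)) + (real m - 1) * (\<alpha> * A) = m * (\<alpha> * A)"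
    unfolding S_delta by (simp add: algebra_simps)
  ultimately show "(\<lambda>k. P k (r k m) / x k) \<longlonglongrightarrow> m * (\<alpha> * A)" by simp
qed

lemma P_r: "P k (r k m) = (r k m) ^ n * \<bar>W' k (r k m)\<bar>\<^sup>2 / 2"
  unfolding P_def radial_solution.pohozaev_def[OF sol_q] using W_r[OF m] by simp

text \<open>The following rising piece spends a strictly positive flux, so the slope at its initial
  zero cannot vanish.\<close>

lemma W'_r_pos: "0 < \<bar>W' k (r k m)\<bar>"
proof -
  define V V' where "V = radial_solution.scaled (q k) (W k) (sgn (W k (s k (m + 1)))) 1"
    and "V' = radial_solution.scaled' (q k) (W' k) (sgn (W k (s k (m + 1)))) 1"
  have "rise n (q k) V V' (r k m) (s k (m + 1))"
    unfolding V_def V'_def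
    using m r_pos r_less_s[OF m] W_r[OF m] W'_s[of "m + 1"] W_nz[OF m] s_less_r[of "m + 1" k]
    by (intro radial_solution.scaled_rise[OF sol_q q_less]) auto
  then interpret S: rise n "q k" V V' "r k m" "s k (m + 1)" .
  have "V' (r k m) \<noteq> 0" using S.B_pos by (auto simp: S.B_def)
  then show ?thesis by (auto simp: V'_def radial_solution.scaled'_def[OF sol_q])
qed

lemma B_pos: "0 < B m k" and C_pos: "0 < C m k"
  using W'_r_pos[of k] r_pos[of k] alpha_pos by (auto simp: B_def C_def)

lemma BM_lim: "(\<lambda>k. B m k * x k powr (real m - 1)) \<longlonglongrightarrow> A / Gamma (real m)"
proof -
  have "B m k * M m k / (M m k * x k powr (1 - real m)) = B m k * x k powr (real m - 1)" for k
    using M_pos[OF m, of k] x_pos[of k] by (simp add: powr_diff field_simps)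
  then show ?thesis
    using tendsto_divide[OF falling_step(1) M_lim] Gamma_m_pos by simp
qed

text \<open>At a zero B^2 / (2 P) is r^(n-2), which eliminates the derivative between the flux and
  energy relations.\<close>

lemma r_power_lim: "(\<lambda>k. r k m ^ (n - 2) * x k powr (2 * real m - 1)) \<longlonglongrightarrow> c powr \<alpha> / (m * (Gamma (real m))\<^sup>2)"
proof -
  have "(B m k * x k powr (real m - 1))\<^sup>2 / (2 * (P k (r k m) / x k)) = r k m ^ (n - 2) * x k powr (2 * real m - 1)" for k
  proof -
    have "x k powr (2 * real m - 1) = (x k powr (real m - 1))\<^sup>2 * x k"
    proof -
      have "2 * real m - 1 = (real m - 1) + (real m - 1) + 1" by simp
      then show ?thesis using x_pos[of k] by (simp only: powr_add powr_one power2_eq_square)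
    qed
    then show ?thesis
      unfolding P_r B_def power_n(1)[of "r k m"] power_n(2)[of "r k m"] using r_pos[of k] W'_r_pos[of k] x_pos[of k]
      by (simp add: field_simps power2_eq_square)
  qed
  moreover have "(\<lambda>k. (B m k * x k powr (real m - 1))\<^sup>2 / (2 * (P k (r k m) / x k)))
    \<longlonglongrightarrow> (A / Gamma (real m))\<^sup>2 / (2 * (m * (\<alpha> * A)))"
    using m A_pos alpha_pos by (intro tendsto_intros BM_lim falling_step(2)) auto
  moreover have "(A / Gamma (real m))\<^sup>2 / (2 * (m * (\<alpha> * A))) = c powr \<alpha> / (m * (Gamma (real m))\<^sup>2)"
    using A_pos alpha_pos c_pos by (simp add: A_def power2_eq_square field_simps)
  ultimately show ?thesis by simp
qed

lemma r_lim: "(\<lambda>k. r k m * x k powr ((2 * real m - 1) / (real n - 2))) \<longlonglongrightarrow>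
  c powr (1/2) * real m powr (1 / (2 - real n)) * Gamma (real m) powr (- (2 / (real n - 2)))"
proof -
  have n2: "real n - 2 = 2 * \<alpha>" "2 - real n = - (2 * \<alpha>)" using n_alpha by auto
  have eq: "(r k m ^ (n - 2) * x k powr (2 * real m - 1)) powr (1 / (2 * \<alpha>)) = r k m * x k powr ((2 * real m - 1) / (2 * \<alpha>))" for k
    using root_power_mult_powr[OF r_pos[of k] x_pos[of k], of "n - 2" "2 * real m - 1"] n3
    unfolding n_minus by simp
  have mp: "real m > 0" using m by simp
  have lim: "(c powr \<alpha> / (m * (Gamma (real m))\<^sup>2)) powr (1 / (2 * \<alpha>)) =
    c powr (1/2) * real m powr (1 / (- (2 * \<alpha>))) * Gamma (real m) powr (- (2 / (2 * \<alpha>)))"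
  proof (rule ln_eqI)
    have "ln ((c powr \<alpha> / (m * (Gamma (real m))\<^sup>2)) powr (1 / (2 * \<alpha>)))
      = 1 / (2 * \<alpha>) * (\<alpha> * ln c - (ln (real m) + 2 * ln (Gamma (real m))))"
      using mp c_pos Gamma_m_pos Gamma_m_nz by (simp add: ln_powr ln_mult ln_div ln_realpow)
    also have "\<dots> = 1 / 2 * ln c + 1 / (- (2 * \<alpha>)) * ln (real m) + - (2 / (2 * \<alpha>)) * ln (Gamma (real m))"
      using alpha_pos by (simp add: field_simps)
    also have "\<dots> = ln (c powr (1/2) * real m powr (1 / (- (2 * \<alpha>))) * Gamma (real m) powr (- (2 / (2 * \<alpha>))))"
      using mp c_pos Gamma_m_pos Gamma_m_nz by (simp add: ln_powr ln_mult)
    finally show "ln ((c powr \<alpha> / (m * (Gamma (real m))\<^sup>2)) powr (1 / (2 * \<alpha>))) = \<dots>" .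
  qed (use mp c_pos Gamma_m_pos Gamma_m_nz in auto)
  have "(\<lambda>k. (r k m ^ (n - 2) * x k powr (2 * real m - 1)) powr (1 / (2 * \<alpha>)))
    \<longlonglongrightarrow> (c powr \<alpha> / (m * (Gamma (real m))\<^sup>2)) powr (1 / (2 * \<alpha>))"
    using mp c_pos Gamma_m_pos Gamma_m_nz by (intro tendsto_powr r_power_lim tendsto_const) auto
  then show ?thesis unfolding eq lim n2 .
qed

lemma W'_r_lim: "(\<lambda>k. \<bar>W' k (r k m)\<bar> * x k powr ((1 - real m * real n) / (real n - 2))) \<longlonglongrightarrow>
  ((real n - 2) / real n) powr (1/2) * real m powr ((real n - 1) / (real n - 2)) * Gamma (real m) powr (real n / (real n - 2))"
proof -
  have mp: "real m > 0" "real n > 0" "real n - 2 > 0" "2 - real n < 0" using m n3 by auto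
  define Y where "Y = (\<lambda>k. r k m * x k powr ((2 * real m - 1) / (real n - 2)))"
  define Y0 where "Y0 = c powr (1/2) * real m powr (1 / (2 - real n)) * Gamma (real m) powr (- (2 / (real n - 2)))"
  have Y0: "Y0 > 0" using c_pos mp Gamma_m_pos Gamma_m_nz by (simp add: Y0_def)
  \<comment> \<open>The slope is B r^(1-n), so its limit follows from those of \<open>B\<close> and
    of the normalised radius \<open>Y\<close>.\<close>
  have eq: "B m k * x k powr (real m - 1) * Y k powr (1 - real n) = \<bar>W' k (r k m)\<bar> * x k powr ((1 - real m * real n) / (real n - 2))" for k
    unfolding Y_def B_def
  proof (rule ln_eqI)
    have 1: "real (n - 1) = real n - 1" using n3 by auto
    show "ln (r k m ^ (n - 1) * \<bar>W' k (r k m)\<bar> * x k powr (real m - 1) * (r k m * x k powr ((2 * real m - 1) / (real n - 2))) powr (1 - real n))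
      = ln (\<bar>W' k (r k m)\<bar> * x k powr ((1 - real m * real n) / (real n - 2)))"
      using r_pos[of k] W'_r_pos[of k] x_pos[of k] mp
      by (simp add: ln_powr ln_mult ln_realpow 1) (simp add: field_simps)
  qed (use r_pos[of k] W'_r_pos[of k] x_pos[of k] in auto)
  have lim: "A / Gamma (real m) * Y0 powr (1 - real n) =
    ((real n - 2) / real n) powr (1/2) * real m powr ((real n - 1) / (real n - 2)) * Gamma (real m) powr (real n / (real n - 2))"
  proof (rule ln_eqI)
    have A: "ln A = ln (real n - 2) + (real n / 2 - 1) * ln c"
    proof -
      have "2 * \<alpha> = real n - 2" "\<alpha> = real n / 2 - 1" by (auto simp: n_alpha add_divide_distrib)
      then show ?thesis unfolding A_def using mp c_pos by (simp add: ln_mult ln_powr)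
    qed
    have c: "ln c = ln (real n) + ln (real n - 2)"
      using mp by (simp add: c_def n_alpha ln_mult)
    have "ln (A / Gamma (real m) * Y0 powr (1 - real n)) = ln A - ln (Gamma (real m)) +
      (1 - real n) * (ln c / 2 + ln (real m) / (2 - real n) - 2 / (real n - 2) * ln (Gamma (real m)))"
      unfolding Y0_def using A_pos c_pos mp Gamma_m_pos Gamma_m_nz by (simp add: ln_powr ln_mult ln_div)
    also have "\<dots> = (ln (real n - 2) - ln (real n)) / 2 + (real n - 1) / (real n - 2) * ln (real m) + real n / (real n - 2) * ln (Gamma (real m))"
    proof -
      \<comment> \<open>With d as an atom, the two sides differ by a multiple of
        \<open>real n * d - 1 - 2 * d\<close>, which is zero.\<close>
      define d where "d = 1 / (real n - 2)"
      have d: "z / (real n - 2) = z * d" "z / (2 - real n) = - (z * d)" for z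
        using mp by (auto simp: d_def field_simps)
      have nd: "real n * d - 1 - 2 * d = 0" using mp by (simp add: d_def field_simps)
      have "u + (real n / 2 - 1) * (v + u) - w + (1 - real n) * ((v + u) / 2 + - (y * d) - 2 * d * w)
        = (u - v) / 2 + (real n - 1) * d * y + real n * d * w + w * (real n * d - 1 - 2 * d)" for u v w y
        by (simp add: field_simps)
      then show ?thesis unfolding A c d nd by simp
    qed
    also have "\<dots> = ln (((real n - 2) / real n) powr (1/2) * real m powr ((real n - 1) / (real n - 2)) * Gamma (real m) powr (real n / (real n - 2)))"
      using mp Gamma_m_pos Gamma_m_nz by (simp add: ln_powr ln_mult ln_div)
    finally show "ln (A / Gamma (real m) * Y0 powr (1 - real n)) = \<dots>" .
  qed (use Y0 A_pos mp Gamma_m_pos Gamma_m_nz in auto)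
  have "(\<lambda>k. B m k * x k powr (real m - 1) * Y k powr (1 - real n)) \<longlonglongrightarrow> A / Gamma (real m) * Y0 powr (1 - real n)"
    using r_lim Y0 unfolding Y_def Y0_def[symmetric] by (intro tendsto_intros BM_lim) auto
  then show ?thesis unfolding eq lim .
qed

text \<open>The Gamma recursion arises here: the plateau is B / (2 \<alpha> r^(n-2)), and the limits
  of numerator and denominator leave m Gamma(m).\<close>

lemma C_lim: "(\<lambda>k. C m k * x k powr (- real m)) \<longlonglongrightarrow> Gamma (real m + 1)"
proof -
  have "B m k * x k powr (real m - 1) / (r k m ^ (n - 2) * x k powr (2 * real m - 1)) / (2 * \<alpha>) = C m k * x k powr (- real m)" for k
  proof -
    have "x k powr (real m - 1) = x k powr (- real m) * x k powr (2 * real m - 1)"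
      by (simp add: powr_add[symmetric])
    then show ?thesis unfolding B_def C_def power_n(2)[of "r k m"] using r_pos[of k] x_pos[of k] by simp
  qed
  moreover have "(\<lambda>k. B m k * x k powr (real m - 1) / (r k m ^ (n - 2) * x k powr (2 * real m - 1)) / (2 * \<alpha>))
    \<longlonglongrightarrow> A / Gamma (real m) / (c powr \<alpha> / (m * (Gamma (real m))\<^sup>2)) / (2 * \<alpha>)"
    using c_pos Gamma_m_pos Gamma_m_nz m alpha_pos by (intro tendsto_intros BM_lim r_power_lim) auto
  moreover have "A / Gamma (real m) / (c powr \<alpha> / (m * (Gamma (real m))\<^sup>2)) / (2 * \<alpha>) = Gamma (real m + 1)"
    using c_pos Gamma_m_pos Gamma_m_nz m alpha_pos Gamma_plus1[of "real m"]
    by (simp add: A_def power2_eq_square nonpos_Ints_def)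
  ultimately show ?thesis by simp
qed

lemma Gamma_Suc_pos: "Gamma (real m + 1) > 0"
  by (intro Gamma_real_pos) auto

lemma Gamma_Suc_nz: "Gamma (real m + 1) \<noteq> 0"
  using Gamma_Suc_pos by linarith

text \<open>\<open>B\<close> has order x^(1-m) and \<open>C\<close> order x^m, so the product has
  order x. This yields both the smallness required by \<open>rising_lim\<close> and the vanishing
  energy of the rising piece.\<close>

lemma BC_lim: "(\<lambda>k. B m k * C m k) \<longlonglongrightarrow> 0"
proof -
  have eq: "B m k * x k powr (real m - 1) * (C m k * x k powr (- real m)) * x k = B m k * C m k" for k
  proof -
    have "x k powr (real m - 1) * x k powr (- real m) * x k powr 1 = x k powr ((real m - 1) + (- real m) + 1)"
      by (simp only: powr_add)
    then have "x k powr (real m - 1) * x k powr (- real m) * x k = 1"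
      using x_pos[of k] by simp
    moreover have "B m k * y * (C m k * z) * w = B m k * C m k * (y * z * w)" for y z w by simp
    ultimately show ?thesis by simp
  qed
  have "(\<lambda>k. B m k * x k powr (real m - 1) * (C m k * x k powr (- real m)) * x k) \<longlonglongrightarrow> A / Gamma (real m) * Gamma (real m + 1) * 0"
    by (intro tendsto_intros BM_lim C_lim x_lim)
  then show ?thesis unfolding eq by simp
qed

lemma G_lim: "(\<lambda>k. B m k * C m k powr (q k * \<alpha> - 1)) \<longlonglongrightarrow> 0"
proof -
  have "(\<lambda>k. C m k powr (- \<alpha> * e k)) \<longlonglongrightarrow> 1"
    by (rule powr_e_lim[OF C_pos C_lim Gamma_Suc_pos])
  from tendsto_mult[OF BC_lim this]
  have lim: "(\<lambda>k. B m k * C m k * C m k powr (- \<alpha> * e k)) \<longlonglongrightarrow> 0" by simp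
  have eq: "B m k * C m k * C m k powr (- \<alpha> * e k) = B m k * C m k powr (q k * \<alpha> - 1)" for k
  proof -
    have "q k * \<alpha> - 1 = 1 + - \<alpha> * e k" using alpha_pos by (simp add: q_def algebra_simps)
    then show ?thesis using C_pos[of k] by (simp only: powr_add powr_one)
  qed
  show ?thesis using lim unfolding eq .
qed

lemma W_nz_rising: "r k m < t \<Longrightarrow> t \<le> s k (m + 1) \<Longrightarrow> W k t \<noteq> 0"
  using W_nz[OF m, of k t] s_less_r[of "m + 1" k] by simp

lemma W'_s_Suc: "W' k (s k (m + 1)) = 0"
  by (rule W'_s) simp

lemmas rising = rising_lim[of q W W' "\<lambda>k. r k m" "\<lambda>k. s k (m + 1)", OF sol_q q_less q_lim r_pos r_less_s[OF m]
      W_r[OF m] W'_s_Suc W_nz_rising G_lim[unfolded B_def C_def], folded B_def C_def P_def \<delta>_def M_def]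

lemma M_Suc_lim: "(\<lambda>k. M (m + 1) k * x k powr (- real m)) \<longlonglongrightarrow> Gamma (real m + 1)"
proof -
  have "M (m + 1) k / C m k * (C m k * x k powr (- real m)) = M (m + 1) k * x k powr (- real m)" for k
    using C_pos[of k] by simp
  then show ?thesis using tendsto_mult[OF rising(1) C_lim] by simp
qed

text \<open>The flux balance gives s^n close to n B C^(-q-1). Replacing q by its limit in the
  exponent of x costs x^(m e), which tends to 1.\<close>

lemma s_power_lim: "(\<lambda>k. s k (m + 1) ^ n * x k powr (real m - 1 + real m * (2 / \<alpha> + 1))) \<longlonglongrightarrow>
  n * (A / Gamma (real m)) * Gamma (real m + 1) powr (- (2 / \<alpha> + 1))"
proof -
  define \<theta> where "\<theta> = (\<lambda>k. s k (m + 1) ^ n * C m k powr (q k + 1) / (n * B m k))"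
  have "\<theta> k * (n * (B m k * x k powr (real m - 1))) * (C m k * x k powr (- real m)) powr (- (q k + 1)) * x k powr (m * e k)
    = s k (m + 1) ^ n * x k powr (real m - 1 + real m * (2 / \<alpha> + 1))" for k
  proof -
    have *: "(C m k * x k powr (- real m)) powr (- (q k + 1)) = x k powr (m * (q k + 1)) / C m k powr (q k + 1)"
      unfolding powr_mult powr_powr powr_minus_divide[of "C m k"] minus_mult_minus by simp
    have "real m - 1 + real m * (2 / \<alpha> + 1) = (real m - 1) + m * (q k + 1) + m * e k"
      by (simp add: q_def algebra_simps)
    then have "x k powr (real m - 1 + real m * (2 / \<alpha> + 1)) = x k powr (real m - 1) * x k powr (m * (q k + 1)) * x k powr (m * e k)"
      by (simp only: powr_add)
    then show ?thesis unfolding \<theta>_def * using C_pos[of k] B_pos[of k] n3 by simp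
  qed
  moreover have "(\<lambda>k. \<theta> k * (n * (B m k * x k powr (real m - 1))) * (C m k * x k powr (- real m)) powr (- (q k + 1)) * x k powr (m * e k))
    \<longlonglongrightarrow> 1 * (n * (A / Gamma (real m))) * Gamma (real m + 1) powr (- (2 / \<alpha> + 1)) * 1"
  proof (intro tendsto_intros BM_lim C_lim q_lim)
    show "\<theta> \<longlonglongrightarrow> 1" unfolding \<theta>_def by (rule rising(2))
    \<comment> \<open>Trivially x has order x^1, so \<open>powr_e_lim\<close> applies to x
      itself.\<close>
    have "x k * x k powr (- 1) = 1" for k
      using x_pos[of k] by (simp add: powr_minus)
    then have "(\<lambda>k. x k * x k powr (- 1)) \<longlonglongrightarrow> 1" by simp
    then show "(\<lambda>k. x k powr (m * e k)) \<longlonglongrightarrow> 1" by (rule powr_e_lim[OF x_pos]) simp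
  qed (use Gamma_Suc_pos Gamma_Suc_nz in auto)
  ultimately show ?thesis by simp
qed

lemma s_lim: "(\<lambda>k. s k (m + 1) * x k powr ((2 * real (m + 1) * real n - 3 * real n + 2) / (real n * (real n - 2)))) \<longlonglongrightarrow>
  c powr (1/2) * (real (m + 1) - 1) powr (1 / real n) * Gamma (real (m + 1)) powr (- (2 / (real n - 2)))"
proof -
  have mp: "real m > 0" "real n > 0" "real n - 2 > 0" using m n3 by auto
  have s_pos: "s k (m + 1) > 0" for k using r_pos[of k] r_less_s[OF m, of k] by simp
  have \<alpha>: "2 / \<alpha> = 4 / (real n - 2)" using alpha_pos by (simp add: n_alpha)
  have ex: "(real m - 1 + real m * (2 / \<alpha> + 1)) / n = (2 * real (m + 1) * real n - 3 * real n + 2) / (real n * (real n - 2))"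
    unfolding \<alpha> using mp by (simp add: field_simps)
  have eq: "(s k (m + 1) ^ n * x k powr (real m - 1 + real m * (2 / \<alpha> + 1))) powr (1 / n) =
    s k (m + 1) * x k powr ((2 * real (m + 1) * real n - 3 * real n + 2) / (real n * (real n - 2)))" for k
    unfolding ex[symmetric] using n3 by (intro root_power_mult_powr s_pos x_pos) simp
  have G: "Gamma (real m + 1) = real m * Gamma (real m)"
    using m by (intro Gamma_plus1) (auto simp: nonpos_Ints_def)
  have lim: "(n * (A / Gamma (real m)) * Gamma (real m + 1) powr (- (2 / \<alpha> + 1))) powr (1 / n) =
    c powr (1/2) * real m powr (1 / real n) * Gamma (real m + 1) powr (- (2 / (real n - 2)))"
  proof (rule ln_eqI)
    have A: "ln A = ln (real n - 2) + (real n / 2 - 1) * ln c"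
    proof -
      have "2 * \<alpha> = real n - 2" "\<alpha> = real n / 2 - 1" by (auto simp: n_alpha add_divide_distrib)
      then show ?thesis unfolding A_def using mp c_pos by (simp add: ln_mult ln_powr)
    qed
    have c: "ln c = ln (real n) + ln (real n - 2)"
      using mp by (simp add: c_def n_alpha ln_mult)
    \<comment> \<open>Source of the factor m^(1/n): Gamma(m) is Gamma(m+1) / m.\<close>
    have g: "ln (Gamma (real m)) = ln (Gamma (real m + 1)) - ln (real m)"
      unfolding G using mp Gamma_m_pos Gamma_m_nz by (simp add: ln_mult)
    have "ln ((n * (A / Gamma (real m)) * Gamma (real m + 1) powr (- (2 / \<alpha> + 1))) powr (1 / n))
      = (ln (real n) + (ln A - ln (Gamma (real m))) - (2 / \<alpha> + 1) * ln (Gamma (real m + 1))) / n"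
      using mp A_pos Gamma_m_pos Gamma_m_nz Gamma_Suc_pos Gamma_Suc_nz by (simp add: ln_powr ln_mult ln_div del: minus_add_distrib)
    also have "\<dots> = ln c / 2 + ln (real m) / n - 2 / (real n - 2) * ln (Gamma (real m + 1))"
      unfolding A g c \<alpha> using mp by (simp add: field_simps)
    also have "\<dots> = ln (c powr (1/2) * real m powr (1 / real n) * Gamma (real m + 1) powr (- (2 / (real n - 2))))"
      using mp c_pos Gamma_Suc_pos Gamma_Suc_nz by (simp add: ln_powr ln_mult)
    finally show "ln ((n * (A / Gamma (real m)) * Gamma (real m + 1) powr (- (2 / \<alpha> + 1))) powr (1 / n)) = \<dots>" .
  qed (use mp A_pos c_pos Gamma_m_pos Gamma_m_nz Gamma_Suc_pos Gamma_Suc_nz in auto)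
  have "(\<lambda>k. (s k (m + 1) ^ n * x k powr (real m - 1 + real m * (2 / \<alpha> + 1))) powr (1 / n))
    \<longlonglongrightarrow> (n * (A / Gamma (real m)) * Gamma (real m + 1) powr (- (2 / \<alpha> + 1))) powr (1 / n)"
    using mp A_pos Gamma_m_pos Gamma_m_nz Gamma_Suc_pos Gamma_Suc_nz by (intro tendsto_powr s_power_lim tendsto_const) auto
  then show ?thesis unfolding eq lim by (simp add: add.commute)
qed

lemma invariant_Suc: "invariant (m + 1)"
  unfolding invariant_def
proof (intro conjI)
  show "(\<lambda>k. M (m + 1) k * x k powr (1 - real (m + 1))) \<longlonglongrightarrow> Gamma (real (m + 1))"
    using M_Suc_lim by (simp add: add.commute)
  define \<theta> where "\<theta> = (\<lambda>k. s k (m + 1) ^ n * C m k powr (q k + 1) / (n * B m k))"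
  have s_pos: "s k (m + 1) > 0" for k using r_pos[of k] r_less_s[OF m, of k] by simp
  have M1: "M (m + 1) k > 0" for k by (rule M_pos) simp
  \<comment> \<open>This is (s M^(q/2))^n for index m + 1, since n / 2 = \<alpha> + 1; the
    factorisation shows \<open>G_lim\<close> as the factor that tends to 0.\<close>
  define H where "H = (\<lambda>k. \<theta> k * n * (B m k * C m k powr (q k * \<alpha> - 1)) * (M (m + 1) k / C m k) powr (q k * (\<alpha> + 1)))"
  have \<theta>: "\<theta> \<longlonglongrightarrow> 1" unfolding \<theta>_def by (rule rising(2))
  have H_lim: "H \<longlonglongrightarrow> 1 * real n * 0 * 1 powr (2 / \<alpha> * (\<alpha> + 1))"
    unfolding H_def
    by (rule tendsto_mult[OF tendsto_mult[OF tendsto_mult[OF \<theta> tendsto_const] G_lim]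
        tendsto_powr[OF rising(1) tendsto_mult[OF q_lim tendsto_const] one_neq_zero]])
  have H_pos: "H k > 0" for k
    unfolding H_def \<theta>_def using s_pos[of k] C_pos[of k] B_pos[of k] M1[of k] n3 by simp
  have "H k powr (1 / n) = s k (m + 1) * M (m + 1) k powr (q k / 2)" for k
  proof (rule ln_eqI)
    have "ln (H k) = n * ln (s k (m + 1)) + q k * (\<alpha> + 1) * ln (M (m + 1) k)"
      unfolding H_def \<theta>_def using s_pos[of k] C_pos[of k] B_pos[of k] M1[of k] n3
      by (simp add: ln_powr ln_mult ln_div ln_realpow) (simp add: algebra_simps)
    also have "\<alpha> + 1 = n / 2" by (simp add: n_alpha)
    finally show "ln (H k powr (1 / n)) = ln (s k (m + 1) * M (m + 1) k powr (q k / 2))"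
      using s_pos[of k] M1[of k] H_pos[of k] n3 by (simp add: ln_powr ln_mult field_simps)
  qed (use s_pos[of k] M1[of k] H_pos[of k] in auto)
  moreover have "(\<lambda>k. H k powr (1 / n)) \<longlonglongrightarrow> 0"
    using H_lim H_pos n3 by (intro tendsto_zero_powrI[OF _ tendsto_const]) (auto simp: less_imp_le)
  ultimately show "(\<lambda>k. s k (m + 1) * M (m + 1) k powr (q k / 2)) \<longlonglongrightarrow> 0" by simp
  \<comment> \<open>The energy of the rising piece, squeezed between 0 and C B.\<close>
  define D where "D = (\<lambda>k. (P k (s k (m + 1)) - P k (r k m)) / \<delta> k)"
  have "D \<longlonglongrightarrow> 0"
  proof (rule tendsto_sandwich[OF _ _ tendsto_const])
    show "(\<lambda>k. C m k * B m k) \<longlonglongrightarrow> 0" using BC_lim by (simp add: mult.commute)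
  qed (use rising(5,6) in \<open>auto simp: D_def\<close>)
  have "\<delta> k \<noteq> 0" for k
    using radial_solution.delta_pos[OF sol_q q_less, of k] by (simp add: \<delta>_def)
  then have "D k * (\<delta> k / x k) + P k (r k m) / x k = P k (s k (m + 1)) / x k" for k
    using x_pos[of k] by (simp add: D_def field_simps)
  moreover have "(\<lambda>k. D k * (\<delta> k / x k) + P k (r k m) / x k) \<longlonglongrightarrow> 0 * (\<alpha>\<^sup>2 / (kappa n * n)) + m * (\<alpha> * A)"
    by (intro tendsto_intros \<open>D \<longlonglongrightarrow> 0\<close> \<delta>_lim falling_step(2))
  ultimately show "(\<lambda>k. P k (s k (m + 1)) / x k) \<longlonglongrightarrow> (real (m + 1) - 1) * (\<alpha> * A)" by simp
qed

end

lemma invariant: "1 \<le> m \<Longrightarrow> invariant m"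
proof (induction m rule: nat_induct_at_least)
  case (Suc m)
  then show ?case unfolding Suc_eq_plus1 by (rule invariant_Suc)
qed (rule invariant_1)

end

section \<open>The profile equation\<close>

lemma norm_axis_line_derivative:
  fixes y :: "real^'n::finite"
  assumes "y \<noteq> 0"
  shows "((\<lambda>t. norm (y + t *\<^sub>R axis i 1)) has_real_derivative y $ i / norm y) (at 0)"
proof -
  have "((\<lambda>t. y + t *\<^sub>R axis i 1) has_vector_derivative (axis i 1 :: real^'n)) (at 0)"
    by (auto intro!: derivative_eq_intros)
  then have "((\<lambda>t. y + t *\<^sub>R axis i 1) has_derivative (\<lambda>t. t *\<^sub>R (axis i 1 :: real^'n))) (at 0)"
    by (simp add: has_vector_derivative_def)
  moreover have "(norm has_derivative (\<lambda>h. h \<bullet> sgn y)) (at (y + 0 *\<^sub>R axis i 1))"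
    using has_derivative_norm[OF assms] by simp
  ultimately have "((\<lambda>t. norm (y + t *\<^sub>R axis i 1)) has_derivative (\<lambda>t. (t *\<^sub>R axis i 1) \<bullet> sgn y)) (at 0)"
    using has_derivative_compose[of "\<lambda>t. y + t *\<^sub>R axis i 1" _ 0 UNIV norm] by fastforce
  moreover have "(\<lambda>t. (t *\<^sub>R axis i 1) \<bullet> sgn y) = (*) (y $ i / norm y)"
    by (rule ext) (simp add: sgn_div_norm inner_axis' divide_inverse mult_ac)
  ultimately show ?thesis by (simp only: has_field_derivative_def)
qed

lemma partial_deriv_radial:
  fixes y :: "real^'n::finite"
  assumes "y \<noteq> 0" "(w has_real_derivative d) (at (norm y))"
  shows "partial_deriv i (\<lambda>x. w (norm x)) y = d * (y $ i / norm y)"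
  unfolding partial_deriv_def
  using DERIV_chain2[of w d "\<lambda>t. norm (y + t *\<^sub>R axis i 1)" 0, OF _ norm_axis_line_derivative[OF assms(1), of i]] assms(2)
  by (simp add: DERIV_imp_deriv)

lemma laplacian_radial:
  fixes y :: "real^'n::finite" and w w' :: "real \<Rightarrow> real"
  assumes y: "y \<noteq> 0" and w: "\<And>\<rho>. 0 < \<rho> \<Longrightarrow> (w has_real_derivative w' \<rho>) (at \<rho>)"
    and w': "(w' has_real_derivative d) (at (norm y))"
  shows "laplacian (\<lambda>x. w (norm x)) y = d + (real CARD('n) - 1) / norm y * w' (norm y)"
proof -
  define \<rho> where "\<rho> = norm y"
  have \<rho>: "\<rho> > 0" using y by (simp add: \<rho>_def)
  have snd_partial: "partial_deriv i (partial_deriv i (\<lambda>x. w (norm x))) y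
    = d * (y $ i)\<^sup>2 / \<rho>\<^sup>2 + w' \<rho> * (1 / \<rho> - (y $ i)\<^sup>2 / \<rho> ^ 3)" for i
  proof -
    define l where "l = (\<lambda>t. y + t *\<^sub>R axis i 1)"
    have nl: "((\<lambda>t. norm (l t)) has_real_derivative y $ i / \<rho>) (at 0)"
      unfolding l_def \<rho>_def by (rule norm_axis_line_derivative[OF y])
    have l0: "norm (l 0) = \<rho>" by (simp add: l_def \<rho>_def)
    have cl: "continuous (at 0) (\<lambda>t. norm (l t))" using DERIV_isCont[OF nl] .
    have "((\<lambda>t. norm (l t)) \<longlongrightarrow> \<rho>) (at 0)" using cl l0 by (simp add: continuous_at)
    then have "\<forall>\<^sub>F t in at 0. 0 < norm (l t)" using \<rho> by (rule order_tendstoD)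
    then have "\<forall>\<^sub>F t in nhds 0. 0 < norm (l t)"
      unfolding eventually_nhds_conv_at l0 using \<rho> by blast
    \<comment> \<open>Near t = 0 the point \<open>l t\<close> is nonzero, so the first partial
      derivative may be replaced by its closed form before the second differentiation.\<close>
    then have ev: "\<forall>\<^sub>F t in nhds 0. w' (norm (l t)) * ((y $ i + t) / norm (l t)) = partial_deriv i (\<lambda>x. w (norm x)) (l t)"
    proof eventually_elim
      case (elim t)
      have "l t \<noteq> 0" using elim by auto
      then show ?case
        using partial_deriv_radial[of "l t" w "w' (norm (l t))" i] w[OF elim] by (simp add: l_def axis_def)
    qed
    have "((\<lambda>t. w' (norm (l t)) * ((y $ i + t) / norm (l t))) has_real_derivative
      d * (y $ i / \<rho>) * ((y $ i + 0) / norm (l 0)) + ((1 * norm (l 0) - (y $ i + 0) * (y $ i / \<rho>)) / (norm (l 0) * norm (l 0))) * w' (norm (l 0))) (at 0)"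
    proof (rule DERIV_mult)
      show "((\<lambda>t. w' (norm (l t))) has_real_derivative d * (y $ i / \<rho>)) (at 0)"
        using DERIV_chain2[of w' d "\<lambda>t. norm (l t)" 0, OF _ nl] w' l0 by (simp add: \<rho>_def)
      show "((\<lambda>t. (y $ i + t) / norm (l t)) has_real_derivative
        (1 * norm (l 0) - (y $ i + 0) * (y $ i / \<rho>)) / (norm (l 0) * norm (l 0))) (at 0)"
        using \<rho> l0 by (intro DERIV_divide nl) (auto intro!: derivative_eq_intros)
    qed
    also have "d * (y $ i / \<rho>) * ((y $ i + 0) / norm (l 0)) + ((1 * norm (l 0) - (y $ i + 0) * (y $ i / \<rho>)) / (norm (l 0) * norm (l 0))) * w' (norm (l 0))
      = d * (y $ i)\<^sup>2 / \<rho>\<^sup>2 + w' \<rho> * (1 / \<rho> - (y $ i)\<^sup>2 / \<rho> ^ 3)"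
      unfolding l0 using \<rho> by (simp add: field_simps power2_eq_square power3_eq_cube)
    finally have "((\<lambda>t. partial_deriv i (\<lambda>x. w (norm x)) (l t)) has_real_derivative
      d * (y $ i)\<^sup>2 / \<rho>\<^sup>2 + w' \<rho> * (1 / \<rho> - (y $ i)\<^sup>2 / \<rho> ^ 3)) (at 0)"
      using DERIV_cong_ev[OF refl ev refl] by blast
    then show ?thesis unfolding partial_deriv_def[of i "partial_deriv i (\<lambda>x. w (norm x))"] l_def
      by (rule DERIV_imp_deriv)
  qed
  have sq: "(\<Sum>i\<in>UNIV. (y $ i)\<^sup>2) = \<rho>\<^sup>2"
    by (simp add: \<rho>_def norm_vec_def L2_set_def sum_nonneg)
  have "laplacian (\<lambda>x. w (norm x)) y
    = (\<Sum>i\<in>UNIV. d / \<rho>\<^sup>2 * (y $ i)\<^sup>2 + (w' \<rho> / \<rho> - w' \<rho> / \<rho> ^ 3 * (y $ i)\<^sup>2))"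
    unfolding laplacian_def snd_partial by (simp add: algebra_simps)
  also have "\<dots> = d / \<rho>\<^sup>2 * \<rho>\<^sup>2 + (real CARD('n) * (w' \<rho> / \<rho>) - w' \<rho> / \<rho> ^ 3 * \<rho>\<^sup>2)"
    by (simp only: sum.distrib sum_subtractf sum_distrib_left[symmetric] sq sum_constant)
  also have "\<dots> = d + (real CARD('n) - 1) / \<rho> * w' \<rho>"
    using \<rho> by (simp add: field_simps power2_eq_square power3_eq_cube)
  finally show ?thesis by (simp add: \<rho>_def)
qed

lemma classical_solution_radial:
  fixes w :: "real \<Rightarrow> real"
  assumes n: "n = CARD('n::finite)" "n \<ge> 3" and p: "0 < p" "p \<le> 4 / (real n - 2)"
    and C2: "C2_on {0..} w" and sol: "classical_solution p (\<lambda>x :: real^'n. w (norm x))"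
  obtains w' where "radial_solution n p w w'"
    and "\<And>\<rho>. 0 \<le> \<rho> \<Longrightarrow> (w has_real_derivative w' \<rho>) (at \<rho> within {0..})"
proof -
  obtain D D2 where D: "\<And>x. 0 \<le> x \<Longrightarrow> (w has_derivative blinfun_apply (D x)) (at x within {0..})"
    and D2: "\<And>x. 0 \<le> x \<Longrightarrow> (D has_derivative blinfun_apply (D2 x)) (at x within {0..})"
    using C2 unfolding C2_on_def by auto
  define w' where "w' = (\<lambda>x. blinfun_apply (D x) 1)"
  define w'' where "w'' = (\<lambda>x. blinfun_apply (blinfun_apply (D2 x) 1) 1)"
  have w: "(w has_real_derivative w' \<rho>) (at \<rho> within {0..})" if "0 \<le> \<rho>" for \<rho>
  proof -
    have "blinfun_apply (D \<rho>) t = w' \<rho> * t" for t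
      using blinfun.scaleR_right[of "D \<rho>" t 1] by (simp add: w'_def mult.commute)
    then have "blinfun_apply (D \<rho>) = (*) (w' \<rho>)" by (rule ext)
    then show ?thesis using D[OF that] by (simp add: has_field_derivative_def)
  qed
  have w': "(w' has_real_derivative w'' \<rho>) (at \<rho> within {0..})" if "0 \<le> \<rho>" for \<rho>
  proof -
    have "(w' has_derivative (\<lambda>t. blinfun_apply (blinfun_apply (D2 \<rho>) t) 1)) (at \<rho> within {0..})"
      unfolding w'_def using blinfun.FDERIV[OF D2[OF that] has_derivative_const[of 1]] by (simp add: blinfun.zero_right)
    moreover have "blinfun_apply (blinfun_apply (D2 \<rho>) t) 1 = w'' \<rho> * t" for t
      using blinfun.scaleR_right[of "D2 \<rho>" t 1] by (simp add: w''_def blinfun.scaleR_left mult.commute)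
    ultimately show ?thesis by (simp add: has_field_derivative_def)
  qed
  have at: "at \<rho> within {0..} = at \<rho>" if "0 < \<rho>" for \<rho> :: real
    using that by (intro at_within_interior) (auto simp: interior_real_atLeast)
  have wi: "(w has_real_derivative w' \<rho>) (at \<rho>)" "(w' has_real_derivative w'' \<rho>) (at \<rho>)" if "0 < \<rho>" for \<rho>
    using w[of \<rho>] w'[of \<rho>] that at[OF that] by auto
  have ode: "w'' \<rho> = - (real n - 1) / \<rho> * w' \<rho> - \<bar>w \<rho>\<bar> powr p * w \<rho>" if "0 < \<rho>" for \<rho>
  proof -
    obtain i :: 'n where True by simp
    \<comment> \<open>By radial symmetry one point of norm \<rho>, on a coordinate axis, gives the
      full profile equation.\<close>
    define y :: "real^'n" where "y = \<rho> *\<^sub>R axis i 1"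
    have y: "norm y = \<rho>" "y \<noteq> 0" using that by (auto simp: y_def norm_axis_1 axis_eq_0_iff)
    have "laplacian (\<lambda>x. w (norm x)) y = w'' \<rho> + (real n - 1) / \<rho> * w' \<rho>"
      using laplacian_radial[OF y(2) wi(1), of "w'' \<rho>"] wi(2)[OF that] y(1) n(1) by simp
    moreover have "- laplacian (\<lambda>x. w (norm x)) y = \<bar>w (norm y)\<bar> powr p * w (norm y)"
      using sol unfolding classical_solution_def by blast
    moreover have "- (real n - 1) / \<rho> * w' \<rho> = - ((real n - 1) / \<rho> * w' \<rho>)"
      by (simp add: left_diff_distrib diff_divide_distrib)
    ultimately show ?thesis unfolding y(1) by linarith
  qed
  interpret dimension n by unfold_locales (rule n(2))
  have "radial_solution n p w w'"
  proof
    show "p * \<alpha> \<le> 2" using p n(2) by (simp add: \<alpha>_def field_simps)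
    show "continuous_on {0..} w" "continuous_on {0..} w'"
      using w w' by (auto intro: DERIV_continuous_on)
  qed (use wi ode p in auto)
  with w that show thesis by blast
qed

text \<open>Turns a complete increasing list of zeros into nonvanishing before the first zero and
  between neighbours.\<close>

lemma strict_mono_sequence_gap:
  fixes r :: "nat \<Rightarrow> real"
  assumes "\<And>i. 1 \<le> i \<Longrightarrow> r i < r (i + 1)" "1 \<le> m" "1 \<le> j"
  shows "\<not> (r m < r j \<and> r j < r (m + 1))" and "r 1 \<le> r j"
proof -
  have mono: "r i \<le> r k" if "1 \<le> i" "i \<le> k" for i k
    using that(2,1)
  proof (induction k rule: dec_induct)
    case (step k)
    then show ?case using assms(1)[of k] unfolding Suc_eq_plus1 by simp
  qed simp
  show "\<not> (r m < r j \<and> r j < r (m + 1))"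
  proof (cases "j \<le> m")
    case True
    then show ?thesis using mono[of j m] assms(3) by simp
  next
    case False
    then show ?thesis using mono[of "m + 1" j] assms(2) by simp
  qed
  show "r 1 \<le> r j" using mono[of 1 j] assms(3) by simp
qed

theorem corollary1p6:
  fixes n :: nat
    and w :: "real \<Rightarrow> real \<Rightarrow> real"
    and r s :: "real \<Rightarrow> nat \<Rightarrow> real"
  assumes dim: "n = CARD('n::finite)" "n \<ge> 3"
    and profile: "\<And>\<epsilon>. \<epsilon> \<in> {0<..<4 / (real n - 2)} \<Longrightarrow> C2_on {0..} (w \<epsilon>)"
    and solution: "\<And>\<epsilon>. \<epsilon> \<in> {0<..<4 / (real n - 2)} \<Longrightarrow>
        classical_solution (4 / (real n - 2) - \<epsilon>) (\<lambda>x :: real^'n. w \<epsilon> (norm x))"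
    and initial: "\<And>\<epsilon>. \<epsilon> \<in> {0<..<4 / (real n - 2)} \<Longrightarrow> w \<epsilon> 0 = 1"
    and all_zeros: "\<And>\<epsilon>. \<epsilon> \<in> {0<..<4 / (real n - 2)} \<Longrightarrow> r \<epsilon> ` {1..} = zeros (w \<epsilon>)"
    and all_critical: "\<And>\<epsilon>. \<epsilon> \<in> {0<..<4 / (real n - 2)} \<Longrightarrow> s \<epsilon> ` {1..} = critical_points (w \<epsilon>)"
    and divergent: "\<And>\<epsilon>. \<epsilon> \<in> {0<..<4 / (real n - 2)} \<Longrightarrow>
        filterlim (r \<epsilon>) at_top sequentially \<and> filterlim (s \<epsilon>) at_top sequentially"
    and interlacing: "\<And>\<epsilon>. \<epsilon> \<in> {0<..<4 / (real n - 2)} \<Longrightarrow>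
        s \<epsilon> 1 = 0 \<and> (\<forall>i\<ge>1. s \<epsilon> i < r \<epsilon> i \<and> r \<epsilon> i < s \<epsilon> (i + 1))"
  shows "(\<forall>m\<ge>1. ((\<lambda>\<epsilon>. r \<epsilon> m * (kappa n * \<epsilon>) powr ((2 * real m - 1) / (real n - 2)))
            \<longlongrightarrow> (real n * (real n - 2)) powr (1/2) * real m powr (1 / (2 - real n))
                * Gamma (real m) powr (- (2 / (real n - 2)))) (at_right 0))
    \<and> (\<forall>m\<ge>1. ((\<lambda>\<epsilon>. \<bar>deriv (w \<epsilon>) (r \<epsilon> m)\<bar>
                * (kappa n * \<epsilon>) powr ((1 - real m * real n) / (real n - 2)))
            \<longlongrightarrow> ((real n - 2) / real n) powr (1/2) * real m powr ((real n - 1) / (real n - 2))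
                * Gamma (real m) powr (real n / (real n - 2))) (at_right 0))
    \<and> (\<forall>m\<ge>2. ((\<lambda>\<epsilon>. s \<epsilon> m * (kappa n * \<epsilon>) powr
                  ((2 * real m * real n - 3 * real n + 2) / (real n * (real n - 2))))
            \<longlongrightarrow> (real n * (real n - 2)) powr (1/2) * (real m - 1) powr (1 / real n)
                * Gamma (real m) powr (- (2 / (real n - 2)))) (at_right 0))
    \<and> (\<forall>m\<ge>2. ((\<lambda>\<epsilon>. \<bar>w \<epsilon> (s \<epsilon> m)\<bar> * (kappa n * \<epsilon>) powr (1 - real m))
            \<longlongrightarrow> Gamma (real m)) (at_right 0))"
proof -
  interpret dimension n by unfold_locales (rule dim(2))
  define b where "b = 4 / (real n - 2)"
  have b: "b > 0" "b = 2 / \<alpha>" using alpha_pos by (auto simp: b_def n_alpha)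
  \<comment> \<open>Restricting to 0 < \<epsilon> < b confines the test sequences to the parameters
    for which a solution is given.\<close>
  have at: "at_right 0 = at 0 within {0<..<b}"
    using b(1) by (intro at_within_nhd[of _ "{..<b}"]) auto
  have seq: "((\<lambda>\<epsilon>. f \<epsilon>) \<longlongrightarrow> L) (at_right 0)"
    if "\<And>X. (\<And>k. X k \<in> {0<..<b}) \<Longrightarrow> X \<longlonglongrightarrow> 0 \<Longrightarrow> (\<lambda>k. f (X k)) \<longlonglongrightarrow> L"
    for f :: "real \<Rightarrow> real" and L
    unfolding at tendsto_at_iff_sequentially using that by (auto simp: o_def)
  have nodal: "\<exists>W'. nodal_sequence n X (\<lambda>k. w (X k)) W' (\<lambda>k. r (X k)) (\<lambda>k. s (X k))
      \<and> (\<forall>k. \<forall>m\<ge>1. W' k (r (X k) m) = deriv (w (X k)) (r (X k) m))"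
    if X: "\<And>k. X k \<in> {0<..<b}" "X \<longlonglongrightarrow> 0" for X
  proof -
    have "\<exists>v. radial_solution n (2 / \<alpha> - X k) (w (X k)) v \<and>
      (\<forall>\<rho>\<ge>0. (w (X k) has_real_derivative v \<rho>) (at \<rho> within {0..}))" for k
    proof -
      have Xk: "X k \<in> {0<..<4 / (real n - 2)}" using X(1)[of k] by (simp add: b_def)
      obtain v where "radial_solution n (4 / (real n - 2) - X k) (w (X k)) v"
        "\<And>\<rho>. 0 \<le> \<rho> \<Longrightarrow> (w (X k) has_real_derivative v \<rho>) (at \<rho> within {0..})"
        using classical_solution_radial[OF dim, of "4 / (real n - 2) - X k" "w (X k)"]
          profile[OF Xk] solution[OF Xk] Xk by auto
      then show ?thesis using b by (auto simp: b_def)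
    qed
    then obtain W' where sol: "\<And>k. radial_solution n (2 / \<alpha> - X k) (w (X k)) (W' k)"
      and W': "\<And>k \<rho>. 0 \<le> \<rho> \<Longrightarrow> (w (X k) has_real_derivative W' k \<rho>) (at \<rho> within {0..})"
      by metis
    have Xk: "X k \<in> {0<..<4 / (real n - 2)}" for k using X(1)[of k] by (simp add: b_def)
    have inter: "s (X k) m < r (X k) m" "r (X k) m < s (X k) (m + 1)" if "1 \<le> m" for k m
      using interlacing[OF Xk[of k]] that by auto
    have zero: "0 \<le> t \<and> w (X k) t = 0 \<longleftrightarrow> (\<exists>j\<ge>1. t = r (X k) j)" for k t
      using all_zeros[OF Xk[of k]] unfolding zeros_def by (auto simp: set_eq_iff image_iff)
    have mono: "r (X k) i < r (X k) (i + 1)" if "1 \<le> i" for k i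
      using inter(2)[OF that, of k] inter(1)[of "i + 1" k] by simp
    have r_pos: "0 < r (X k) m" if "1 \<le> m" for k m
      using strict_mono_sequence_gap(2)[of "r (X k)" 1 m, OF mono _ that] inter(1)[of 1 k]
        interlacing[OF Xk[of k]] by auto
    have "nodal_sequence n X (\<lambda>k. w (X k)) W' (\<lambda>k. r (X k)) (\<lambda>k. s (X k))"
    proof (intro nodal_sequence.intro nodal_sequence_axioms.intro dimension_axioms)
      fix k
      show "0 < X k" using X(1)[of k] by simp
      show "w (X k) 0 = 1" by (rule initial[OF Xk])
      show "s (X k) 1 = 0" using interlacing[OF Xk[of k]] by simp
      fix m :: nat assume m: "1 \<le> m"
      show "w (X k) (r (X k) m) = 0" using zero[of "r (X k) m" k] m by blast
      have "s (X k) m \<in> critical_points (w (X k))" using all_critical[OF Xk[of k]] m by blast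
      then have *: "0 \<le> s (X k) m" "(w (X k) has_real_derivative 0) (at (s (X k) m) within {0..})"
        by (auto simp: critical_points_def)
      \<comment> \<open>At the critical point 0 the derivative is one-sided; uniqueness needs 0 to
        be a limit point of the half-line.\<close>
      have "\<nexists>a. {0..} = {a::real}"
        using infinite_Ici[of "0::real"] by (metis finite.emptyI finite.insertI)
      then have nontriv: "at (s (X k) m) within {0..} \<noteq> bot"
        unfolding trivial_limit_within
        using *(1) connected_imp_perfect[of "{0..}" "s (X k) m"] by auto
      show "W' k (s (X k) m) = 0"
        using has_field_derivative_unique[OF W'[OF *(1)] *(2) nontriv] by simp
      show "w (X k) t \<noteq> 0" if "r (X k) m < t" "t < r (X k) (m + 1)" for t
        using zero[of t k] strict_mono_sequence_gap(1)[of "r (X k)" m, OF mono m] that r_pos[OF m, of k] by force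
    next
      fix k t assume "0 \<le> t" "t < r (X k) 1"
      then show "w (X k) t \<noteq> 0"
        using zero[of t k] strict_mono_sequence_gap(2)[of "r (X k)" 1, OF mono] by force
    qed (use sol X inter in auto)
    moreover have "W' k (r (X k) m) = deriv (w (X k)) (r (X k) m)" if "1 \<le> m" for k m
      using radial_solution.W_deriv[OF sol[of k] r_pos[OF that, of k]] by (simp add: DERIV_imp_deriv)
    ultimately show ?thesis by blast
  qed
  show ?thesis
  proof (intro conjI allI impI seq)
    fix m :: nat and X assume m: "1 \<le> m" and X: "\<And>k. X k \<in> {0<..<b}" "X \<longlonglongrightarrow> 0"
    obtain W' where "nodal_sequence n X (\<lambda>k. w (X k)) W' (\<lambda>k. r (X k)) (\<lambda>k. s (X k))"
      and W': "\<forall>k. \<forall>m\<ge>1. W' k (r (X k) m) = deriv (w (X k)) (r (X k) m)"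
      using nodal[OF X] by blast
    then interpret N: nodal_sequence n X "\<lambda>k. w (X k)" W' "\<lambda>k. r (X k)" "\<lambda>k. s (X k)" by simp
    have c: "c = real n * (real n - 2)" by (simp add: c_def n_alpha)
    show "(\<lambda>k. r (X k) m * (kappa n * X k) powr ((2 * real m - 1) / (real n - 2)))
        \<longlonglongrightarrow> (real n * (real n - 2)) powr (1 / 2) * real m powr (1 / (2 - real n))
          * Gamma (real m) powr (- (2 / (real n - 2)))"
      using N.r_lim[OF m N.invariant[OF m]] by (simp add: N.x_def c)
    show "(\<lambda>k. \<bar>deriv (w (X k)) (r (X k) m)\<bar> * (kappa n * X k) powr ((1 - real m * real n) / (real n - 2)))
        \<longlonglongrightarrow> ((real n - 2) / real n) powr (1 / 2) * real m powr ((real n - 1) / (real n - 2))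
          * Gamma (real m) powr (real n / (real n - 2))"
      using N.W'_r_lim[OF m N.invariant[OF m]] W' m by (simp add: N.x_def)
  next
    fix m :: nat and X assume m2: "2 \<le> m" and X: "\<And>k. X k \<in> {0<..<b}" "X \<longlonglongrightarrow> 0"
    \<comment> \<open>\<open>s_lim\<close> concerns the critical point after the j-th zero, hence
      the shift by one and the restriction to m at least 2.\<close>
    define j where "j = m - 1"
    have j: "1 \<le> j" "m = j + 1" using m2 by (auto simp: j_def)
    obtain W' where "nodal_sequence n X (\<lambda>k. w (X k)) W' (\<lambda>k. r (X k)) (\<lambda>k. s (X k))"
      using nodal[OF X] by blast
    then interpret N: nodal_sequence n X "\<lambda>k. w (X k)" W' "\<lambda>k. r (X k)" "\<lambda>k. s (X k)" .
    have c: "c = real n * (real n - 2)" by (simp add: c_def n_alpha)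
    show "(\<lambda>k. s (X k) m * (kappa n * X k) powr ((2 * real m * real n - 3 * real n + 2) / (real n * (real n - 2))))
        \<longlonglongrightarrow> (real n * (real n - 2)) powr (1 / 2) * (real m - 1) powr (1 / real n)
          * Gamma (real m) powr (- (2 / (real n - 2)))"
      using N.s_lim[OF j(1) N.invariant[OF j(1)]] unfolding j(2)[symmetric] N.x_def c .
    show "(\<lambda>k. \<bar>w (X k) (s (X k) m)\<bar> * (kappa n * X k) powr (1 - real m)) \<longlonglongrightarrow> Gamma (real m)"
      using N.invariant[of m] m2 by (simp add: N.invariant_def N.M_def N.x_def)
  qed
qed

end
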